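(* There is a function $e:\mathbb R^+\to\mathbb N$ and a polynomial $p$ in two variables (with $p\ge 1$ on positive integers) such that, assuming the Strong Exponential Time Hypothesis (SETH), for every integer $k\ge 2$ and every $\varepsilon>0$, no $O(n^{k-\varepsilon})$-time algorithm can approximate $k$-Dominating Set to within a factor of $(\log n)^{1/p(k,e(\varepsilon))}$; that is, there is no algorithm that, given a graph $G$ on $n\geq 2$ vertices, runs in time $O(n^{k-\varepsilon})$ and, whenever the minimum dominating set of $G$ has size at most $k$, outputs a dominating set of $G$ of size at most $(\log n)^{1/p(k,e(\varepsilon))}\cdot k$.
   Context: Logarithms are base 2. A dominating set of an undirected graph $G$ is a set $S\subseteq V(G)$ such that every vertex outside $S$ has a neighbor in $S$. SETH: for every $\varepsilon>0$ there exists $w=w(\varepsilon)\in\mathbb N$ such that no algorithm can solve $w$-SAT (satisfiability of CNF formulae with at most $w$ literals per clause) in $O(2^{(1-\varepsilon)n})$ time, where $n$ is the number of variables; moreover, this holds even when the number of clauses is at most $c(\varepsilon)\cdot n$, where $c(\varepsilon)$ is a constant depending only on $\varepsilon$. *)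

theory Defs
  imports
    Complex_Main
    "HOL-Library.Landau_Symbols"
    "HOL-Library.Log_Nat"
    "HOL-Computational_Algebra.Polynomial"
begin

section \<open>Random access machines\<close>

text \<open>
  An algorithm is a program of a deterministic RAM with addition, truncated subtraction,
  multiplication and integer division, and its running time is measured by the logarithmic cost
  criterion. A unit-cost charge for arithmetic on unbounded integers would be unreasonable here,
  whereas a word RAM whose word length is logarithmic in the running time agrees with this model up
  to polylogarithmic factors. Such factors are absorbed by the quantification over all
  \<open>\<epsilon> > 0\<close>, both in SETH and in time bounds of the form \<open>O(n\<^sup>k\<^sup>-\<^sup>\<epsilon>)\<close>.

  The input is a read-only array with random access, so that an algorithm need not read all of its
  input; this matters for running times below \<open>n\<^sup>2\<close> on graphs with \<open>n\<close> vertices. The output is a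
  write-only sequence. Registers are numbered by natural numbers and are initially 0.
\<close>

datatype instr =
    Const nat nat    \<comment> \<open>\<open>Const d c\<close>: \<open>R[d] := c\<close>\<close>
  | Add nat nat nat  \<comment> \<open>\<open>Add d a b\<close>: \<open>R[d] := R[a] + R[b]\<close>; similarly for the next three\<close>
  | Sub nat nat nat
  | Mul nat nat nat
  | Div nat nat nat
  | Load nat nat     \<comment> \<open>\<open>Load d s\<close>: \<open>R[d] := R[R[s]]\<close>\<close>
  | Store nat nat    \<comment> \<open>\<open>Store d s\<close>: \<open>R[R[d]] := R[s]\<close>\<close>
  | Input nat nat    \<comment> \<open>\<open>Input d s\<close>: \<open>R[d] := x[R[s]]\<close>, where \<open>x\<close> is the input array\<close>
  | Output nat       \<comment> \<open>\<open>Output s\<close>: append \<open>R[s]\<close> to the output\<close>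
  | Jz nat nat       \<comment> \<open>\<open>Jz s l\<close>: continue at instruction \<open>l\<close> if \<open>R[s] = 0\<close>\<close>

type_synonym program = "instr list"

text \<open>Program counter, registers, output produced so far.\<close>
type_synonym config = "nat \<times> (nat \<Rightarrow> nat) \<times> nat list"

definition input_at :: "nat list \<Rightarrow> nat \<Rightarrow> nat" where
  "input_at x i = (if i < length x then x ! i else 0)"

fun step :: "nat list \<Rightarrow> instr \<Rightarrow> config \<Rightarrow> config" where
  "step x (Const d c) (pc, R, out) = (Suc pc, R(d := c), out)"
| "step x (Add d a b) (pc, R, out) = (Suc pc, R(d := R a + R b), out)"
| "step x (Sub d a b) (pc, R, out) = (Suc pc, R(d := R a - R b), out)"
| "step x (Mul d a b) (pc, R, out) = (Suc pc, R(d := R a * R b), out)"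
| "step x (Div d a b) (pc, R, out) = (Suc pc, R(d := R a div R b), out)"
| "step x (Load d s) (pc, R, out) = (Suc pc, R(d := R (R s)), out)"
| "step x (Store d s) (pc, R, out) = (Suc pc, R(R d := R s), out)"
| "step x (Input d s) (pc, R, out) = (Suc pc, R(d := input_at x (R s)), out)"
| "step x (Output s) (pc, R, out) = (Suc pc, R, out @ [R s])"
| "step x (Jz s l) (pc, R, out) = ((if R s = 0 then l else Suc pc), R, out)"

text \<open>
  \<open>floorlog 2 m\<close> is the number of binary digits of \<open>m\<close> (0 for \<open>m = 0\<close>); the successor makes every
  instruction cost at least one.
\<close>
definition lcost :: "nat \<Rightarrow> nat" where
  "lcost m = Suc (floorlog 2 m)"

text \<open>
  The register numbers and jump targets written in an instruction are constants of the program and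
  are not charged for: they would change the cost by a constant factor only.
\<close>
fun cost :: "nat list \<Rightarrow> instr \<Rightarrow> (nat \<Rightarrow> nat) \<Rightarrow> nat" where
  "cost x (Const d c) R = lcost c"
| "cost x (Add d a b) R = lcost (R a) + lcost (R b)"
| "cost x (Sub d a b) R = lcost (R a) + lcost (R b)"
| "cost x (Mul d a b) R = lcost (R a) + lcost (R b)"
| "cost x (Div d a b) R = lcost (R a) + lcost (R b)"
| "cost x (Load d s) R = lcost (R s) + lcost (R (R s))"
| "cost x (Store d s) R = lcost (R d) + lcost (R s)"
| "cost x (Input d s) R = lcost (R s) + lcost (input_at x (R s))"
| "cost x (Output s) R = lcost (R s)"
| "cost x (Jz s l) R = lcost (R s)"

text \<open>
  \<open>runs P x c t y\<close>: started in configuration \<open>c\<close> on input \<open>x\<close>, program \<open>P\<close> halts after instructions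
  of total cost \<open>t\<close>, with output \<open>y\<close>. A program halts when its program counter leaves it.
\<close>
inductive runs :: "program \<Rightarrow> nat list \<Rightarrow> config \<Rightarrow> nat \<Rightarrow> nat list \<Rightarrow> bool"
  for P :: program and x :: "nat list" where
  halt: "length P \<le> pc \<Longrightarrow> runs P x (pc, R, out) 0 out"
| next_instr: "pc < length P \<Longrightarrow> runs P x (step x (P ! pc) (pc, R, out)) t y
    \<Longrightarrow> runs P x (pc, R, out) (cost x (P ! pc) R + t) y"

definition computes :: "program \<Rightarrow> nat list \<Rightarrow> nat \<Rightarrow> nat list \<Rightarrow> bool" where
  "computes P x t y \<longleftrightarrow> runs P x (0, \<lambda>_. 0, []) t y"


section \<open>The Strong Exponential Time Hypothesis\<close>

type_synonym literal = "nat \<times> bool"  \<comment> \<open>a variable and the value that makes the literal true\<close>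
type_synonym clause = "literal list"
type_synonym cnf = "clause list"

text \<open>
  Variables are \<open>0, \<dots>, n - 1\<close>. A formula is a set of clauses and a clause a set of literals, each
  listed in arbitrary order without repetition.
\<close>
definition w_cnf :: "nat \<Rightarrow> nat \<Rightarrow> cnf \<Rightarrow> bool" where
  "w_cnf w n F \<longleftrightarrow> distinct (map set F) \<and>
     (\<forall>C\<in>set F. distinct C \<and> length C \<le> w \<and> (\<forall>(v, b)\<in>set C. v < n))"

definition satisfiable :: "cnf \<Rightarrow> bool" where
  "satisfiable F \<longleftrightarrow> (\<exists>\<alpha> :: nat \<Rightarrow> bool. \<forall>C\<in>set F. \<exists>(v, b)\<in>set C. \<alpha> v = b)"

definition cnf_input :: "nat \<Rightarrow> cnf \<Rightarrow> nat list" where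
  "cnf_input n F = n # length F #
     concat (map (\<lambda>C. length C # map (\<lambda>(v, b). 2 * v + of_bool b) C) F)"

text \<open>
  Satisfiability of the instances \<open>F\<close> on \<open>n\<close> variables with \<open>I n F\<close> is decidable in time
  \<open>O(2\<^sup>(\<^sup>1\<^sup>-\<^sup>\<epsilon>\<^sup>)\<^sup>n)\<close>.
\<close>
definition SAT_in_time :: "real \<Rightarrow> (nat \<Rightarrow> cnf \<Rightarrow> bool) \<Rightarrow> bool" where
  "SAT_in_time \<epsilon> I \<longleftrightarrow> (\<exists>(P :: program) (T :: nat \<Rightarrow> nat).
     (\<lambda>n. real (T n)) \<in> O(\<lambda>n. 2 powr ((1 - \<epsilon>) * real n)) \<and>
     (\<forall>n F. I n F \<longrightarrow> (\<exists>t \<le> T n. computes P (cnf_input n F) t [of_bool (satisfiable F)])))"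

definition SETH :: bool where
  "SETH \<longleftrightarrow> (\<forall>\<epsilon> :: real. \<epsilon> > 0 \<longrightarrow> (\<exists>w.
     \<not> SAT_in_time \<epsilon> (w_cnf w) \<and>
     (\<exists>c :: real. \<not> SAT_in_time \<epsilon> (\<lambda>n F. w_cnf w n F \<and> real (length F) \<le> c * real n))))"


section \<open>Approximating \<open>k\<close>-Dominating Set\<close>

definition simple_graph :: "nat \<Rightarrow> (nat \<times> nat) set \<Rightarrow> bool" where
  "simple_graph n E \<longleftrightarrow> E \<subseteq> {..<n} \<times> {..<n} \<and> sym E \<and> irrefl E"

definition dominating_set :: "'a set \<Rightarrow> ('a \<times> 'a) set \<Rightarrow> 'a set \<Rightarrow> bool" where
  "dominating_set V E S \<longleftrightarrow> S \<subseteq> V \<and> (\<forall>v\<in>V - S. \<exists>u\<in>S. (v, u) \<in> E)"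

definition domination_number :: "'a set \<Rightarrow> ('a \<times> 'a) set \<Rightarrow> nat" where
  "domination_number V E = (LEAST d. \<exists>S. dominating_set V E S \<and> card S = d)"

text \<open>The number of vertices followed by the adjacency matrix, row by row.\<close>
definition graph_input :: "nat \<Rightarrow> (nat \<times> nat) set \<Rightarrow> nat list" where
  "graph_input n E = n # concat (map (\<lambda>u. map (\<lambda>v. of_bool ((u, v) \<in> E)) [0..<n]) [0..<n])"

text \<open>
  The program terminates within the time bound on all graphs with at least two vertices; its output
  lists the vertices of the computed set, and is constrained only if the minimum dominating set has
  size at most \<open>k\<close>. The approximation factor \<open>\<rho>\<close> may depend on the number of vertices.
\<close>
definition approximates_DomSet_in_time ::
  "program \<Rightarrow> nat \<Rightarrow> (nat \<Rightarrow> real) \<Rightarrow> (nat \<Rightarrow> real) \<Rightarrow> bool" where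
  "approximates_DomSet_in_time P k \<rho> f \<longleftrightarrow> (\<exists>T :: nat \<Rightarrow> nat.
     (\<lambda>n. real (T n)) \<in> O(f) \<and>
     (\<forall>n E. n \<ge> 2 \<and> simple_graph n E \<longrightarrow>
       (\<exists>t y. t \<le> T n \<and> computes P (graph_input n E) t y \<and>
         (domination_number {..<n} E \<le> k \<longrightarrow>
            dominating_set {..<n} E (set y) \<and> real (card (set y)) \<le> \<rho> n * real k))))"


section \<open>Polynomials in two variables\<close>

text \<open>The value at \<open>(a, b)\<close> of a polynomial whose coefficients are polynomials in the first variable.\<close>
definition poly2 :: "'a :: comm_semiring_1 poly poly \<Rightarrow> 'a \<Rightarrow> 'a \<Rightarrow> 'a" where
  "poly2 p a b = poly (poly p [:b:]) a"

end

(* Following the threshold-graph approach to gap reductions for set cover, a sparse formula with n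
   variables and m clauses is turned into a graph as follows. Split the variables into k blocks of L
   variables and write D = 2^L. The k * D partial assignments (j, x) of single blocks form a clique.
   Every x < D is encoded by the word (hash D q i x) for i < D * q, over an alphabet of size q; two
   such words agree in at most 5 * D places. For every place i and every function f from
   A = {0..<q}^k to the clauses there is a vertex (i, f), adjacent to (j, x) iff for some a in A
   the j-th digit of a is the i-th letter of x and (j, x) satisfies the clause f(a).

   A satisfying assignment yields a dominating set of k blocks. If the formula is unsatisfiable and X
   has at most h vertices with 6 h^2 < q, then there is a place i at which distinct x, y occurring
   in X have distinct letters and such that X contains no vertex (i, f). Then each a in A selects at
   most one partial assignment per block from X, some clause f(a) is satisfied by none of them, and
   (i, f) is not dominated.

   With h about n^(1/(4 k)) the graph has 2^(n/k + o(n)) vertices, so that h exceeds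
   k * (log |V|)^(1/(16 k)), and every entry of the adjacency matrix is computable in time polynomial
   in n. A fast approximation algorithm can therefore be simulated without writing down the graph.
   In particular e can be constant. *)
theory Submission
  imports Defs "HOL-Real_Asymp.Real_Asymp"
begin

text \<open>Writing the graph down is too expensive: its adjacency matrix has at least
  \<open>4 ^ L\<close> entries, which exceeds \<open>2 ^ n\<close> when \<open>k = 2\<close>. Each
  entry has to be computed on demand from the formula, and this calls for an explicit code.
  Multiplicative hashing serves because long words are cheap here: there are \<open>k * D\<close>
  partial assignments anyway, so \<open>D * q\<close> places raise the number of vertices by a
  subexponential factor only, and a letter takes one multiplication and two divisions.

  The gap is limited by the vertices (i, f). A place carries \<open>m ^ (q ^ k)\<close> of them,
  where \<open>q\<close> exceeds \<open>6 * h ^ 2\<close>; this is subexponential only if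
  \<open>h ^ (2 * k)\<close> stays well below \<open>n\<close>. The exponent
  \<open>1 / (4 * k)\<close> makes \<open>q ^ k\<close> about \<open>sqrt n\<close>.

  SETH may answer \<epsilon> with a large clause density, but the density changes only the constant
  factor \<open>K0\<close> of \<open>h\<close> and never the exponent, which is why \<open>e\<close>
  is constant. The output of the algorithm is not trusted but checked for size and domination, which
  takes about \<open>V\<close> rounds; this fits the time bound because the exponent
  \<open>k - \<epsilon>\<close> can be assumed to be at least 1.\<close>

section \<open>Compiling expressions to RAM programs\<close>

inductive reach :: "program \<Rightarrow> nat list \<Rightarrow> config \<Rightarrow> nat \<Rightarrow> config \<Rightarrow> bool"
  for P :: program and inp :: "nat list" where
  reach_refl: "reach P inp c 0 c"
| reach_step: "pc < length P \<Longrightarrow> reach P inp (step inp (P ! pc) (pc, R, out)) t c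
    \<Longrightarrow> reach P inp (pc, R, out) (cost inp (P ! pc) R + t) c"

lemma reach_trans:
  assumes "reach P inp c t c'" "reach P inp c' t' c''"
  shows "reach P inp c (t + t') c''"
  using assms by (induction) (auto simp: add.assoc intro: reach_step)

lemma reach_runs:
  assumes "reach P inp c t c'" "runs P inp c' t' y"
  shows "runs P inp c (t + t') y"
  using assms by (induction) (auto simp: add.assoc intro: next_instr)

text \<open>Costs matter only as upper bounds; the slack lets runs compose without tracking their
  exact cost.\<close>

definition reach_within :: "program \<Rightarrow> nat list \<Rightarrow> config \<Rightarrow> nat \<Rightarrow> config \<Rightarrow> bool" where
  "reach_within P inp c T c' \<longleftrightarrow> (\<exists>t\<le>T. reach P inp c t c')"

lemma reach_within_refl: "reach_within P inp c T c"
  unfolding reach_within_def using reach_refl by blast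

lemma reach_within_trans:
  assumes "reach_within P inp c T c'" "reach_within P inp c' T' c''" "T + T' \<le> U"
  shows "reach_within P inp c U c''"
  using assms unfolding reach_within_def by (meson add_mono le_trans reach_trans)

lemma reach_within_step:
  assumes "pc < length P" "P ! pc = i" "cost inp i R \<le> C"
    "reach_within P inp (step inp i (pc, R, out)) T c'" "C + T \<le> U"
  shows "reach_within P inp (pc, R, out) U c'"
proof -
  obtain t where t: "t \<le> T" "reach P inp (step inp (P ! pc) (pc, R, out)) t c'"
    using assms unfolding reach_within_def by blast
  have "reach P inp (pc, R, out) (cost inp (P ! pc) R + t) c'"
    using reach_step[OF assms(1) t(2)] .
  moreover have "cost inp (P ! pc) R + t \<le> U"
    using assms t by simp
  ultimately show ?thesis
    unfolding reach_within_def by blast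
qed

fun code_at :: "program \<Rightarrow> nat \<Rightarrow> program \<Rightarrow> bool" where
  "code_at P b [] \<longleftrightarrow> True"
| "code_at P b (i # c) \<longleftrightarrow> b < length P \<and> P ! b = i \<and> code_at P (Suc b) c"

lemma code_at_append:
  "code_at P b (c @ d) \<longleftrightarrow> code_at P b c \<and> code_at P (b + length c) d"
  by (induction c arbitrary: b) auto

lemma code_at_context: "code_at (c @ d @ e) (length c) d"
proof (induction d arbitrary: c)
  case (Cons i d)
  have "code_at ((c @ [i]) @ d @ e) (length (c @ [i])) d"
    by (rule Cons)
  then show ?case by (simp add: nth_append)
qed simp

lemma lcost_mono: "a \<le> b \<Longrightarrow> lcost a \<le> lcost b"
  unfolding lcost_def by (simp add: floorlog_mono)

lemma lcost_pos: "1 \<le> lcost a"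
  unfolding lcost_def by simp

section \<open>Expressions with bounded loops and their compilation\<close>

datatype binop = Plus | Minus | Times | Divide

fun binop_instr :: "binop \<Rightarrow> nat \<Rightarrow> nat \<Rightarrow> nat \<Rightarrow> instr" where
  "binop_instr Plus = Add"
| "binop_instr Minus = Sub"
| "binop_instr Times = Mul"
| "binop_instr Divide = Div"

fun binop_val :: "binop \<Rightarrow> nat \<Rightarrow> nat \<Rightarrow> nat" where
  "binop_val Plus a b = a + b"
| "binop_val Minus a b = a - b"
| "binop_val Times a b = a * b"
| "binop_val Divide a b = a div b"

text \<open>
  \<open>Iter w x y n i e\<close> starts with the accumulator \<open>y := i\<close> and performs \<open>y := e\<close> for the counter values
  \<open>x = 0, \<dots>, n - 1\<close>. The flag \<open>w\<close> has no effect on the value; it selects the bound on \<open>n\<close> that enters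
  the running time, so that the few long loops are accounted for separately.
\<close>
datatype expr =
    Var nat
  | Num nat
  | Bin binop expr expr
  | Inp expr
  | Iter bool nat nat expr expr expr

fun eval :: "nat list \<Rightarrow> expr \<Rightarrow> (nat \<Rightarrow> nat) \<Rightarrow> nat" where
  "eval inp (Var x) \<sigma> = \<sigma> x"
| "eval inp (Num c) \<sigma> = c"
| "eval inp (Bin p a b) \<sigma> = binop_val p (eval inp a \<sigma>) (eval inp b \<sigma>)"
| "eval inp (Inp a) \<sigma> = input_at inp (eval inp a \<sigma>)"
| "eval inp (Iter w x y n i e) \<sigma> =
     rec_nat (eval inp i \<sigma>) (\<lambda>j acc. eval inp e (\<sigma>(x := j, y := acc))) (eval inp n \<sigma>)"

text \<open>Separates running time from meaning: if no intermediate value exceeds \<open>M\<close>,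
  every executed instruction costs at most \<open>2 * lcost M\<close>, and time becomes a count of
  instructions. In the loop clause, \<open>Iter w x y (Num j) i e\<close> denotes the accumulator
  after \<open>j\<close> rounds.\<close>

fun tame :: "nat list \<Rightarrow> nat \<Rightarrow> (bool \<Rightarrow> nat) \<Rightarrow> expr \<Rightarrow> (nat \<Rightarrow> nat) \<Rightarrow> bool" where
  "tame inp M W (Var x) \<sigma> \<longleftrightarrow> \<sigma> x \<le> M"
| "tame inp M W (Num c) \<sigma> \<longleftrightarrow> c \<le> M"
| "tame inp M W (Bin p a b) \<sigma> \<longleftrightarrow> tame inp M W a \<sigma> \<and> tame inp M W b \<sigma> \<and>
     binop_val p (eval inp a \<sigma>) (eval inp b \<sigma>) \<le> M"
| "tame inp M W (Inp a) \<sigma> \<longleftrightarrow> tame inp M W a \<sigma> \<and> input_at inp (eval inp a \<sigma>) \<le> M"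
| "tame inp M W (Iter w x y n i e) \<sigma> \<longleftrightarrow> tame inp M W n \<sigma> \<and> tame inp M W i \<sigma> \<and>
     eval inp n \<sigma> \<le> W w \<and>
     (\<forall>j < eval inp n \<sigma>. tame inp M W e (\<sigma>(x := j, y := eval inp (Iter w x y (Num j) i e) \<sigma>)))"

lemma tame_eval_le: "tame inp M W e \<sigma> \<Longrightarrow> eval inp e \<sigma> \<le> M"
proof (induction e arbitrary: \<sigma>)
  case (Iter w x y n i e)
  show ?case
  proof (cases "eval inp n \<sigma>")
    case 0
    then show ?thesis using Iter by auto
  next
    case (Suc j)
    then show ?thesis using Iter(3)[of "\<sigma>(x := j, y := eval inp (Iter w x y (Num j) i e) \<sigma>)"] Iter(4)
      by (auto simp del: fun_upd_apply)
  qed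
qed auto

fun code_len :: "expr \<Rightarrow> nat" where
  "code_len (Var x) = 2"
| "code_len (Num c) = 1"
| "code_len (Bin p a b) = code_len a + code_len b + 1"
| "code_len (Inp a) = code_len a + 1"
| "code_len (Iter w x y n i e) = code_len n + code_len i + code_len e + 9"

text \<open>
  Variable \<open>x\<close> resides in register \<open>\<gamma> x < f\<close>, the registers from \<open>f\<close> on are free, the result is left in
  register \<open>f\<close>, and the code is located at address \<open>b\<close>.
\<close>
fun compile :: "(nat \<Rightarrow> nat) \<Rightarrow> nat \<Rightarrow> nat \<Rightarrow> expr \<Rightarrow> program" where
  "compile \<gamma> f b (Var x) = [Const f 0, Add f (\<gamma> x) f]"
| "compile \<gamma> f b (Num c) = [Const f c]"
| "compile \<gamma> f b (Bin p e1 e2) =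
     compile \<gamma> f b e1 @ compile \<gamma> (f + 1) (b + code_len e1) e2 @ [binop_instr p f f (f + 1)]"
| "compile \<gamma> f b (Inp a) = compile \<gamma> f b a @ [Input f f]"
| "compile \<gamma> f b (Iter w x y n i e) =
     (let l = b + code_len n + code_len i + 2 in
      compile \<gamma> f b n @ compile \<gamma> (f + 1) (b + code_len n) i @
      [Const (f + 2) 0, Const (f + 3) 1, Jz f (l + code_len e + 6)] @
      compile (\<gamma>(x := f + 2, y := f + 1)) (f + 4) (l + 1) e @
      [Const (f + 5) 0, Add (f + 1) (f + 4) (f + 5), Add (f + 2) (f + 2) (f + 3), Sub f f (f + 3),
       Jz (f + 5) l, Add f (f + 1) f])"

lemma length_compile [simp]: "length (compile \<gamma> f b e) = code_len e"
  by (induction e arbitrary: \<gamma> f b) (auto simp: Let_def)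

text \<open>How many registers from \<open>f\<close> on the code may overwrite. A loop keeps in
  \<open>f\<close> to \<open>f + 3\<close> the remaining rounds, the accumulator, the counter and
  the constant 1; \<open>f + 4\<close> receives the value of the body, and \<open>f + 5\<close>,
  reset to 0 in every round, makes the backward jump unconditional.\<close>

fun width :: "expr \<Rightarrow> nat" where
  "width (Var x) = 1"
| "width (Num c) = 1"
| "width (Bin p a b) = max (width a) (1 + width b)"
| "width (Inp a) = width a"
| "width (Iter w x y n i e) = max (width n) (max (1 + width i) (max 6 (4 + width e)))"

text \<open>A round executes six instructions besides the body: the exit test and the five that
  close the loop. The summand 4 stands for two initialisations, the last exit test and the final
  move.\<close>

fun step_bound :: "(bool \<Rightarrow> nat) \<Rightarrow> expr \<Rightarrow> nat" where
  "step_bound W (Var x) = 2"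
| "step_bound W (Num c) = 1"
| "step_bound W (Bin p a b) = step_bound W a + step_bound W b + 1"
| "step_bound W (Inp a) = step_bound W a + 1"
| "step_bound W (Iter w x y n i e) =
     step_bound W n + step_bound W i + 4 + W w * (step_bound W e + 6)"

lemma width_pos: "0 < width e"
  by (induction e) auto

text \<open>Split off from the induction over expressions: the body is abstracted to a sequence
  \<open>g\<close> of accumulator values, and the induction runs over the remaining rounds
  \<open>N - j\<close>, the content of register \<open>f\<close>. The condition \<open>u > 1\<close>
  puts \<open>f + 5\<close> into the range that may be overwritten.\<close>

lemma compile_loop:
  fixes inp :: "nat list" and M :: nat and R0 :: "nat \<Rightarrow> nat" and out :: "nat list" and P :: program
  assumes body: "\<And>R. (\<forall>z. (R \<circ> \<gamma>') z = ((R0 \<circ> \<gamma>)(x := R (f + 2), y := R (f + 1))) z) \<Longrightarrow>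
       R (f + 2) < N \<Longrightarrow> R (f + 1) = g (R (f + 2)) \<Longrightarrow> 
       \<exists>R'. reach_within P inp (l + 1, R, out) (s * (2 * lcost M)) (l + 1 + c, R', out) \<and>
         R' (f + 4) = g (Suc (R (f + 2))) \<and> (\<forall>r. r < f + 4 \<or> r \<ge> f + 4 + u \<longrightarrow> R' r = R r)"
    and \<gamma>': "\<gamma>' = \<gamma>(x := f + 2, y := f + 1)" and \<gamma>: "\<forall>z. \<gamma> z < f"
    and gM: "\<forall>j \<le> N. g j \<le> M" and M: "N \<le> M" "1 \<le> M"
    and code: "l < length P" "P ! l = Jz f (l + c + 6)"
      "code_at P (l + 1 + c) [Const (f + 5) 0, Add (f + 1) (f + 4) (f + 5),
         Add (f + 2) (f + 2) (f + 3), Sub f f (f + 3), Jz (f + 5) l]"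
    and u: "u > 1"
    and "j \<le> N" "R f = N - j" "R (f + 1) = g j" "R (f + 2) = j" "R (f + 3) = 1"
      "\<forall>r. r < f \<or> r \<ge> f + 4 + u \<longrightarrow> R r = R0 r"
  shows "\<exists>R'. reach_within P inp (l, R, out) (((N - j) * (s + 6) + 1) * (2 * lcost M)) (l + c + 6, R', out) \<and>
     R' f = 0 \<and> R' (f + 1) = g N \<and> (\<forall>r. r < f \<or> r \<ge> f + 4 + u \<longrightarrow> R' r = R0 r)"
  using assms(11-)
proof (induction "N - j" arbitrary: j R)
  case 0
  have c0: "lcost 0 \<le> 2 * lcost M"
    using lcost_mono[of 0 M] by simp
  have "reach_within P inp (l, R, out) (((N - j) * (s + 6) + 1) * (2 * lcost M)) (l + c + 6, R, out)"
    apply (rule reach_within_step[OF code(1,2), where C = "2 * lcost M" and T = 0])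
    using 0 c0 by (auto intro: reach_within_refl)
  then show ?case using 0 by auto
next
  case (Suc d)
  let ?K = "2 * lcost M"
  have lc: "a \<le> M \<Longrightarrow> b \<le> M \<Longrightarrow> lcost a + lcost b \<le> ?K" for a b
    using lcost_mono[of a M] lcost_mono[of b M] by simp
  have lc1: "a \<le> M \<Longrightarrow> lcost a \<le> ?K" for a
    using lcost_mono[of a M] by simp
  have jN: "j < N" and d: "d = N - Suc j" using Suc by auto
  have env: "\<forall>z. (R \<circ> \<gamma>') z = ((R0 \<circ> \<gamma>)(x := R (f + 2), y := R (f + 1))) z"
    using \<gamma> Suc.prems(6) by (auto simp: \<gamma>')
  obtain R1 where R1: "reach_within P inp (l + 1, R, out) (s * ?K) (l + 1 + c, R1, out)"
      "R1 (f + 4) = g (Suc j)" "\<forall>r. r < f + 4 \<or> r \<ge> f + 4 + u \<longrightarrow> R1 r = R r"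
    using body[OF env] Suc.prems jN by auto
  define R2 where "R2 = R1(f + 5 := 0, f + 1 := g (Suc j), f + 2 := Suc j, f := N - Suc j)"
  have R1v: "R1 f = N - j" "R1 (f + 2) = j" "R1 (f + 3) = 1"
    using R1(3) Suc.prems by auto
  have gM': "g (Suc j) \<le> M" "j \<le> M" "Suc j \<le> M" "N - j \<le> M" using gM jN M by auto
  have st2: "reach_within P inp (l + 1 + c, R1, out) (5 * ?K) (l, R2, out)"
    apply (rule reach_within_step[where C = ?K and T = "4 * ?K"])
    using code(3) apply (simp; fail)
    using code(3) apply (simp; fail)
    apply (simp add: lc1 ; fail)
     apply (simp del: One_nat_def)
    apply (rule reach_within_step[where C = ?K and T = "3 * ?K"])
    using code(3) apply (simp; fail)
    using code(3) apply (simp; fail)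
    using R1 gM' apply (simp add: lc ; fail)
     apply (simp del: One_nat_def)
    apply (rule reach_within_step[where C = ?K and T = "2 * ?K"])
    using code(3) apply (simp; fail)
    using code(3) apply (simp; fail)
    using R1v gM' M apply (simp add: lc ; fail)
     apply (simp del: One_nat_def)
    apply (rule reach_within_step[where C = ?K and T = "1 * ?K"])
    using code(3) apply (simp; fail)
    using code(3) apply (simp; fail)
    using R1v gM' M apply (simp add: lc ; fail)
     apply (simp del: One_nat_def)
    apply (rule reach_within_step[where C = ?K and T = 0])
    using code(3) apply (simp; fail)
    using code(3) apply (simp; fail)
        apply (simp add: lc1 ; fail)
    using R1 R1v by (auto simp: R2_def intro!: reach_within_refl)
  have R2v: "R2 f = N - Suc j" "R2 (f + 1) = g (Suc j)" "R2 (f + 2) = Suc j" "R2 (f + 3) = 1"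
    "\<forall>r. r < f \<or> r \<ge> f + 4 + u \<longrightarrow> R2 r = R0 r"
    using R1 R1v Suc.prems u by (auto simp: R2_def)
  obtain R' where R': "reach_within P inp (l, R2, out) (((N - Suc j) * (s + 6) + 1) * ?K) (l + c + 6, R', out)"
     "R' f = 0 \<and> R' (f + 1) = g N \<and> (\<forall>r. r < f \<or> r \<ge> f + 4 + u \<longrightarrow> R' r = R0 r)"
    using Suc.hyps(1)[OF d _ R2v] jN by auto
  have "reach_within P inp (l, R, out) (?K + (s * ?K + (5 * ?K + (((N - Suc j) * (s + 6) + 1) * ?K)))) (l + c + 6, R', out)"
    apply (rule reach_within_step[OF code(1,2) _ _ order_refl])
    subgoal using Suc.prems(2) gM' by (simp add: lc1)
    subgoal
      using Suc.prems(2) jN apply simp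
      apply (rule reach_within_trans[OF R1(1)[simplified]])
       apply (rule reach_within_trans[OF st2[simplified] R'(1)[simplified] order_refl])
      apply simp
      done
    done
  moreover have "?K + (s * ?K + (5 * ?K + (((N - Suc j) * (s + 6) + 1) * ?K))) = ((N - j) * (s + 6) + 1) * ?K"
  proof -
    obtain a where "N - j = Suc a" "N - Suc j = a" using jN by (metis Suc_diff_Suc)
    then show ?thesis by (simp add: algebra_simps)
  qed
  ultimately have "reach_within P inp (l, R, out) (((N - j) * (s + 6) + 1) * ?K) (l + c + 6, R', out)"
    by (simp only:)
  then show ?case using R'(2) by blast
qed

theorem compile_correct:
  assumes "code_at P b (compile \<gamma> f b e)" "tame inp M W e (R \<circ> \<gamma>)" "\<forall>x. \<gamma> x < f" "1 \<le> M"
  shows "\<exists>R'. reach_within P inp (b, R, out) (step_bound W e * (2 * lcost M)) (b + code_len e, R', out) \<and>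
    R' f = eval inp e (R \<circ> \<gamma>) \<and> (\<forall>r. r < f \<or> r \<ge> f + width e \<longrightarrow> R' r = R r)"
  using assms
proof (induction e arbitrary: b \<gamma> f R)
  case (Var x)
  let ?K = "2 * lcost M"
  have "\<gamma> x \<noteq> f" using Var by (metis less_irrefl)
  have "reach_within P inp (b, R, out) (2 * ?K) (b + 2, R(f := R (\<gamma> x)), out)"
    apply (rule reach_within_step[where C = ?K and T = "1 * ?K"])
    using Var apply (simp; fail)
    using Var apply (simp; fail)
    using lcost_mono[of 0 M] apply (simp; fail)
     apply (simp del: One_nat_def)
    apply (rule reach_within_step[where C = ?K and T = 0])
    using Var apply (simp; fail)
    using Var apply (simp; fail)
    using Var lcost_mono[of "R (\<gamma> x)" M] lcost_mono[of 0 M] \<open>\<gamma> x \<noteq> f\<close> apply (simp; fail)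
    using \<open>\<gamma> x \<noteq> f\<close> by (auto intro!: reach_within_refl)
  then show ?case by (auto intro!: exI[of _ "R(f := R (\<gamma> x))"])
next
  case (Num c)
  let ?K = "2 * lcost M"
  have "reach_within P inp (b, R, out) ?K (b + 1, R(f := c), out)"
    apply (rule reach_within_step[where C = ?K and T = 0])
    using Num apply (simp; fail)
    using Num apply (simp; fail)
    using lcost_mono[of c M] Num apply (simp; fail)
    by (auto intro!: reach_within_refl)
  then show ?case by (auto intro!: exI[of _ "R(f := c)"])
next
  case (Bin p e1 e2)
  let ?K = "2 * lcost M"
  have code: "code_at P b (compile \<gamma> f b e1)"
    "code_at P (b + code_len e1) (compile \<gamma> (f + 1) (b + code_len e1) e2)"
    "b + code_len e1 + code_len e2 < length P"
    "P ! (b + code_len e1 + code_len e2) = binop_instr p f f (f + 1)"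
    using Bin.prems(1) by (simp_all add: code_at_append)
  have t: "tame inp M W e1 (R \<circ> \<gamma>)" "tame inp M W e2 (R \<circ> \<gamma>)"
    using Bin.prems(2) unfolding tame.simps by blast+
  obtain R1 where R1: "reach_within P inp (b, R, out) (step_bound W e1 * ?K) (b + code_len e1, R1, out)"
     "R1 f = eval inp e1 (R \<circ> \<gamma>)" "\<forall>r. r < f \<or> r \<ge> f + width e1 \<longrightarrow> R1 r = R r"
    using Bin.IH(1)[OF code(1) t(1) Bin.prems(3,4)] by blast
  have e: "R1 \<circ> \<gamma> = R \<circ> \<gamma>" using R1 Bin.prems(3) by auto
  have g': "\<forall>x. \<gamma> x < f + 1" using Bin.prems(3) by (simp add: less_SucI)
  obtain R2 where R2: "reach_within P inp (b + code_len e1, R1, out) (step_bound W e2 * ?K) (b + code_len e1 + code_len e2, R2, out)"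
     "R2 (f + 1) = eval inp e2 (R \<circ> \<gamma>)" "\<forall>r. r < f + 1 \<or> r \<ge> f + 1 + width e2 \<longrightarrow> R2 r = R1 r"
    using Bin.IH(2)[OF code(2) t(2)[folded e] g' Bin.prems(4)] unfolding e by blast
  let ?v = "binop_val p (eval inp e1 (R \<circ> \<gamma>)) (eval inp e2 (R \<circ> \<gamma>))"
  have R2f: "R2 f = eval inp e1 (R \<circ> \<gamma>)" using R2 R1 by auto
  have "lcost (R2 f) \<le> lcost M" "lcost (R2 (f + 1)) \<le> lcost M"
    unfolding R2f R2(2) using t by (auto intro!: lcost_mono tame_eval_le)
  then have "cost inp (binop_instr p f f (f + 1)) R2 \<le> ?K"
    by (cases p) auto
  moreover have "step inp (binop_instr p f f (f + 1)) (b + code_len e1 + code_len e2, R2, out) =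
      (b + code_len (Bin p e1 e2), R2(f := ?v), out)"
    using R2f R2(2) by (cases p) auto
  ultimately have R3: "reach_within P inp (b + code_len e1 + code_len e2, R2, out) ?K (b + code_len (Bin p e1 e2), R2(f := ?v), out)"
    using reach_within_step[OF code(3,4), where C = ?K and T = 0 and U = ?K] by (simp add: reach_within_refl)
  have "reach_within P inp (b, R, out) (step_bound W (Bin p e1 e2) * ?K) (b + code_len (Bin p e1 e2), R2(f := ?v), out)"
    apply (rule reach_within_trans[OF R1(1)])
     apply (rule reach_within_trans[OF R2(1) R3 order_refl])
    apply (simp add: algebra_simps)
    done
  moreover have "\<forall>r. r < f \<or> r \<ge> f + width (Bin p e1 e2) \<longrightarrow> (R2(f := ?v)) r = R r"
    using R1(3) R2(3) by auto
  moreover have "(R2(f := ?v)) f = eval inp (Bin p e1 e2) (R \<circ> \<gamma>)"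
    unfolding eval.simps by simp
  ultimately show ?case by blast
next
  case (Inp a)
  let ?K = "2 * lcost M"
  let ?v = "input_at inp (eval inp a (R \<circ> \<gamma>))"
  have code: "code_at P b (compile \<gamma> f b a)"
    "b + code_len a < length P" "P ! (b + code_len a) = Input f f"
    using Inp.prems(1) by (simp_all add: code_at_append)
  have t: "tame inp M W a (R \<circ> \<gamma>)" "?v \<le> M" using Inp.prems(2) unfolding tame.simps by blast+
  obtain R1 where R1: "reach_within P inp (b, R, out) (step_bound W a * ?K) (b + code_len a, R1, out)"
     "R1 f = eval inp a (R \<circ> \<gamma>)" "\<forall>r. r < f \<or> r \<ge> f + width a \<longrightarrow> R1 r = R r"
    using Inp.IH[OF code(1) t(1) Inp.prems(3,4)] by blast
  have "lcost (R1 f) \<le> lcost M" "lcost ?v \<le> lcost M"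
    unfolding R1 using t by (auto intro!: lcost_mono tame_eval_le)
  then have R2: "reach_within P inp (b + code_len a, R1, out) ?K (b + code_len (Inp a), R1(f := ?v), out)"
    using reach_within_step[OF code(2,3), where C = ?K and T = 0 and U = ?K] R1(2) by (simp add: reach_within_refl)
  have "reach_within P inp (b, R, out) (step_bound W (Inp a) * ?K) (b + code_len (Inp a), R1(f := ?v), out)"
    apply (rule reach_within_trans[OF R1(1) R2])
    apply (simp add: algebra_simps)
    done
  moreover have "\<forall>r. r < f \<or> r \<ge> f + width (Inp a) \<longrightarrow> (R1(f := ?v)) r = R r"
    using R1(3) width_pos[of a] by auto
  moreover have "(R1(f := ?v)) f = eval inp (Inp a) (R \<circ> \<gamma>)"
    unfolding eval.simps by simp
  ultimately show ?case by blast
next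
  case (Iter w x y n i e)
  let ?K = "2 * lcost M"
  define l where "l = b + code_len n + code_len i + 2"
  define \<gamma>' where "\<gamma>' = \<gamma>(x := f + 2, y := f + 1)"
  have code: "code_at P b (compile \<gamma> f b n)"
    "code_at P (b + code_len n) (compile \<gamma> (f + 1) (b + code_len n) i)"
    "code_at P (b + code_len n + code_len i) [Const (f + 2) 0, Const (f + 3) 1]"
    "l < length P" "P ! l = Jz f (l + code_len e + 6)"
    "code_at P (l + 1) (compile \<gamma>' (f + 4) (l + 1) e)"
    "code_at P (l + 1 + code_len e) [Const (f + 5) 0, Add (f + 1) (f + 4) (f + 5),
         Add (f + 2) (f + 2) (f + 3), Sub f f (f + 3), Jz (f + 5) l]"
    "l + code_len e + 6 < length P" "P ! (l + code_len e + 6) = Add f (f + 1) f"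
    using Iter.prems(1) by (simp_all add: code_at_append Let_def l_def \<gamma>'_def numeral_eq_Suc add_ac)
  let ?\<sigma> = "R \<circ> \<gamma>"
  have t: "tame inp M W n ?\<sigma>" "tame inp M W i ?\<sigma>" "eval inp n ?\<sigma> \<le> W w"
    using Iter.prems(2) unfolding tame.simps by blast+
  obtain R1 where R1: "reach_within P inp (b, R, out) (step_bound W n * ?K) (b + code_len n, R1, out)"
     "R1 f = eval inp n (R \<circ> \<gamma>)" "\<forall>r. r < f \<or> r \<ge> f + width n \<longrightarrow> R1 r = R r"
    using Iter.IH(1)[OF code(1) t(1) Iter.prems(3,4)] by blast
  have e: "R1 \<circ> \<gamma> = R \<circ> \<gamma>" using R1 Iter.prems(3) by auto
  have g': "\<forall>x. \<gamma> x < f + 1" using Iter.prems(3) by (simp add: less_SucI)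
  obtain R2 where R2: "reach_within P inp (b + code_len n, R1, out) (step_bound W i * ?K) (b + code_len n + code_len i, R2, out)"
     "R2 (f + 1) = eval inp i (R \<circ> \<gamma>)" "\<forall>r. r < f + 1 \<or> r \<ge> f + 1 + width i \<longrightarrow> R2 r = R1 r"
    using Iter.IH(2)[OF code(2) t(2)[folded e] g' Iter.prems(4)] unfolding e by blast
  define R3 where "R3 = R2(f + 2 := 0, f + 3 := 1)"
  have st3: "reach_within P inp (b + code_len n + code_len i, R2, out) (2 * ?K) (l, R3, out)"
    apply (rule reach_within_step[where C = ?K and T = "1 * ?K"])
    using code(3) apply (simp; fail)
    using code(3) apply (simp; fail)
    using lcost_mono[of 0 M] apply (simp; fail)
     apply (simp del: One_nat_def)
    apply (rule reach_within_step[where C = ?K and T = 0])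
    using code(3) apply (simp; fail)
    using code(3) apply (simp; fail)
    using Iter.prems(4) lcost_mono[of 1 M] apply (simp; fail)
    by (auto intro!: reach_within_refl simp: l_def R3_def)
  define N where "N = eval inp n ?\<sigma>"
  define g where "g j = eval inp (Iter w x y (Num j) i e) ?\<sigma>" for j
  have g0: "g 0 = eval inp i ?\<sigma>" by (simp add: g_def)
  have gS: "g (Suc j) = eval inp e (?\<sigma>(x := j, y := g j))" for j by (simp add: g_def)
  have te: "tame inp M W e (?\<sigma>(x := j, y := g j))" if "j < N" for j
    using Iter.prems(2) that unfolding tame.simps g_def N_def by blast
  have gM: "\<forall>j\<le>N. g j \<le> M"
  proof (intro allI impI)
    fix j assume "j \<le> N"
    then show "g j \<le> M" using te[of "j - 1"] tame_eval_le[OF t(2)] g0 gS[of "j - 1"]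
        tame_eval_le[of inp M W e "?\<sigma>(x := j - 1, y := g (j - 1))"] by (cases j) auto
  qed
  have NM: "N \<le> M" unfolding N_def using t(1) by (rule tame_eval_le)
  \<comment> \<open>\<open>max 2\<close> because the loop itself overwrites \<open>f + 5\<close>,
    however few registers the body uses.\<close>
  obtain R4 where R4: "reach_within P inp (l, R3, out) (((N - 0) * (step_bound W e + 6) + 1) * ?K) (l + code_len e + 6, R4, out)"
     "R4 f = 0" "R4 (f + 1) = g N"  "\<forall>r. r < f \<or> r \<ge> f + 4 + max 2 (width e) \<longrightarrow> R4 r = R3 r"
  proof -
    have "\<exists>R'. reach_within P inp (l, R3, out) (((N - 0) * (step_bound W e + 6) + 1) * ?K) (l + code_len e + 6, R', out) \<and>
     R' f = 0 \<and> R' (f + 1) = g N \<and> (\<forall>r. r < f \<or> r \<ge> f + 4 + max 2 (width e) \<longrightarrow> R' r = R3 r)"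
    proof (rule compile_loop[where ?R0.0 = R3 and \<gamma> = \<gamma> and \<gamma>' = \<gamma>' and x = x and y = y])
      fix R5 assume R5: "\<forall>z. (R5 \<circ> \<gamma>') z = ((R3 \<circ> \<gamma>)(x := R5 (f + 2), y := R5 (f + 1))) z"
         "R5 (f + 2) < N" "R5 (f + 1) = g (R5 (f + 2))"
      have eq: "R3 \<circ> \<gamma> = ?\<sigma>"
      proof
        fix z
        have z: "\<gamma> z < f" using Iter.prems(3) by blast
        then have "R3 (\<gamma> z) = R2 (\<gamma> z)" by (auto simp: R3_def)
        then show "(R3 \<circ> \<gamma>) z = ?\<sigma> z" using R2(3) R1(3) z by auto
      qed
      have eq2: "R5 \<circ> \<gamma>' = ?\<sigma>(x := R5 (f + 2), y := g (R5 (f + 2)))"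
        using R5 eq by (intro ext) auto
      have gg: "\<forall>z. \<gamma>' z < f + 4"
        using Iter.prems(3) by (auto simp: \<gamma>'_def trans_less_add1)
      show "\<exists>R'. reach_within P inp (l + 1, R5, out) (step_bound W e * (2 * lcost M)) (l + 1 + code_len e, R', out) \<and>
         R' (f + 4) = g (Suc (R5 (f + 2))) \<and> (\<forall>r. r < f + 4 \<or> r \<ge> f + 4 + max 2 (width e) \<longrightarrow> R' r = R5 r)"
        using Iter.IH(3)[OF code(6), of R5] te[OF R5(2)] gg Iter.prems(4)
        unfolding eq2 gS by fastforce
    next
      show "R3 f = N - 0" "R3 (f + 1) = g 0" "R3 (f + 2) = 0" "R3 (f + 3) = 1"
        using R2 R1(2) by (auto simp: R3_def N_def g0)
    qed (use code gM NM Iter.prems(3,4) in \<open>auto simp: \<gamma>'_def\<close>)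
    then show ?thesis using that by blast
  qed
  let ?b = "b + code_len (Iter w x y n i e)"
  have b: "?b = Suc (l + code_len e + 6)" by (simp add: l_def)
  have st5: "reach_within P inp (l + code_len e + 6, R4, out) ?K (?b, R4(f := g N), out)"
    apply (rule reach_within_step[where C = ?K and T = 0])
    using code apply (simp; fail)
    using code(9) apply assumption
    using R4(2,3) gM lcost_mono[of "g N" M] lcost_mono[of 0 M] apply (simp; fail)
    using R4(2,3) b by (auto intro!: reach_within_refl simp del: code_len.simps)
  have "reach_within P inp (b, R, out) (step_bound W (Iter w x y n i e) * ?K) (?b, R4(f := g N), out)"
    apply (rule reach_within_trans[OF R1(1)])
     apply (rule reach_within_trans[OF R2(1)])
      apply (rule reach_within_trans[OF st3])
       apply (rule reach_within_trans[OF R4(1) st5 order_refl])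
      apply (rule order_refl)
     apply (rule order_refl)
  proof -
    have "N * (step_bound W e + 6) \<le> W w * (step_bound W e + 6)"
      using t(3) unfolding N_def by (intro mult_right_mono) auto
    then have "(step_bound W n + step_bound W i + 2 + N * (step_bound W e + 6) + 1 + 1) * ?K \<le> step_bound W (Iter w x y n i e) * ?K"
      by (intro mult_right_mono) auto
    then show "step_bound W n * ?K + (step_bound W i * ?K + (2 * ?K + (((N - 0) * (step_bound W e + 6) + 1) * ?K + ?K)))
       \<le> step_bound W (Iter w x y n i e) * ?K"
      by (simp add: algebra_simps)
  qed
  moreover have "\<forall>r. r < f \<or> r \<ge> f + width (Iter w x y n i e) \<longrightarrow> (R4(f := g N)) r = R r"
    using R4(4) R2(3) R1(3) by (auto simp: R3_def)
  moreover have "(R4(f := g N)) f = eval inp (Iter w x y n i e) ?\<sigma>"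
    unfolding g_def N_def eval.simps by simp
  ultimately show ?case by blast
qed

section \<open>Simulating a program on a computed input\<close>

lemma lcost_le_iff: "lcost a \<le> Suc n \<longleftrightarrow> a < 2 ^ n"
  unfolding lcost_def by (simp add: floorlog_le_iff)

lemma lcost_add: "lcost (a + b) \<le> lcost a + lcost b"
proof -
  obtain m n where mn: "lcost a = Suc m" "lcost b = Suc n" unfolding lcost_def by blast
  have "a < 2 ^ m" "b < 2 ^ n" using mn lcost_le_iff by (metis order_refl)+
  moreover have "(2::nat) ^ m \<le> 2 ^ (m + n)" "(2::nat) ^ n \<le> 2 ^ (m + n)" by simp_all
  ultimately have "a + b < 2 ^ Suc (m + n)" unfolding power_Suc by linarith
  then have "lcost (a + b) \<le> Suc (Suc (m + n))" by (simp only: lcost_le_iff)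
  then show ?thesis using mn by simp
qed

lemma lcost_mult: "lcost (a * b) \<le> lcost a + lcost b"
proof -
  obtain m n where mn: "lcost a = Suc m" "lcost b = Suc n" unfolding lcost_def by blast
  have "a < 2 ^ m" "b < 2 ^ n" using mn lcost_le_iff by (metis order_refl)+
  then have "a * b < 2 ^ (m + n)" unfolding power_add by (intro mult_strict_mono) auto
  then have "lcost (a * b) \<le> Suc (m + n)" by (simp only: lcost_le_iff)
  then show ?thesis using mn by simp
qed

definition arg_state :: "nat \<Rightarrow> nat \<Rightarrow> nat \<Rightarrow> nat" where
  "arg_state X v = (\<lambda>z. if z = 0 then X else v)"

abbreviation arg_regs :: "nat \<Rightarrow> nat" where
  "arg_regs \<equiv> (\<lambda>z. if z = 0 then 0 else 1)"

text \<open>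
  Registers of the simulating program: 0 holds the state in which the simulated outputs are collected,
  1 the argument of the current expression (or an address), 2 the offset \<open>K\<close>, and 3 always 0. Expressions
  are evaluated in the registers from 4 on, and register \<open>r\<close> of the simulated program is \<open>r + K\<close>.
\<close>
fun block_len :: "expr \<Rightarrow> expr \<Rightarrow> instr \<Rightarrow> nat" where
  "block_len inE insE (Load d s) = 2"
| "block_len inE insE (Store d s) = 2"
| "block_len inE insE (Input d s) = code_len inE + 2"
| "block_len inE insE (Output s) = code_len insE + 2"
| "block_len inE insE _ = 1"

text \<open>Translates jump targets. The 1 is the instruction that loads the offset. Since
  \<open>take\<close> stops at the end of the list, every target outside the simulated program is
  sent to the code of the decoder, which is how halting is simulated.\<close>

definition block_start :: "expr \<Rightarrow> expr \<Rightarrow> program \<Rightarrow> nat \<Rightarrow> nat" where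
  "block_start inE insE P l = 1 + (\<Sum>i\<leftarrow>take l P. block_len inE insE i)"

fun sim_block :: "nat \<Rightarrow> expr \<Rightarrow> expr \<Rightarrow> (nat \<Rightarrow> nat) \<Rightarrow> nat \<Rightarrow> instr \<Rightarrow> program" where
  "sim_block K inE insE tgt b (Const d c) = [Const (d + K) c]"
| "sim_block K inE insE tgt b (Add d s s') = [Add (d + K) (s + K) (s' + K)]"
| "sim_block K inE insE tgt b (Sub d s s') = [Sub (d + K) (s + K) (s' + K)]"
| "sim_block K inE insE tgt b (Mul d s s') = [Mul (d + K) (s + K) (s' + K)]"
| "sim_block K inE insE tgt b (Div d s s') = [Div (d + K) (s + K) (s' + K)]"
| "sim_block K inE insE tgt b (Load d s) = [Add 1 (s + K) 2, Load (d + K) 1]"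
| "sim_block K inE insE tgt b (Store d s) = [Add 1 (d + K) 2, Store 1 (s + K)]"
| "sim_block K inE insE tgt b (Input d s) =
     [Add 1 (s + K) 3] @ compile arg_regs 4 (b + 1) inE @ [Add (d + K) 4 3]"
| "sim_block K inE insE tgt b (Output s) =
     [Add 1 (s + K) 3] @ compile arg_regs 4 (b + 1) insE @ [Add 0 4 3]"
| "sim_block K inE insE tgt b (Jz s l) = [Jz (s + K) (tgt l)]"

lemma length_sim_block [simp]: "length (sim_block K inE insE tgt b i) = block_len inE insE i"
  by (cases i) auto

text \<open>Only the two expressions evaluated during the simulation need protected registers. The
  decoder runs afterwards and may overwrite those of the simulated program.\<close>

definition sim_offset :: "expr \<Rightarrow> expr \<Rightarrow> nat" where
  "sim_offset inE insE = 4 + width inE + width insE"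

definition sim_blocks :: "expr \<Rightarrow> expr \<Rightarrow> program \<Rightarrow> program list" where
  "sim_blocks inE insE P =
     map (\<lambda>i. sim_block (sim_offset inE insE) inE insE (block_start inE insE P)
       (block_start inE insE P i) (P ! i)) [0..<length P]"

definition sim_program :: "expr \<Rightarrow> expr \<Rightarrow> expr \<Rightarrow> program \<Rightarrow> program" where
  "sim_program inE insE decE P =
     [Const 2 (sim_offset inE insE)] @ concat (sim_blocks inE insE P) @
     compile arg_regs 4 (block_start inE insE P (length P)) decE @ [Output 4]"

lemma sim_blocks_length:
  "l \<le> length P \<Longrightarrow>
     length (concat (take l (sim_blocks inE insE P))) + 1 = block_start inE insE P l"
proof (induction l)
  case (Suc l)
  then show ?case
    by (simp add: block_start_def sim_blocks_def take_Suc_conv_app_nth)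
qed (simp add: block_start_def)

lemma sim_program_block:
  assumes "l < length P"
  shows "code_at (sim_program inE insE decE P) (block_start inE insE P l)
    (sim_block (sim_offset inE insE) inE insE (block_start inE insE P)
       (block_start inE insE P l) (P ! l))"
proof -
  let ?B = "sim_blocks inE insE P"
  have l: "l < length ?B" using assms by (simp add: sim_blocks_def)
  have "?B = take l ?B @ ?B ! l # drop (Suc l) ?B"
    using l by (rule id_take_nth_drop)
  then have B: "concat ?B = concat (take l ?B) @ ?B ! l @ concat (drop (Suc l) ?B)"
    by (metis concat.simps(2) concat_append)
  let ?a = "[Const 2 (sim_offset inE insE)] @ concat (take l ?B)"
  obtain z where z: "sim_program inE insE decE P = ?a @ ?B ! l @ z"
    unfolding sim_program_def B by simp
  have "length ?a = block_start inE insE P l"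
    using sim_blocks_length[of l P inE insE] assms by simp
  then have "code_at (sim_program inE insE decE P) (block_start inE insE P l) (?B ! l)"
    unfolding z by (metis code_at_context)
  then show ?thesis using assms by (simp add: sim_blocks_def)
qed

lemma sim_program_final:
  "code_at (sim_program inE insE decE P) (block_start inE insE P (length P))
    (compile arg_regs 4 (block_start inE insE P (length P)) decE @ [Output 4])"
proof -
  let ?a = "[Const 2 (sim_offset inE insE)] @ concat (sim_blocks inE insE P)"
  let ?z = "compile arg_regs 4 (block_start inE insE P (length P)) decE @ [Output 4]"
  have "length ?a = block_start inE insE P (length P)"
    using sim_blocks_length[of "length P" P inE insE] by (simp add: sim_blocks_def)
  then show ?thesis
    using code_at_context[of ?a ?z "[]"] by (simp add: sim_program_def)
qed

lemma arg_regs_state: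
  assumes "R 0 = X" "R 1 = v"
  shows "R \<circ> arg_regs = arg_state X v"
  using assms by (auto simp: arg_state_def)

lemma reach_within_mono:
  "reach_within P inp c T c' \<Longrightarrow> T \<le> U \<Longrightarrow> reach_within P inp c U c'"
  unfolding reach_within_def by (meson le_trans)

text \<open>The simulated program may use arbitrarily large numbers \<open>v\<close> as input
  addresses or as outputs, so the bound \<open>M v\<close> on intermediate values depends on
  \<open>v\<close>. The simulated instruction already pays \<open>lcost v\<close>;
  \<open>M_bound\<close> therefore limits the slowdown to a factor independent of
  \<open>v\<close>.\<close>

locale simulation =
  fixes inE insE decE :: expr and P :: program and inp g :: "nat list"
    and ins :: "nat \<Rightarrow> nat \<Rightarrow> nat" and inv :: "nat \<Rightarrow> bool"
    and M :: "nat \<Rightarrow> nat" and W :: "bool \<Rightarrow> nat" and \<Lambda> :: nat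
  assumes input_tame: "inv X \<Longrightarrow> tame inp (M i) W inE (arg_state X i)"
    and input_eval: "inv X \<Longrightarrow> eval inp inE (arg_state X i) = input_at g i"
    and ins_tame: "inv X \<Longrightarrow> tame inp (M v) W insE (arg_state X v)"
    and ins_eval: "inv X \<Longrightarrow> eval inp insE (arg_state X v) = ins X v"
    and inv_0: "inv 0" and inv_ins: "inv X \<Longrightarrow> inv (ins X v)"
    and M_pos: "1 \<le> M v" and M_bound: "lcost (M v) \<le> \<Lambda> * lcost v"
begin

abbreviation "Q \<equiv> sim_program inE insE decE P"
abbreviation "start \<equiv> block_start inE insE P"
abbreviation "K \<equiv> sim_offset inE insE"

definition slowdown :: nat where
  "slowdown = 4 + 2 * lcost K + \<Lambda> + 2 * \<Lambda> * (step_bound W inE + step_bound W insE)"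

definition sim_rel :: "(nat \<Rightarrow> nat) \<Rightarrow> nat list \<Rightarrow> (nat \<Rightarrow> nat) \<Rightarrow> bool" where
  "sim_rel R out R' \<longleftrightarrow> (\<forall>r. R' (r + K) = R r) \<and> R' 2 = K \<and> R' 3 = 0 \<and> R' 0 = foldl ins 0 out"

lemma K_ge: "4 \<le> K" "4 + width inE \<le> K" "4 + width insE \<le> K"
  by (auto simp: sim_offset_def)

lemma inv_foldl: "inv (foldl ins 0 out)"
  by (induction out rule: rev_induct) (auto simp: inv_0 inv_ins)

lemma start_Suc: "pc < length P \<Longrightarrow> start (Suc pc) = start pc + block_len inE insE (P ! pc)"
  by (simp add: block_start_def take_Suc_conv_app_nth)

lemma call_expr:
  assumes rel: "sim_rel R out R'" and code: "code_at Q b ([Add 1 (s + K) 3] @ compile arg_regs 4 (b + 1) e @ [Add d 4 3])"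
    and t: "tame inp (M (R s)) W e (arg_state (foldl ins 0 out) (R s))" and wd: "4 + width e \<le> K"
  shows "\<exists>R''. reach_within Q inp (b, R', [])
        ((3 + \<Lambda> + 2 * \<Lambda> * step_bound W e) * lcost (R s))
        (b + code_len e + 2, R''(d := eval inp e (arg_state (foldl ins 0 out) (R s))), []) \<and>
     (\<forall>r. r < 4 \<or> r \<ge> K \<longrightarrow> R'' r = (R'(1 := R s)) r)"
proof -
  let ?X = "foldl ins 0 out" let ?v = "R s"
  let ?R1 = "R'(1 := ?v)"
  let ?val = "eval inp e (arg_state ?X ?v)"
  have R': "R' (s + K) = ?v" "R' 3 = 0" "R' 0 = ?X" using rel by (auto simp: sim_rel_def)
  have code': "code_at Q (b + 1) (compile arg_regs 4 (b + 1) e)"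
    "b + 1 + code_len e < length Q" "Q ! (b + 1 + code_len e) = Add d 4 3"
    "b < length Q" "Q ! b = Add 1 (s + K) 3"
    using code by (simp_all add: code_at_append)
  have rg: "\<forall>x. arg_regs x < 4" by simp
  have e: "?R1 \<circ> arg_regs = arg_state ?X ?v" using R' by (intro arg_regs_state) auto
  obtain R2 where R2: "reach_within Q inp (b + 1, ?R1, []) (step_bound W e * (2 * lcost (M ?v))) (b + 1 + code_len e, R2, [])"
    "R2 4 = ?val" "\<forall>r. r < 4 \<or> r \<ge> 4 + width e \<longrightarrow> R2 r = ?R1 r"
    using compile_correct[OF code'(1), of inp "M ?v" W ?R1 "[]"] t M_pos rg unfolding e by blast
  have st2: "reach_within Q inp (b + 1 + code_len e, R2, []) (lcost (M ?v) + 1) (b + code_len e + 2, R2(d := ?val), [])"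
    apply (rule reach_within_step[OF code'(2,3), where C = "lcost (M ?v) + 1" and T = 0])
    using R2 R' tame_eval_le[OF t] by (auto intro!: reach_within_refl lcost_mono simp: lcost_def[of 0] floorlog_def)
  have "reach_within Q inp (b, R', []) ((lcost ?v + 1) + (step_bound W e * (2 * lcost (M ?v)) + (lcost (M ?v) + 1)))
     (b + code_len e + 2, R2(d := ?val), [])"
    apply (rule reach_within_step[OF code'(4,5) _ _ order_refl])
    using R' apply (simp add: lcost_def[of 0] floorlog_def; fail)
    using reach_within_trans[OF R2(1) st2 order_refl] R' by simp
  moreover have "(lcost ?v + 1) + (step_bound W e * (2 * lcost (M ?v)) + (lcost (M ?v) + 1)) \<le> (3 + \<Lambda> + 2 * \<Lambda> * step_bound W e) * lcost (R s)"
  proof -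
    have "step_bound W e * (2 * lcost (M ?v)) \<le> step_bound W e * (2 * (\<Lambda> * lcost ?v))"
      using M_bound by (intro mult_left_mono) auto
    also have "\<dots> = 2 * \<Lambda> * step_bound W e * lcost ?v" by simp
    finally have "step_bound W e * (2 * lcost (M ?v)) \<le> 2 * \<Lambda> * step_bound W e * lcost ?v" .
    then show ?thesis using M_bound[of ?v] lcost_pos[of ?v] unfolding distrib_right by linarith
  qed
  ultimately have "reach_within Q inp (b, R', [])
        ((3 + \<Lambda> + 2 * \<Lambda> * step_bound W e) * lcost (R s)) (b + code_len e + 2, R2(d := ?val), [])"
    unfolding reach_within_def by (meson le_trans)
  then show ?thesis using R2(3) wd by (intro exI[of _ R2]) auto
qed

lemma lcost_shift: "lcost (a + K) + lcost K \<le> 2 * lcost K * lcost a + lcost a"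
proof -
  have "lcost (a + K) \<le> lcost a + lcost K" by (rule lcost_add)
  moreover have "lcost K \<le> lcost K * lcost a" using lcost_pos[of a] by simp
  moreover have "2 * lcost K * lcost a = lcost K * lcost a + lcost K * lcost a" by simp
  ultimately show ?thesis by linarith
qed

lemma sim_step:
  assumes pc: "pc < length P" and rel: "sim_rel R out R'"
    and st: "step g (P ! pc) (pc, R, out) = (pc2, R2, out2)"
  shows "\<exists>R2'. reach_within Q inp (start pc, R', []) (slowdown * cost g (P ! pc) R) (start pc2, R2', [])
    \<and> sim_rel R2 out2 R2'"
proof -
  have code: "code_at Q (start pc) (sim_block K inE insE start (start pc) (P ! pc))"
    by (rule sim_program_block[OF pc])
  have rel': "\<And>r. R' (r + K) = R r" "R' 2 = K" "R' 3 = 0" "R' 0 = foldl ins 0 out"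
    using rel by (auto simp: sim_rel_def)
  have small: "cost g (P ! pc) R \<le> slowdown * cost g (P ! pc) R"
    by (simp add: slowdown_def)
  have K: "K \<ge> 4" by (rule K_ge)
  then have ne: "r + K \<noteq> 0" "r + K \<noteq> 1" "r + K \<noteq> 2" "r + K \<noteq> 3" for r by auto
  have simple: ?thesis if "code_at Q (start pc) [i]" "cost inp i R' = cost g (P ! pc) R"
      "step inp i (start pc, R', []) = (start pc2, R2', [])" "sim_rel R2 out2 R2'" for i R2'
    using reach_within_step[of "start pc" Q i inp R' "cost g (P ! pc) R" "[]" 0 _ "slowdown * cost g (P ! pc) R"]
      that small by (metis add_0_right code_at.simps(2) order_refl reach_within_refl)
  note inv = inv_foldl[of out]
  show ?thesis
  proof (cases "P ! pc")
    case (Const d c)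
    show ?thesis
      by (rule simple[of "Const (d + K) c" "R'(d + K := c)"])
        (use code st Const rel' ne K start_Suc[OF pc] in \<open>auto simp: sim_rel_def\<close>)
  next
    case (Add d a b)
    show ?thesis
      by (rule simple[of "Add (d + K) (a + K) (b + K)" "R'(d + K := R a + R b)"])
        (use code st Add rel' ne K start_Suc[OF pc] in \<open>auto simp: sim_rel_def\<close>)
  next
    case (Sub d a b)
    show ?thesis
      by (rule simple[of "Sub (d + K) (a + K) (b + K)" "R'(d + K := R a - R b)"])
        (use code st Sub rel' ne K start_Suc[OF pc] in \<open>auto simp: sim_rel_def\<close>)
  next
    case (Mul d a b)
    show ?thesis
      by (rule simple[of "Mul (d + K) (a + K) (b + K)" "R'(d + K := R a * R b)"])
        (use code st Mul rel' ne K start_Suc[OF pc] in \<open>auto simp: sim_rel_def\<close>)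
  next
    case (Div d a b)
    show ?thesis
      by (rule simple[of "Div (d + K) (a + K) (b + K)" "R'(d + K := R a div R b)"])
        (use code st Div rel' ne K start_Suc[OF pc] in \<open>auto simp: sim_rel_def\<close>)
  next
    case (Jz s l)
    show ?thesis
      by (rule simple[of "Jz (s + K) (start l)" R'])
        (use code st Jz rel rel' ne K start_Suc[OF pc] in \<open>auto split: if_splits\<close>)
  next
    case (Load d s)
    have c: "start pc < length Q" "Q ! start pc = instr.Add 1 (s + K) 2"
       "Suc (start pc) < length Q" "Q ! Suc (start pc) = instr.Load (d + K) 1"
      using code Load by auto
    have "reach_within Q inp (start pc, R', []) (slowdown * cost g (P ! pc) R)
        (start pc2, R'(1 := R s + K, d + K := R (R s)), [])"
      apply (rule reach_within_step[OF c(1,2) order_refl, where T = "lcost (R s + K) + lcost (R (R s))"])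
       apply simp
       apply (rule reach_within_step[OF c(3,4) order_refl, where T = 0])
      using rel' ne K st Load start_Suc[OF pc] lcost_shift[of "R s"] lcost_pos[of "R s"]
        apply (auto intro!: reach_within_refl simp: slowdown_def algebra_simps)
      done
    moreover have "sim_rel R2 out2 (R'(1 := R s + K, d + K := R (R s)))"
      using rel' ne K st Load by (auto simp: sim_rel_def)
    ultimately show ?thesis by blast
  next
    case (Store d s)
    have c: "start pc < length Q" "Q ! start pc = instr.Add 1 (d + K) 2"
       "Suc (start pc) < length Q" "Q ! Suc (start pc) = instr.Store 1 (s + K)"
      using code Store by auto
    have "reach_within Q inp (start pc, R', []) (slowdown * cost g (P ! pc) R)
        (start pc2, R'(1 := R d + K, R d + K := R s), [])"
      apply (rule reach_within_step[OF c(1,2) order_refl, where T = "lcost (R d + K) + lcost (R s)"])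
       apply simp
       apply (rule reach_within_step[OF c(3,4) order_refl, where T = 0])
      using rel' ne K st Store start_Suc[OF pc] lcost_shift[of "R d"] lcost_pos[of "R d"]
        apply (auto intro!: reach_within_refl simp: slowdown_def algebra_simps)
      done
    moreover have "sim_rel R2 out2 (R'(1 := R d + K, R d + K := R s))"
      using rel' ne K st Store by (auto simp: sim_rel_def)
    ultimately show ?thesis by blast
  next
    case (Input d s)
    let ?val = "input_at g (R s)"
    obtain R'' where R'': "reach_within Q inp (start pc, R', [])
        ((3 + \<Lambda> + 2 * \<Lambda> * step_bound W inE) * lcost (R s))
        (start pc + code_len inE + 2, R''(d + K := ?val), [])"
     "\<forall>r. r < 4 \<or> r \<ge> K \<longrightarrow> R'' r = (R'(1 := R s)) r"
      using call_expr[OF rel _ input_tame[OF inv] K_ge(2), of "start pc" s "d + K"] code Input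
      unfolding input_eval[OF inv] by auto
    have pc2: "start pc2 = start pc + code_len inE + 2"
      using st Input start_Suc[OF pc] by auto
    have "(3 + \<Lambda> + 2 * \<Lambda> * step_bound W inE) * lcost (R s) \<le> slowdown * cost g (P ! pc) R"
      using Input by (intro mult_mono) (auto simp: slowdown_def algebra_simps)
    from reach_within_mono[OF R''(1) this]
    have "reach_within Q inp (start pc, R', []) (slowdown * cost g (P ! pc) R)
        (start pc2, R''(d + K := ?val), [])"
      by (simp only: pc2)
    moreover have R''v: "R'' (r + K) = R r" "R'' 2 = K" "R'' 3 = 0" "R'' 0 = foldl ins 0 out" for r
      using R''(2) rel' ne K by simp_all
    then have "sim_rel R2 out2 (R''(d + K := ?val))"
      using R''v ne K st Input by (auto simp: sim_rel_def)
    ultimately show ?thesis by blast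
  next
    case (Output s)
    let ?val = "ins (foldl ins 0 out) (R s)"
    obtain R'' where R'': "reach_within Q inp (start pc, R', [])
        ((3 + \<Lambda> + 2 * \<Lambda> * step_bound W insE) * lcost (R s))
        (start pc + code_len insE + 2, R''(0 := ?val), [])"
     "\<forall>r. r < 4 \<or> r \<ge> K \<longrightarrow> R'' r = (R'(1 := R s)) r"
      using call_expr[OF rel _ ins_tame[OF inv] K_ge(3), of "start pc" s "0"] code Output
      unfolding ins_eval[OF inv] by auto
    have pc2: "start pc2 = start pc + code_len insE + 2"
      using st Output start_Suc[OF pc] by auto
    have "(3 + \<Lambda> + 2 * \<Lambda> * step_bound W insE) * lcost (R s) \<le> slowdown * cost g (P ! pc) R"
      using Output by (intro mult_mono) (auto simp: slowdown_def algebra_simps)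
    from reach_within_mono[OF R''(1) this]
    have "reach_within Q inp (start pc, R', []) (slowdown * cost g (P ! pc) R)
        (start pc2, R''(0 := ?val), [])"
      by (simp only: pc2)
    moreover have R''v: "R'' (r + K) = R r" "R'' 2 = K" "R'' 3 = 0" "R'' 0 = foldl ins 0 out" for r
      using R''(2) rel' ne K by simp_all
    then have "sim_rel R2 out2 (R''(0 := ?val))"
      using R''v ne K st Output by (auto simp: sim_rel_def)
    ultimately show ?thesis by blast
  qed
qed

lemma sim_runs:
  assumes "runs P g c t y"
  shows "c = (pc, R, out) \<Longrightarrow> sim_rel R out R' \<Longrightarrow>
    \<exists>R''. reach_within Q inp (start pc, R', []) (slowdown * t) (start (length P), R'', []) \<and> R'' 0 = foldl ins 0 y"
  using assms
proof (induction arbitrary: pc R out R')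
  case (halt pc R out)
  then have "start pc = start (length P)" by (simp add: block_start_def)
  then show ?case using halt reach_within_refl by (fastforce simp: sim_rel_def)
next
  case (next_instr pc0 R0 out0 t y)
  obtain pc2 R2 out2 where st: "step g (P ! pc0) (pc0, R0, out0) = (pc2, R2, out2)"
    using prod_cases3 by blast
  obtain R2' where R2': "reach_within Q inp (start pc0, R', []) (slowdown * cost g (P ! pc0) R0) (start pc2, R2', [])"
    "sim_rel R2 out2 R2'"
    using sim_step[OF next_instr.hyps(1) _ st] next_instr.prems by blast
  obtain R'' where R'': "reach_within Q inp (start pc2, R2', []) (slowdown * t) (start (length P), R'', [])"
     "R'' 0 = foldl ins 0 y"
    using next_instr.IH[OF st R2'(2)] by blast
  show ?case
    using reach_within_trans[OF R2'(1) R''(1)] R''(2) next_instr.prems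
    by (auto simp: distrib_left)
qed

text \<open>The decoder must work for every \<open>v\<close>, because register 1 still holds
  whatever argument or address was used last.\<close>

theorem sim_computes:
  assumes "computes P g t y"
    and dec_tame: "\<And>v. tame inp Md W decE (arg_state (foldl ins 0 y) v)"
    and dec_eval: "\<And>v. eval inp decE (arg_state (foldl ins 0 y) v) = d" and "1 \<le> Md"
  shows "\<exists>t'. t' \<le> lcost K + slowdown * t + (2 * step_bound W decE + 1) * lcost Md \<and> computes Q inp t' [d]"
proof -
  have c0: "0 < length Q" "Q ! 0 = Const 2 K"
    by (simp_all add: sim_program_def)
  let ?R0 = "(\<lambda>_. 0 :: nat)(2 := K)"
  have "start 0 = 1" by (simp add: block_start_def)
  have "sim_rel (\<lambda>_. 0) [] ?R0"
    using K_ge(1) by (auto simp: sim_rel_def)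
  then obtain R where R: "reach_within Q inp (1, ?R0, []) (slowdown * t) (start (length P), R, [])"
     "R 0 = foldl ins 0 y"
    using sim_runs[OF assms(1)[unfolded computes_def] refl] \<open>start 0 = 1\<close> by metis
  let ?b = "start (length P)"
  have code: "code_at Q ?b (compile arg_regs 4 ?b decE)" "?b + code_len decE < length Q"
    "Q ! (?b + code_len decE) = Output 4"
    using sim_program_final[of inE insE decE P] by (auto simp: code_at_append)
  have rg: "\<forall>x. arg_regs x < 4" by simp
  have e: "R \<circ> arg_regs = arg_state (foldl ins 0 y) (R 1)"
    using R(2) by (intro arg_regs_state) auto
  obtain R2 where R2: "reach_within Q inp (?b, R, []) (step_bound W decE * (2 * lcost Md)) (?b + code_len decE, R2, [])"
    "R2 4 = d"
    using compile_correct[OF code(1), of inp Md W R "[]"] dec_tame assms(4) rg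
    unfolding e dec_eval by blast
  have "length Q = ?b + code_len decE + 1"
    using sim_blocks_length[of "length P" P inE insE]
    by (simp add: sim_program_def) (simp add: sim_blocks_def)
  then have h: "runs Q inp (?b + code_len decE + 1, R2, [d]) 0 [d]" by (intro halt) auto
  have dM: "lcost d \<le> lcost Md"
    using tame_eval_le[OF dec_tame] dec_eval lcost_mono by metis
  have "reach_within Q inp (?b + code_len decE, R2, []) (lcost Md) (?b + code_len decE + 1, R2, [d])"
    apply (rule reach_within_step[OF code(2,3), where C = "lcost Md" and T = 0])
    using R2(2) dM by (auto intro!: reach_within_refl)
  from reach_within_trans[OF R2(1) this order_refl]
  have a: "reach_within Q inp (?b, R, []) (step_bound W decE * (2 * lcost Md) + lcost Md) (?b + code_len decE + 1, R2, [d])" .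
  have "reach_within Q inp (0, \<lambda>_. 0, []) (lcost K + (slowdown * t + (step_bound W decE * (2 * lcost Md) + lcost Md)))
     (?b + code_len decE + 1, R2, [d])"
    apply (rule reach_within_step[OF c0 _ _ order_refl])
    using reach_within_trans[OF R(1) a order_refl] by auto
  then obtain t' where t': "t' \<le> lcost K + (slowdown * t + (step_bound W decE * (2 * lcost Md) + lcost Md))"
     "reach Q inp (0, \<lambda>_. 0, []) t' (?b + code_len decE + 1, R2, [d])"
    unfolding reach_within_def by blast
  have "computes Q inp (t' + 0) [d]"
    unfolding computes_def using reach_runs[OF t'(2) h] .
  then show ?thesis using t'(1) by (auto simp: algebra_simps)
qed

end

section \<open>A gap gadget from multiplicative hashing\<close>

text \<open>These are the multiples of \<open>z\<close> in an open interval of length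
  \<open>2 * d\<close> around \<open>c\<close>: the first one leaves room for at most
  \<open>2 * d div z\<close> further ones. The inequalities avoid subtraction, so the case
  \<open>c < d\<close> is not special.\<close>

lemma mult_interval_card:
  fixes z :: nat
  assumes "z > 0"
  shows "card {a. c < a * z + d \<and> a * z < c + d} \<le> 2 * d div z + 1"
proof (cases "\<exists>a. c < a * z + d \<and> a * z < c + d")
  case False
  then have e: "{a. c < a * z + d \<and> a * z < c + d} = {}" by blast
  show ?thesis unfolding e by simp
next
  case True
  define a0 where "a0 = (LEAST a. c < a * z + d \<and> a * z < c + d)"
  have a0: "c < a0 * z + d \<and> a0 * z < c + d" using True unfolding a0_def by (rule LeastI_ex)
  have "{a. c < a * z + d \<and> a * z < c + d} \<subseteq> {a0..a0 + 2 * d div z}"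
  proof
    fix a assume a: "a \<in> {a. c < a * z + d \<and> a * z < c + d}"
    then have "a0 \<le> a" unfolding a0_def by (auto intro: Least_le)
    moreover have "(a - a0) * z \<le> 2 * d"
    proof -
      have "a * z < c + d" "c < a0 * z + d" using a a0 by auto
      then show ?thesis unfolding diff_mult_distrib by linarith
    qed
    then have "a - a0 \<le> 2 * d div z"
      using assms by (simp add: less_eq_div_iff_mult_less_eq)
    ultimately show "a \<in> {a0..a0 + 2 * d div z}" by simp
  qed
  then have "card {a. c < a * z + d \<and> a * z < c + d} \<le> card {a0..a0 + 2 * d div z}"
    by (rule card_mono[rotated]) simp
  then show ?thesis by simp
qed

text \<open>Multiplicative hashing: \<open>x\<close> is multiplied by the fraction
  \<open>i / D\<close>, rounded down and reduced modulo \<open>q\<close>. The places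
  \<open>i < D * q\<close> form one full period.\<close>

definition hash :: "nat \<Rightarrow> nat \<Rightarrow> nat \<Rightarrow> nat \<Rightarrow> nat" where
  "hash D q i x = (i * x div D) mod q"

text \<open>With \<open>z = x - y\<close>, a collision at \<open>i\<close> forces
  \<open>i * z\<close> to lie within distance \<open>D\<close> of a multiple
  \<open>t * q * D\<close>, and \<open>i < D * q\<close> forces \<open>t \<le> z\<close>. Each of
  these \<open>z + 1\<close> intervals contains at most \<open>2 * D div z + 1\<close> multiples of
  \<open>z\<close>, and \<open>(z + 1) * (2 * D / z + 1) \<le> 5 * D\<close> because
  \<open>z < D\<close>.\<close>

lemma hash_collision_aux:
  assumes yx: "y < x" and xD: "x < D" and q: "q > 0"
  shows "card {i. i < D * q \<and> hash D q i x = hash D q i y} \<le> 5 * D"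
proof -
  define z where "z = x - y"
  have z: "0 < z" "z < D" using yx xD by (auto simp: z_def)
  have "{i. i < D * q \<and> hash D q i x = hash D q i y} \<subseteq>
      (\<Union>t\<in>{..z}. {i. t * q * D < i * z + D \<and> i * z < t * q * D + D})"
  proof
    fix i assume i: "i \<in> {i. i < D * q \<and> hash D q i x = hash D q i y}"
    let ?a = "i * x div D" and ?b = "i * y div D"
    have "?b \<le> ?a" using yx by (intro div_le_mono) simp
    moreover have "?a mod q = ?b mod q" using i by (simp add: hash_def)
    ultimately obtain t where t: "?a = ?b + q * t"
      by (metis mod_eq_dvd_iff_nat dvdE le_add_diff_inverse)
    have iz: "i * x = i * y + i * z" using yx unfolding z_def distrib_left[symmetric] by simp
    have "i * x = ?a * D + (i * x) mod D" "i * y = ?b * D + (i * y) mod D" by simp_all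
    moreover have "(i * x) mod D < D" "(i * y) mod D < D" using z by auto
    moreover have "?a * D = ?b * D + t * q * D" unfolding t by (simp add: algebra_simps)
    ultimately have 1: "t * q * D < i * z + D" "i * z < t * q * D + D" using iz by linarith+
    have "t \<le> z"
    proof (rule ccontr)
      assume "\<not> t \<le> z"
      then have "(z + 1) * (q * D) \<le> t * (q * D)" by (intro mult_right_mono) auto
      then have "z * (q * D) + q * D \<le> t * q * D" by (simp add: algebra_simps)
      moreover have "i * z + z \<le> D * q * z" 
        using mult_right_mono[of "i + 1" "D * q" z] i by (simp add: algebra_simps)
      moreover have "D \<le> q * D" using q by simp
      moreover have "D * q * z = z * (q * D)" by simp
      ultimately show False using 1 z by linarith
    qed
    then show "i \<in> (\<Union>t\<in>{..z}. {i. t * q * D < i * z + D \<and> i * z < t * q * D + D})" using 1 by auto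
  qed
  moreover have fin: "finite {i. c < i * z + D \<and> i * z < c + D}" for c
  proof (rule finite_subset)
    show "{i. c < i * z + D \<and> i * z < c + D} \<subseteq> {..c + D}"
    proof
      fix i assume "i \<in> {i. c < i * z + D \<and> i * z < c + D}"
      then have "i * z < c + D" by blast
      moreover have "i \<le> i * z" using z by simp
      ultimately have "i \<le> c + D" by linarith
      then show "i \<in> {..c + D}" by simp
    qed
  qed simp
  ultimately have "card {i. i < D * q \<and> hash D q i x = hash D q i y} \<le>
     card (\<Union>t\<in>{..z}. {i. t * q * D < i * z + D \<and> i * z < t * q * D + D})"
    by (intro card_mono) auto
  also have "\<dots> \<le> (\<Sum>t\<in>{..z}. card {i. t * q * D < i * z + D \<and> i * z < t * q * D + D})"
    by (rule card_UN_le) simp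
  also have "\<dots> \<le> (\<Sum>t\<in>{..z}. 2 * D div z + 1)"
    using z by (intro sum_mono mult_interval_card)
  also have "\<dots> = z * (2 * D div z) + 2 * D div z + z + 1" by simp
  also have "\<dots> \<le> 2 * D + 2 * D + D"
  proof -
    have "z * (2 * D div z) \<le> 2 * D" "2 * D div z \<le> 2 * D" by simp_all
    then show ?thesis using z by linarith
  qed
  finally show ?thesis by simp
qed

lemma hash_collision:
  assumes "x \<noteq> y" "x < D" "y < D" "q > 0"
  shows "card {i. i < D * q \<and> hash D q i x = hash D q i y} \<le> 5 * D"
proof (cases "y < x")
  case False
  then have "card {i. i < D * q \<and> hash D q i y = hash D q i x} \<le> 5 * D"
    using assms by (intro hash_collision_aux) auto
  then show ?thesis by (simp add: eq_commute)
qed (use assms in \<open>auto intro: hash_collision_aux\<close>)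

text \<open>Allows tuples to be numbers: digits represent the selectors \<open>a\<close> in
  \<open>{0..<q}^k\<close>, the functions \<open>f\<close> from selectors to clauses, and the bits
  of partial assignments.\<close>

lemma digits_exist:
  fixes m A :: nat
  assumes "\<And>a. a < A \<Longrightarrow> u a < m"
  shows "\<exists>f<m ^ A. \<forall>a<A. (f div m ^ a) mod m = u a"
  using assms
proof (induction A)
  case (Suc A)
  then obtain f where f: "f < m ^ A" "\<forall>a<A. (f div m ^ a) mod m = u a" by auto
  have u: "u A < m" using Suc by simp
  let ?f = "f + u A * m ^ A"
  have "?f < m ^ Suc A"
  proof -
    have "?f < m ^ A + u A * m ^ A" using f by simp
    also have "\<dots> = (u A + 1) * m ^ A" by simp
    also have "\<dots> \<le> m * m ^ A" using u by (intro mult_right_mono) auto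
    finally show ?thesis by simp
  qed
  moreover have "(?f div m ^ a) mod m = u a" if "a < Suc A" for a
  proof (cases "a = A")
    case True
    then show ?thesis using f u by simp
  next
    case False
    then have a: "a < A" using that by simp
    have "m ^ A = m ^ (A - a - 1) * m * m ^ a"
      using a by (metis Suc_diff_Suc le_add_diff_inverse2 less_imp_le mult.commute power_Suc power_add diff_Suc_eq_diff_pred diff_commute)
    then have "?f = f + (u A * m ^ (A - a - 1) * m) * m ^ a" by simp
    then have "?f div m ^ a = f div m ^ a + u A * m ^ (A - a - 1) * m"
      using u by (metis div_mult_self1 not_less_zero power_not_zero neq0_conv add.commute)
    then show ?thesis using f a by simp
  qed
  ultimately show ?case by blast
qed simp

section \<open>Dominating sets of the gap graph\<close>

locale gadget =
  fixes k D q m h :: nat and sat :: "nat \<Rightarrow> nat \<Rightarrow> nat \<Rightarrow> bool"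
  assumes k: "k \<ge> 1" and D: "D \<ge> 1" and h: "6 * h * h < q"
begin

abbreviation "A \<equiv> q ^ k"
abbreviation "E \<equiv> m ^ A"
abbreviation "S \<equiv> k * D"
text \<open>Numbering of the vertices: \<open>j * D + x\<close> is the partial assignment (j, x),
  and \<open>S + (i * E + f)\<close> is the vertex (i, f). The argument \<open>e\<close> of
  \<open>covers\<close> is \<open>i * E + f\<close>.\<close>

definition V :: nat where "V = S + D * q * E"

definition covers :: "nat \<Rightarrow> nat \<Rightarrow> bool" where
  "covers s e \<longleftrightarrow> (\<exists>a<A. (a div q ^ (s div D)) mod q = hash D q (e div E) (s mod D) \<and>
     sat (s div D) (s mod D) ((e mod E div m ^ a) mod m))"

definition adj :: "nat \<Rightarrow> nat \<Rightarrow> bool" where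
  "adj u v \<longleftrightarrow> (if u < S then (if v < S then u \<noteq> v else covers u (v - S))
     else v < S \<and> covers v (u - S))"

definition G :: "(nat \<times> nat) set" where
  "G = {(u, v). u < V \<and> v < V \<and> adj u v}"

lemma simple_graph_G: "simple_graph V G"
  unfolding simple_graph_def G_def adj_def sym_def irrefl_def by auto

lemma q_pos: "q > 0" using h by simp

lemma complete:
  assumes g: "\<And>j. j < k \<Longrightarrow> g j < D" and sat: "\<And>u. u < m \<Longrightarrow> \<exists>j<k. sat j (g j) u"
  shows "domination_number {..<V} G \<le> k"
proof -
  define X where "X = (\<lambda>j. j * D + g j) ` {..<k}"
  have S: "j * D + g j < S" if "j < k" for j
  proof -
    have "j * D + g j < (j + 1) * D" using g[OF that] by simp
    also have "\<dots> \<le> S" using that by (intro mult_right_mono) auto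
    finally show ?thesis .
  qed
  have "dominating_set {..<V} G X"
    unfolding dominating_set_def
  proof (intro conjI ballI)
    show "X \<subseteq> {..<V}" using S unfolding X_def V_def by (auto intro: trans_less_add1)
  next
    fix v assume v: "v \<in> {..<V} - X"
    show "\<exists>u\<in>X. (v, u) \<in> G"
    proof (cases "v < S")
      case True
      have "0 * D + g 0 \<in> X" unfolding X_def using k by (intro imageI) simp
      moreover have "(v, 0 * D + g 0) \<in> G"
        using True S[of 0] k v calculation by (auto simp: G_def adj_def V_def)
      ultimately show ?thesis by blast
    next
      case False
      define e where "e = v - S"
      have "e < D * q * E" using v False by (auto simp: e_def V_def)
      \<comment> \<open>Without clauses \<open>E\<close> is 0 and there is no such vertex.\<close>
      then have m: "m > 0" using q_pos by (metis gr0I mult_0_right not_less_zero power_eq_0_iff zero_less_power)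
      \<comment> \<open>The selector whose digits are the letters of the chosen blocks themselves at
        this place; whichever block satisfies the clause \<open>f(a)\<close> then dominates
        \<open>v\<close>.\<close>
      obtain a where a: "a < A" "\<forall>j<k. (a div q ^ j) mod q = hash D q (e div E) (g j)"
        using digits_exist[of k "\<lambda>j. hash D q (e div E) (g j)" q] q_pos by (auto simp: hash_def)
      obtain j where j: "j < k" "sat j (g j) ((e mod E div m ^ a) mod m)"
        using sat[of "(e mod E div m ^ a) mod m"] m by auto
      have "covers (j * D + g j) e"
        unfolding covers_def using a j g[OF j(1)] by (intro exI[of _ a]) auto
      then have "(v, j * D + g j) \<in> G"
        using S[OF j(1)] v False by (auto simp: G_def adj_def V_def e_def)
      then show ?thesis using j by (auto simp: X_def)
    qed
  qed
  then have "domination_number {..<V} G \<le> card X"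
    unfolding domination_number_def by (blast intro: Least_le)
  also have "\<dots> \<le> k" unfolding X_def using card_image_le[of "{..<k}"] by auto
  finally show ?thesis .
qed

lemma sound:
  assumes unsat: "\<And>g. (\<And>j. g j < D) \<Longrightarrow> \<exists>u<m. \<forall>j. \<not> sat j (g j) u"
    and X: "dominating_set {..<V} G X"
  shows "h < card X"
proof (rule ccontr)
  assume "\<not> h < card X"
  then have card: "card X \<le> h" by simp
  have XV: "X \<subseteq> {..<V}" using X by (auto simp: dominating_set_def)
  then have fin: "finite X" by (rule finite_subset) simp
  define pairs where "pairs = {p \<in> X \<times> X. fst p mod D \<noteq> snd p mod D}"
  have finp: "finite pairs" using fin by (auto simp: pairs_def)
  define col where "col p = {i. i < D * q \<and> hash D q i (fst p mod D) = hash D q i (snd p mod D)}" for p :: "nat \<times> nat"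
  \<comment> \<open>Two kinds of places are excluded: collisions inside \<open>X\<close>, and the
    places of vertices (i, f) in \<open>X\<close>. Truncated subtraction assigns place 0 to the
    members below \<open>S\<close>; this is harmless, since the second kind is bounded by
    \<open>card X\<close> alone.\<close>
  define bad where "bad = (\<Union>p\<in>pairs. col p) \<union> (\<lambda>v. (v - S) div E) ` X"
  have finc: "finite (col p)" for p by (auto simp: col_def)
  have "card bad \<le> card (\<Union>p\<in>pairs. col p) + card ((\<lambda>v. (v - S) div E) ` X)"
    unfolding bad_def by (rule card_Un_le)
  also have "\<dots> \<le> (\<Sum>p\<in>pairs. card (col p)) + card X"
    using finp fin by (intro add_mono card_UN_le card_image_le)
  also have "(\<Sum>p\<in>pairs. card (col p)) \<le> (\<Sum>p\<in>pairs. 5 * D)"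
    unfolding col_def pairs_def using D q_pos by (intro sum_mono hash_collision) auto
  also have "\<dots> = card pairs * (5 * D)" by simp
  also have "card pairs \<le> card (X \<times> X)"
    unfolding pairs_def using fin by (intro card_mono) auto
  also have "card (X \<times> X) \<le> h * h" unfolding card_cartesian_product using card by (intro mult_mono) auto
  finally have "card bad \<le> h * h * (5 * D) + h" using card by simp
  \<comment> \<open>The origin of the 6: five from the collisions and one from the places occupied
    by \<open>X\<close>.\<close>
  also have "\<dots> \<le> h * h * (5 * D) + h * h * D"
    using D by (intro add_left_mono) (simp add: mult.assoc)
  also have "\<dots> = 6 * h * h * D" by simp
  also have "\<dots> < q * D" using h D by (intro mult_strict_right_mono) auto
  finally have "card bad < card {..<D * q}" by (simp add: mult.commute)
  moreover have "finite bad" unfolding bad_def using finp fin finc by auto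
  ultimately obtain i where i: "i < D * q" "i \<notin> bad"
    by (metis card_mono lessThan_iff not_less subsetI)
  define P where "P a j x \<longleftrightarrow> x < D \<and> j * D + x \<in> X \<and> (a div q ^ j) mod q = hash D q i x" for a j x
  \<comment> \<open>\<open>P a j x\<close> says that \<open>a\<close> selects (j, x) from
    \<open>X\<close>. A block without a selected member gets the default 0, since
    \<open>unsat\<close> speaks about total choices.\<close>
  define g where "g a j = (if \<exists>x. P a j x then SOME x. P a j x else 0)" for a j
  have gD: "g a j < D" for a j
  proof (cases "\<exists>x. P a j x")
    case True
    then have "P a j (SOME x. P a j x)" by (rule someI_ex)
    then have "P a j (g a j)" using True by (simp only: g_def if_True)
    then show ?thesis by (simp add: P_def)
  qed (use D in \<open>auto simp: g_def\<close>)
  have gP: "g a j = x" if "P a j x" for a j x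
  proof -
    have "P a j (SOME x. P a j x)" using that by (rule someI)
    moreover have "\<exists>x. P a j x" using that by blast
    ultimately have "P a j (g a j)" by (simp only: g_def if_True)
    \<comment> \<open>Otherwise the two words would agree at \<open>i\<close>, which is not a bad
      place.\<close>
    then have "(j * D + g a j, j * D + x) \<notin> pairs"
      using that i by (auto simp: P_def bad_def col_def)
    then show ?thesis using \<open>P a j (g a j)\<close> that by (auto simp: P_def pairs_def)
  qed
  obtain u where u: "\<And>a. u a < m \<and> (\<forall>j. \<not> sat j (g a j) (u a))"
  proof -
    have "\<exists>u. u < m \<and> (\<forall>j. \<not> sat j (g a j) u)" for a
      using unsat[of "g a"] gD by blast
    then show ?thesis using that by metis
  qed
  obtain f where f: "f < E" "\<forall>a<A. (f div m ^ a) mod m = u a"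
    using digits_exist[of A u m] u by auto
  define v where "v = S + (i * E + f)"
  have "i * E + f < (i + 1) * E" using f by simp
  also have "\<dots> \<le> D * q * E" using i by (intro mult_right_mono) auto
  finally have vV: "v < V" by (simp add: v_def V_def)
  have vi: "(v - S) div E = i" 
  proof -
    have "E \<noteq> 0" using f(1) by linarith
    then have "(f + i * E) div E = i + f div E" by (rule div_mult_self1)
    also have "\<dots> = i" using f(1) by (simp only: div_less add_0_right)
    finally show ?thesis by (simp only: v_def diff_add_inverse add.commute[of f])
  qed
  then have "v \<notin> X" using i by (auto simp: bad_def)
  then obtain w where w: "w \<in> X" "(v, w) \<in> G" using X vV by (auto simp: dominating_set_def)
  then have cov: "w < S" "covers w (i * E + f)" by (auto simp: G_def adj_def v_def)
  then obtain a where a: "a < A" "(a div q ^ (w div D)) mod q = hash D q i (w mod D)"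
     "sat (w div D) (w mod D) (u a)"
    using f vi[unfolded v_def diff_add_inverse] unfolding covers_def by auto
  \<comment> \<open>The dominating vertex \<open>w\<close> is itself selected by \<open>a\<close>,
    so \<open>g\<close> returns it; but \<open>u a\<close> was chosen as a clause that no block of
    \<open>g a\<close> satisfies.\<close>
  have "P a (w div D) (w mod D)" using a w D by (auto simp: P_def)
  then show False using u a gP by metis
qed

end

section \<open>Encodings of vertex sets, graphs and formulas\<close>

primrec num_of_digits :: "nat \<Rightarrow> nat list \<Rightarrow> nat" where
  "num_of_digits B [] = 0"
| "num_of_digits B (d # ds) = d + B * num_of_digits B ds"

lemma num_of_digits_less:
  "set ds \<subseteq> {..<B} \<Longrightarrow> num_of_digits B ds < B ^ length ds"
proof (induction ds)
  case (Cons d ds)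
  then have "d + B * num_of_digits B ds < B + B * num_of_digits B ds" by simp
  also have "\<dots> = B * (num_of_digits B ds + 1)" by simp
  also have "\<dots> \<le> B * B ^ length ds" using Cons by (intro mult_left_mono) auto
  finally show ?case by simp
qed simp

lemma num_of_digits_ge:
  "set ds \<subseteq> {1..<B} \<Longrightarrow> l < length ds \<Longrightarrow> B ^ l \<le> num_of_digits B ds"
proof (induction ds arbitrary: l)
  case (Cons d ds)
  show ?case
  proof (cases l)
    case (Suc l')
    then have "B ^ l' \<le> num_of_digits B ds" using Cons by simp
    then have "B * B ^ l' \<le> B * num_of_digits B ds" by (rule mult_le_mono2)
    then show ?thesis unfolding Suc num_of_digits.simps power_Suc by (rule trans_le_add2)
  qed (use Cons in auto)
qed simp

lemma num_of_digits_less_iff: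
  assumes "set ds \<subseteq> {1..<B}" "B \<ge> 1"
  shows "num_of_digits B ds < B ^ l \<longleftrightarrow> length ds \<le> l"
proof
  assume "num_of_digits B ds < B ^ l"
  then show "length ds \<le> l" using num_of_digits_ge[OF assms(1), of l] by (meson not_le)
next
  assume l: "length ds \<le> l"
  show "num_of_digits B ds < B ^ l"
  proof -
    have "B ^ length ds \<le> B ^ l" using l assms(2) by (intro power_increasing)
    moreover have "set ds \<subseteq> {..<B}" using assms(1) by auto
    ultimately show ?thesis using num_of_digits_less[of ds B] by linarith
  qed
qed

lemma num_of_digits_nth:
  "set ds \<subseteq> {..<B} \<Longrightarrow>
    (num_of_digits B ds div B ^ i) mod B = (if i < length ds then ds ! i else 0)"
proof (induction ds arbitrary: i)
  case (Cons d ds)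
  then have d: "d < B" by simp
  show ?case
  proof (cases i)
    case (Suc i')
    have "(d + B * num_of_digits B ds) div B ^ i = ((d + B * num_of_digits B ds) div B) div B ^ i'"
      unfolding Suc power_Suc by (simp add: div_mult2_eq)
    also have "\<dots> = num_of_digits B ds div B ^ i'"
      using d by simp
    finally show ?thesis using Cons Suc by simp
  qed (use d in simp)
qed simp

text \<open>
  A set of vertices below \<open>V\<close> is kept as a number whose digits in base \<open>V + 1\<close> are the successors of the
  elements. These digits are positive, so the size of the set can be read off the size of the number.
  Nothing is inserted once there are \<open>h + 1\<close> elements, since such a set is rejected anyway.
\<close>
definition insert_num :: "nat \<Rightarrow> nat \<Rightarrow> nat \<Rightarrow> nat \<Rightarrow> nat" where
  "insert_num V h X y =
     (if X < (V + 1) ^ h \<and> \<not> (\<exists>i<h + 1. (X div (V + 1) ^ i) mod (V + 1) = y mod V + 1)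
      then X * (V + 1) + (y mod V + 1) else X)"

text \<open>Equality with the set of outputs may be lost once \<open>h + 1\<close> digits are
  stored; inclusion remains, which suffices to recognise that the set is too large. Reduction modulo
  \<open>V\<close> gives a meaning to arbitrary outputs, because a program that owes no guarantee
  may print any number.\<close>

lemma foldl_insert_num:
  assumes V: "V \<ge> 1"
  shows "\<exists>ds. foldl (insert_num V h) 0 ys = num_of_digits (V + 1) ds \<and> distinct ds \<and>
    set ds \<subseteq> (\<lambda>y. y mod V + 1) ` set ys \<and>
    (length ds \<le> h \<longrightarrow> set ds = (\<lambda>y. y mod V + 1) ` set ys) \<and> length ds \<le> h + 1"
proof (induction ys rule: rev_induct)
  case Nil
  then show ?case by (intro exI[of _ "[]"]) simp
next
  case (snoc y ys)
  let ?f = "\<lambda>y. y mod V + 1"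
  obtain ds where ds: "foldl (insert_num V h) 0 ys = num_of_digits (V + 1) ds" "distinct ds"
    "set ds \<subseteq> ?f ` set ys" "length ds \<le> h \<longrightarrow> set ds = ?f ` set ys" "length ds \<le> h + 1"
    using snoc by blast
  let ?X = "num_of_digits (V + 1) ds" and ?d = "?f y"
  have f: "?f ` set ys \<subseteq> {1..<V + 1}" using V by (auto simp: less_Suc_eq_0_disj Suc_le_eq)
  note s = subset_trans[OF ds(3) f]
  have "{1..<V + 1} \<subseteq> {..<V + 1}" by auto
  note s1 = s subset_trans[OF s this]
  note less = num_of_digits_less_iff[OF s1(1) le_add2, of h]
  have mem: "(\<exists>i<h + 1. (?X div (V + 1) ^ i) mod (V + 1) = ?d) \<longleftrightarrow> ?d \<in> set ds"
    unfolding num_of_digits_nth[OF s1(2)] in_set_conv_nth using ds(5) by (auto; metis le_imp_less_Suc less_le_trans)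
  show ?case
  proof (cases "length ds \<le> h \<and> ?d \<notin> set ds")
    case True
    then have "insert_num V h ?X y = ?X * (V + 1) + ?d"
      unfolding insert_num_def less mem by (simp only: if_True simp_thms)
    then have "foldl (insert_num V h) 0 (ys @ [y]) = num_of_digits (V + 1) (?d # ds)"
      using ds(1) by simp
    then show ?thesis using ds True by (intro exI[of _ "?d # ds"]) auto
  next
    case False
    then have "insert_num V h ?X y = ?X"
      unfolding insert_num_def less mem by simp
    then have "foldl (insert_num V h) 0 (ys @ [y]) = ?X" using ds(1) by simp
    then show ?thesis using ds False by (intro exI[of _ ds]) auto
  qed
qed

lemma insert_num_bound:
  assumes "X < (V + 1) ^ (h + 1)" "V \<ge> 1"
  shows "insert_num V h X y < (V + 1) ^ (h + 1)"
proof -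
  have "X * (V + 1) + (y mod V + 1) < (V + 1) ^ (h + 1)" if "X < (V + 1) ^ h"
  proof -
    have "X * (V + 1) + (y mod V + 1) < X * (V + 1) + (V + 1)"
      using assms(2) by simp
    also have "\<dots> = (X + 1) * (V + 1)" by simp
    also have "\<dots> \<le> (V + 1) ^ h * (V + 1)" using that by (intro mult_right_mono) auto
    finally show ?thesis by (simp only: power_add power_one_right)
  qed
  then show ?thesis using assms unfolding insert_num_def by auto
qed

definition accepts :: "(nat \<Rightarrow> nat \<Rightarrow> bool) \<Rightarrow> nat \<Rightarrow> nat \<Rightarrow> nat \<Rightarrow> bool" where
  "accepts adj V h X \<longleftrightarrow> X < (V + 1) ^ h \<and>
     (\<forall>v<V. \<exists>i<h + 1. (X div (V + 1) ^ i) mod (V + 1) \<noteq> 0 \<and>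
        ((X div (V + 1) ^ i) mod (V + 1) = v + 1 \<or> adj v ((X div (V + 1) ^ i) mod (V + 1) - 1)))"

lemma ex_nth_nonzero:
  fixes ds :: "nat list"
  assumes "length ds \<le> N" "0 \<notin> set ds"
  shows "(\<exists>i<N. (if i < length ds then ds ! i else 0) \<noteq> 0 \<and>
      P (if i < length ds then ds ! i else 0)) \<longleftrightarrow> (\<exists>d\<in>set ds. P d)"
proof
  assume "\<exists>d\<in>set ds. P d"
  then obtain i where "i < length ds" "P (ds ! i)" by (metis in_set_conv_nth)
  then show "\<exists>i<N. (if i < length ds then ds ! i else 0) \<noteq> 0 \<and> P (if i < length ds then ds ! i else 0)"
    using assms nth_mem[of i ds] by (intro exI[of _ i]) (auto simp del: nth_mem intro: gr0I)
next
  assume "\<exists>i<N. (if i < length ds then ds ! i else 0) \<noteq> 0 \<and> P (if i < length ds then ds ! i else 0)"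
  then obtain i where i: "(if i < length ds then ds ! i else 0) \<noteq> 0" "P (if i < length ds then ds ! i else 0)"
    by blast
  then have "i < length ds" by presburger
  then show "\<exists>d\<in>set ds. P d" using i(2) by (intro bexI[of _ "ds ! i"]) simp_all
qed

context gadget
begin

lemma V_pos: "V \<ge> 1"
proof -
  have "1 * 1 \<le> k * D" using k D by (rule mult_le_mono)
  then show ?thesis unfolding V_def mult_1 by (rule trans_le_add1)
qed

lemma accepts_iff:
  "accepts adj V h (foldl (insert_num V h) 0 ys) \<longleftrightarrow>
     (let X = (\<lambda>y. y mod V) ` set ys in card X \<le> h \<and> dominating_set {..<V} G X)"
proof -
  let ?f = "\<lambda>y. y mod V + 1"
  let ?X = "(\<lambda>y. y mod V) ` set ys"
  obtain ds where ds: "foldl (insert_num V h) 0 ys = num_of_digits (V + 1) ds" "distinct ds"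
    "set ds \<subseteq> ?f ` set ys" "length ds \<le> h \<longrightarrow> set ds = ?f ` set ys" "length ds \<le> h + 1"
    using foldl_insert_num[OF V_pos] by blast
  let ?N = "num_of_digits (V + 1) ds"
  have XV: "?X \<subseteq> {..<V}" using V_pos by auto
  have fX: "?f ` set ys = Suc ` ?X" by (auto simp: image_image)
  have f: "?f ` set ys \<subseteq> {1..<V + 1}" using XV by auto
  note s = subset_trans[OF ds(3) f]
  have "{1..<V + 1} \<subseteq> {..<V + 1}" by auto
  note s1 = s subset_trans[OF s this]
  note less = num_of_digits_less_iff[OF s1(1) le_add2, of h]
  have len: "length ds = card (set ds)" using ds(2) by (simp add: distinct_card)
  have card: "card (?f ` set ys) = card ?X" unfolding fX by (rule card_image) simp
  have lX: "length ds \<le> h \<longleftrightarrow> card ?X \<le> h"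
  proof
    assume a: "length ds \<le> h"
    then have e: "set ds = ?f ` set ys" using ds(4) by blast
    show "card ?X \<le> h" using a unfolding len e card .
  next
    assume "card ?X \<le> h"
    moreover have "card (set ds) \<le> card (?f ` set ys)" using ds(3) by (intro card_mono) auto
    ultimately show "length ds \<le> h" unfolding len card by linarith
  qed
  have eq: "(\<exists>i<h + 1. (?N div (V + 1) ^ i) mod (V + 1) \<noteq> 0 \<and>
        ((?N div (V + 1) ^ i) mod (V + 1) = v + 1 \<or> adj v ((?N div (V + 1) ^ i) mod (V + 1) - 1))) \<longleftrightarrow>
     (\<exists>u\<in>?X. u = v \<or> adj v u)" if h: "length ds \<le> h" for v
  proof -
    have "(\<exists>i<h + 1. (?N div (V + 1) ^ i) mod (V + 1) \<noteq> 0 \<and>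
        ((?N div (V + 1) ^ i) mod (V + 1) = v + 1 \<or> adj v ((?N div (V + 1) ^ i) mod (V + 1) - 1))) \<longleftrightarrow>
      (\<exists>d\<in>set ds. d = v + 1 \<or> adj v (d - 1))"
      unfolding num_of_digits_nth[OF s1(2)] 
    proof (rule ex_nth_nonzero)
      show "length ds \<le> h + 1" using h by simp
      show "0 \<notin> set ds" using s1(1) by force
    qed
    also have "\<dots> \<longleftrightarrow> (\<exists>u\<in>?X. u = v \<or> adj v u)"
    proof -
      have e: "set ds = Suc ` ?X" using ds(4) h unfolding fX by blast
      show ?thesis unfolding e by auto
    qed
    finally show ?thesis .
  qed
  have "accepts adj V h ?N \<longleftrightarrow> length ds \<le> h \<and> (\<forall>v<V. \<exists>u\<in>?X. u = v \<or> adj v u)"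
  proof (cases "length ds \<le> h")
    case True
    then show ?thesis unfolding accepts_def less eq[OF True] by (simp only: simp_thms)
  next
    case False
    then show ?thesis unfolding accepts_def less by (simp only: simp_thms)
  qed
  also have "(\<forall>v<V. \<exists>u\<in>?X. u = v \<or> adj v u) \<longleftrightarrow> dominating_set {..<V} G ?X"
  proof
    assume L: "\<forall>v<V. \<exists>u\<in>?X. u = v \<or> adj v u"
    show "dominating_set {..<V} G ?X"
      unfolding dominating_set_def
    proof (intro conjI XV ballI)
      fix v assume v: "v \<in> {..<V} - ?X"
      then obtain u where u: "u \<in> ?X" "u = v \<or> adj v u" using L by blast
      then have "adj v u" "u < V" using v XV by blast+
      then show "\<exists>u\<in>?X. (v, u) \<in> G" using u(1) v unfolding G_def by blast
    qed
  next
    assume R: "dominating_set {..<V} G ?X"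
    show "\<forall>v<V. \<exists>u\<in>?X. u = v \<or> adj v u"
    proof (intro allI impI)
      fix v assume "v < V"
      then have "v \<in> ?X \<or> (\<exists>u\<in>?X. (v, u) \<in> G)" using R unfolding dominating_set_def by blast
      then show "\<exists>u\<in>?X. u = v \<or> adj v u"
      proof
        assume "\<exists>u\<in>?X. (v, u) \<in> G"
        then show ?thesis unfolding G_def mem_Collect_eq case_prod_conv by (rule bexE) (erule bexI[rotated], elim conjE, erule disjI2)
      qed (rule bexI[where x = v], auto)
    qed
  qed
  finally show ?thesis unfolding ds(1) lX Let_def .
qed

end

section \<open>Random access to the encoded graph and formula\<close>

lemma nth_concat_uniform:
  assumes "\<And>xs. xs \<in> set xss \<Longrightarrow> length xs = n" "i < length xss * n"
  shows "concat xss ! i = xss ! (i div n) ! (i mod n)"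
  using assms
proof (induction xss arbitrary: i)
  case (Cons xs xss)
  then have xs: "length xs = n" by simp
  have n: "n > 0" using Cons(3) by (cases n) auto
  show ?case
  proof (cases "i < n")
    case False
    then have i: "i = n + (i - n)" by simp
    have "concat xss ! (i - n) = xss ! ((i - n) div n) ! ((i - n) mod n)"
      using Cons False by (intro Cons.IH) auto
    moreover have "i div n = Suc ((i - n) div n)" "i mod n = (i - n) mod n"
      using False n by (simp_all add: le_div_geq le_mod_geq)
    ultimately show ?thesis using xs False by (simp add: nth_append)
  qed (use xs in \<open>simp add: nth_append\<close>)
qed simp

lemma input_at_graph:
  assumes "n \<ge> 1"
  shows "input_at (graph_input n E) i =
    (if i = 0 then n else if (i - 1) div n < n then of_bool (((i - 1) div n, (i - 1) mod n) \<in> E) else 0)"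
proof (cases i)
  case (Suc j)
  let ?xss = "map (\<lambda>u. map (\<lambda>v. of_bool ((u, v) \<in> E) :: nat) [0..<n]) [0..<n]"
  have len: "length (concat ?xss) = n * n"
    by (simp add: length_concat comp_def sum_list_triv)
  have j: "j div n < n \<longleftrightarrow> j < n * n"
    using assms by (simp add: div_less_iff_less_mult)
  show ?thesis
  proof (cases "j < n * n")
    case True
    then have "concat ?xss ! j = ?xss ! (j div n) ! (j mod n)"
      by (intro nth_concat_uniform) auto
    also have "\<dots> = of_bool ((j div n, j mod n) \<in> E)" using True j assms by simp
    finally show ?thesis using True j Suc len
      unfolding input_at_def graph_input_def by simp
  next
    case False
    then show ?thesis using j Suc len unfolding input_at_def graph_input_def by simp
  qed
qed (simp add: input_at_def graph_input_def)

text \<open>Index of the length field of clause \<open>u\<close>; the 2 skips the header.\<close>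

definition clause_pos :: "cnf \<Rightarrow> nat \<Rightarrow> nat" where
  "clause_pos F u = 2 + (\<Sum>C\<leftarrow>take u F. length C + 1)"

lemma clause_pos_Suc: "u < length F \<Longrightarrow> clause_pos F (Suc u) = clause_pos F u + length (F ! u) + 1"
  by (simp add: clause_pos_def take_Suc_conv_app_nth)

lemma input_at_cnf_header: "input_at (cnf_input n F) 0 = n" "input_at (cnf_input n F) 1 = length F"
  by (simp_all add: input_at_def cnf_input_def)

lemma input_at_cnf:
  assumes u: "u < length F"
  shows "input_at (cnf_input n F) (clause_pos F u) = length (F ! u)"
    and "i < length (F ! u) \<Longrightarrow> input_at (cnf_input n F) (clause_pos F u + 1 + i) =
      (case F ! u ! i of (v, b) \<Rightarrow> 2 * v + of_bool b)"
proof -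
  let ?e = "\<lambda>C. length C # map (\<lambda>(v, b). 2 * v + of_bool b) C"
  let ?p = "n # length F # concat (map ?e (take u F))"
  have "F = take u F @ F ! u # drop (Suc u) F" using u by (rule id_take_nth_drop)
  then have "concat (map ?e F) = concat (map ?e (take u F)) @ ?e (F ! u) @ concat (map ?e (drop (Suc u) F))"
    by (metis (no_types, lifting) concat.simps(2) concat_append list.simps(9) map_append)
  then have x: "cnf_input n F = ?p @ ?e (F ! u) @ concat (map ?e (drop (Suc u) F))"
    unfolding cnf_input_def by simp
  have p: "clause_pos F u = length ?p"
    by (simp add: clause_pos_def length_concat comp_def)
  have at: "input_at (ps @ qs @ rs) (length ps + j) = qs ! j" if "j < length qs" for ps qs rs :: "nat list" and j
    using that by (simp add: input_at_def nth_append)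
  show "input_at (cnf_input n F) (clause_pos F u) = length (F ! u)"
    using at[of 0 "?e (F ! u)" ?p "concat (map ?e (drop (Suc u) F))"] unfolding x p by simp
  show "input_at (cnf_input n F) (clause_pos F u + 1 + i) =
      (case F ! u ! i of (v, b) \<Rightarrow> 2 * v + of_bool b)" if "i < length (F ! u)"
    using at[of "Suc i" "?e (F ! u)" ?p "concat (map ?e (drop (Suc u) F))"] that unfolding x p by simp
qed

text \<open>Variable \<open>v\<close> is bit \<open>v mod L\<close> of the assignment to block
  \<open>v div L\<close>.\<close>

definition block_sat :: "nat \<Rightarrow> cnf \<Rightarrow> nat \<Rightarrow> nat \<Rightarrow> nat \<Rightarrow> bool" where
  "block_sat L F j x u \<longleftrightarrow> (\<exists>(v, b)\<in>set (F ! u). v div L = j \<and> odd (x div 2 ^ (v mod L)) = b)"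

lemma satisfiable_block_sat:
  assumes F: "w_cnf w n F" and sat: "satisfiable F" and L: "n \<le> k * L" "L > 0"
  shows "\<exists>g. (\<forall>j. g j < 2 ^ L) \<and> (\<forall>u<length F. \<exists>j<k. block_sat L F j (g j) u)"
proof -
  obtain \<alpha> where \<alpha>: "\<forall>C\<in>set F. \<exists>(v, b)\<in>set C. \<alpha> v = b" using sat by (auto simp: satisfiable_def)
  have "\<exists>x<2 ^ L. \<forall>p<L. (x div 2 ^ p) mod 2 = (of_bool (\<alpha> (j * L + p)) :: nat)" for j
    by (rule digits_exist) simp
  then obtain g where g: "\<And>j. g j < 2 ^ L" "\<And>j p. p < L \<Longrightarrow> (g j div 2 ^ p) mod 2 = (of_bool (\<alpha> (j * L + p)) :: nat)"
    by metis
  have "\<exists>j<k. block_sat L F j (g j) u" if u: "u < length F" for u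
  proof -
    obtain v b where vb: "(v, b) \<in> set (F ! u)" "\<alpha> v = b" using \<alpha> u nth_mem by blast
    then have "v < n" using F u nth_mem unfolding w_cnf_def by blast
    then have j: "v div L < k" using L by (simp add: div_less_iff_less_mult)
    have "(g (v div L) div 2 ^ (v mod L)) mod 2 = (of_bool (\<alpha> v) :: nat)"
      using g(2)[of "v mod L" "v div L"] L by simp
    then have "odd (g (v div L) div 2 ^ (v mod L)) = b" using vb(2) by (cases b) (auto simp: odd_iff_mod_2_eq_one)
    then show ?thesis using j vb(1) unfolding block_sat_def by blast
  qed
  then show ?thesis using g(1) by blast
qed

text \<open>Any choice of block assignments glues to a total assignment, which falsifies some
  clause.\<close>

lemma unsatisfiable_block_sat:
  assumes "\<not> satisfiable F"
  shows "\<exists>u<length F. \<forall>j. \<not> block_sat L F j (g j) u"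
proof -
  define \<alpha> where "\<alpha> v = odd (g (v div L) div 2 ^ (v mod L))" for v
  have "\<not> (\<forall>C\<in>set F. \<exists>(v, b)\<in>set C. \<alpha> v = b)"
    using assms unfolding satisfiable_def by (rule contrapos_nn) (rule exI)
  then obtain C where C: "C \<in> set F" "\<not> (\<exists>(v, b)\<in>set C. \<alpha> v = b)" by blast
  then obtain u where u: "u < length F" "F ! u = C" by (metis in_set_conv_nth)
  have "\<not> block_sat L F j (g j) u" for j
  proof
    assume "block_sat L F j (g j) u"
    then obtain v b where "(v, b) \<in> set C" "v div L = j" "odd (g j div 2 ^ (v mod L)) = b"
      unfolding block_sat_def u(2) by blast
    then have "(v, b) \<in> set C" "\<alpha> v = b" unfolding \<alpha>_def by simp_all
    then show False using C(2) by blast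
  qed
  then show ?thesis using u(1) by blast
qed

section \<open>A calculus for evaluating expressions\<close>

text \<open>
  Variables 12 to 15 are reserved for these constructs. Since there is no conditional, \<open>let_e\<close> and
  \<open>cond_e\<close> are loops with one and at most one iteration; the body of \<open>cond_e\<close> is evaluated only if the
  condition holds, and the value is 0 otherwise.
\<close>
definition let_e :: "nat \<Rightarrow> expr \<Rightarrow> expr \<Rightarrow> expr" where
  "let_e x a b = Iter False 12 x (Num 1) a b"

text \<open>Truth values are 0 and 1. Everything rests on truncated subtraction:
  \<open>1 - a\<close> tests for 0, \<open>(a - b) + (b - a)\<close> vanishes iff
  \<open>a = b\<close>, and \<open>b - a\<close> is positive iff \<open>a < b\<close>.\<close>

definition not_e :: "expr \<Rightarrow> expr" where
  "not_e a = Bin Minus (Num 1) a"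

definition eq_e :: "expr \<Rightarrow> expr \<Rightarrow> expr" where
  "eq_e a b = not_e (Bin Plus (Bin Minus a b) (Bin Minus b a))"

definition less_e :: "expr \<Rightarrow> expr \<Rightarrow> expr" where
  "less_e a b = not_e (not_e (Bin Minus b a))"

definition or_e :: "expr \<Rightarrow> expr \<Rightarrow> expr" where
  "or_e a b = not_e (Bin Times (not_e a) (not_e b))"

definition mod_e :: "expr \<Rightarrow> expr \<Rightarrow> expr" where
  "mod_e a b = Bin Minus a (Bin Times (Bin Divide a b) b)"

definition cond_e :: "expr \<Rightarrow> expr \<Rightarrow> expr" where
  "cond_e c a = Iter False 12 13 c (Num 0) a"

text \<open>The loop counts witnesses; the double negation turns the count into a truth
  value.\<close>

definition ex_e :: "bool \<Rightarrow> nat \<Rightarrow> nat \<Rightarrow> expr \<Rightarrow> expr \<Rightarrow> expr" where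
  "ex_e w x y n b = not_e (not_e (Iter w x y n (Num 0) (Bin Plus (Var y) b)))"

definition pow_e :: "nat \<Rightarrow> expr \<Rightarrow> expr" where
  "pow_e z n = Iter False 14 15 n (Num 1) (Bin Times (Var 15) (Var z))"

locale bounded_eval =
  fixes inp :: "nat list" and M :: nat and W :: "bool \<Rightarrow> nat"
  assumes M_ge_1: "1 \<le> M" and W_ge_1: "1 \<le> W False"
begin

text \<open>Value and tameness are derived together, because bounding a result usually requires
  knowing it.\<close>

definition yields :: "(nat \<Rightarrow> nat) \<Rightarrow> expr \<Rightarrow> nat \<Rightarrow> bool" where
  "yields \<sigma> e v \<longleftrightarrow> tame inp M W e \<sigma> \<and> eval inp e \<sigma> = v"

lemma yields_le: "yields \<sigma> e v \<Longrightarrow> v \<le> M"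
  unfolding yields_def using tame_eval_le by blast

lemma yields_cong: "yields \<sigma> e v \<Longrightarrow> v = v' \<Longrightarrow> yields \<sigma> e v'"
  by simp

lemma yields_Var: "\<sigma> x \<le> M \<Longrightarrow> yields \<sigma> (Var x) (\<sigma> x)"
  by (simp add: yields_def)

lemma yields_Num: "c \<le> M \<Longrightarrow> yields \<sigma> (Num c) c"
  by (simp add: yields_def)

lemma yields_Plus:
  "yields \<sigma> a va \<Longrightarrow> yields \<sigma> b vb \<Longrightarrow> va + vb \<le> M \<Longrightarrow> yields \<sigma> (Bin Plus a b) (va + vb)"
  by (simp add: yields_def)

lemma yields_Times:
  "yields \<sigma> a va \<Longrightarrow> yields \<sigma> b vb \<Longrightarrow> va * vb \<le> M \<Longrightarrow> yields \<sigma> (Bin Times a b) (va * vb)"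
  by (simp add: yields_def)

lemma yields_Minus:
  assumes "yields \<sigma> a va" "yields \<sigma> b vb"
  shows "yields \<sigma> (Bin Minus a b) (va - vb)"
  using assms yields_le[OF assms(1)] by (simp add: yields_def)

lemma yields_Divide:
  assumes "yields \<sigma> a va" "yields \<sigma> b vb"
  shows "yields \<sigma> (Bin Divide a b) (va div vb)"
  using assms order_trans[OF div_le_dividend[of va vb] yields_le[OF assms(1)]] by (simp add: yields_def)

lemma yields_Inp:
  "yields \<sigma> a va \<Longrightarrow> input_at inp va \<le> M \<Longrightarrow> yields \<sigma> (Inp a) (input_at inp va)"
  by (simp add: yields_def)

text \<open>\<open>g\<close> acts as the loop invariant: it prescribes the accumulator after each
  round.\<close>

lemma yields_Iter:
  assumes n: "yields \<sigma> n N" and i: "yields \<sigma> i (g 0)" and W: "N \<le> W w"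
    and e: "\<And>j. j < N \<Longrightarrow> yields (\<sigma>(x := j, y := g j)) e (g (Suc j))"
  shows "yields \<sigma> (Iter w x y n i e) (g N)"
proof -
  have ev: "eval inp (Iter w x y (Num j) i e) \<sigma> = g j" if "j \<le> N" for j
    using that
  proof (induction j)
    case (Suc j)
    then have "eval inp (Iter w x y (Num j) i e) \<sigma> = g j" by simp
    then show ?case using e[of j] Suc by (simp add: yields_def del: fun_upd_apply)
  qed (use i in \<open>simp add: yields_def\<close>)
  have "tame inp M W e (\<sigma>(x := j, y := eval inp (Iter w x y (Num j) i e) \<sigma>))" if "j < N" for j
    using ev[of j] e[OF that] that unfolding yields_def by simp
  then show ?thesis
    using ev[of N] n i W unfolding yields_def by simp
qed

lemma yields_let:
  assumes "yields \<sigma> a va" "yields (\<sigma>(12 := 0, x := va)) b v"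
  shows "yields \<sigma> (let_e x a b) v"
  using yields_Iter[of \<sigma> "Num 1" 1 a "\<lambda>j. if j = 0 then va else v" False 12 x b] assms M_ge_1 W_ge_1
  by (auto simp: let_e_def yields_Num)

lemma yields_not:
  assumes "yields \<sigma> a (of_bool p)"
  shows "yields \<sigma> (not_e a) (of_bool (\<not> p))"
  unfolding not_e_def by (rule yields_cong[OF yields_Minus[OF yields_Num[OF M_ge_1] assms]]) simp

lemma yields_eq:
  assumes "yields \<sigma> a va" "yields \<sigma> b vb"
  shows "yields \<sigma> (eq_e a b) (of_bool (va = vb))"
proof -
  have "(va - vb) + (vb - va) \<le> M" using yields_le[OF assms(1)] yields_le[OF assms(2)] by simp
  then have "yields \<sigma> (eq_e a b) (1 - ((va - vb) + (vb - va)))"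
    unfolding eq_e_def not_e_def
    by (intro yields_Minus yields_Plus yields_Num assms M_ge_1)
  then show ?thesis by (rule yields_cong) auto
qed

lemma yields_less:
  assumes "yields \<sigma> a va" "yields \<sigma> b vb"
  shows "yields \<sigma> (less_e a b) (of_bool (va < vb))"
proof -
  have "yields \<sigma> (less_e a b) (1 - (1 - (vb - va)))"
    unfolding less_e_def not_e_def
    by (intro yields_Minus yields_Num assms M_ge_1)
  then show ?thesis by (rule yields_cong) auto
qed

lemma yields_and:
  assumes "yields \<sigma> a (of_bool p)" "yields \<sigma> b (of_bool p')"
  shows "yields \<sigma> (Bin Times a b) (of_bool (p \<and> p'))"
  by (rule yields_cong[OF yields_Times[OF assms]]) (use M_ge_1 in auto)

lemma yields_or:
  assumes "yields \<sigma> a (of_bool p)" "yields \<sigma> b (of_bool p')"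
  shows "yields \<sigma> (or_e a b) (of_bool (p \<or> p'))"
proof -
  have "yields \<sigma> (or_e a b) (of_bool (\<not> (\<not> p \<and> \<not> p')))"
    unfolding or_e_def by (intro yields_not yields_and assms)
  then show ?thesis by simp
qed

lemma yields_mod:
  assumes "yields \<sigma> a va" "yields \<sigma> b vb"
  shows "yields \<sigma> (mod_e a b) (va mod vb)"
proof -
  have "va div vb * vb \<le> M" using yields_le[OF assms(1)] div_times_less_eq_dividend[of va vb] by linarith
  then have "yields \<sigma> (mod_e a b) (va - va div vb * vb)"
    unfolding mod_e_def by (intro yields_Minus yields_Times yields_Divide assms)
  then show ?thesis by (simp add: minus_div_mult_eq_mod)
qed

lemma yields_cond:
  assumes "yields \<sigma> c (of_bool p)" "p \<Longrightarrow> yields (\<sigma>(12 := 0, 13 := 0)) a v"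
  shows "yields \<sigma> (cond_e c a) (if p then v else 0)"
  using yields_Iter[of \<sigma> c "of_bool p" "Num 0" "\<lambda>j. if j = 0 then 0 else v" False 12 13 a] assms M_ge_1 W_ge_1
  by (cases p) (auto simp: cond_e_def yields_Num)

lemma yields_ex:
  assumes n: "yields \<sigma> n N" and N: "N \<le> W w"
    and b: "\<And>j c. j < N \<Longrightarrow> c \<le> N \<Longrightarrow> yields (\<sigma>(x := j, y := c)) b (of_bool (p j))"
  shows "yields \<sigma> (ex_e w x y n b) (of_bool (\<exists>j<N. p j))"
proof -
  define g :: "nat \<Rightarrow> nat" where "g j = (\<Sum>i<j. of_bool (p i))" for j
  have g: "g j \<le> j" for j
    unfolding g_def by (rule order_trans[OF sum_bounded_above[where K = 1]]) auto
  have "yields \<sigma> (Iter w x y n (Num 0) (Bin Plus (Var y) b)) (g N)"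
  proof (rule yields_Iter[OF n _ N])
    fix j assume j: "j < N"
    have "g (Suc j) = g j + of_bool (p j)" by (simp add: g_def)
    moreover have "g (Suc j) \<le> M" using g[of "Suc j"] j yields_le[OF n] by simp
    ultimately show "yields (\<sigma>(x := j, y := g j)) (Bin Plus (Var y) b) (g (Suc j))"
      using yields_Plus[OF yields_Var b[OF j], of "g j" y] g[of j] j by simp
  qed (use M_ge_1 in \<open>simp add: g_def yields_Num\<close>)
  then have "yields \<sigma> (ex_e w x y n b) (1 - (1 - g N))"
    unfolding ex_e_def not_e_def by (intro yields_Minus yields_Num M_ge_1)
  moreover have "g N = 0 \<longleftrightarrow> \<not> (\<exists>j<N. p j)" by (auto simp: g_def)
  ultimately show ?thesis by (elim yields_cong) auto
qed

lemma yields_pow: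
  assumes n: "yields \<sigma> n N" and N: "N \<le> W False" and z: "z \<notin> {14, 15}" and z': "\<sigma> z \<le> M"
    and p: "\<And>j. j \<le> N \<Longrightarrow> \<sigma> z ^ j \<le> M"
  shows "yields \<sigma> (pow_e z n) (\<sigma> z ^ N)"
  unfolding pow_e_def
proof (rule yields_Iter[OF n _ N])
  fix j assume "j < N"
  then have "\<sigma> z ^ j * \<sigma> z \<le> M" "\<sigma> z ^ j \<le> M" using p[of "Suc j"] p[of j] by (simp_all add: mult.commute)
  then show "yields (\<sigma>(14 := j, 15 := \<sigma> z ^ j)) (Bin Times (Var 15) (Var z)) (\<sigma> z ^ Suc j)"
    using z z' yields_Times[OF yields_Var yields_Var, of "\<sigma>(14 := j, 15 := \<sigma> z ^ j)" 15 z] by (simp add: mult.commute)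
qed (use M_ge_1 in \<open>simp add: yields_Num\<close>)

lemmas yields_intros =
  yields_Var yields_Num yields_Plus yields_Minus yields_Divide yields_Inp
  yields_let yields_not yields_eq yields_less yields_or yields_mod yields_cond

end

section \<open>Integer roots\<close>

lemma downset_lessThan:
  fixes S :: "nat set"
  assumes "finite S" "\<And>i j. i \<in> S \<Longrightarrow> j \<le> i \<Longrightarrow> j \<in> S"
  shows "S = {..<card S}"
proof -
  define a where "a = (LEAST a. a \<notin> S)"
  have "\<exists>a. a \<notin> S" using assms(1) ex_new_if_finite infinite_UNIV_nat by blast
  then have a: "a \<notin> S" unfolding a_def by (rule LeastI_ex)
  have "i \<in> S \<longleftrightarrow> i < a" for i
    using a assms(2) not_less_Least[of i "\<lambda>a. a \<notin> S"] unfolding a_def by (meson not_le)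
  then have "S = {..<a}" by blast
  then show ?thesis by simp
qed

text \<open>Integer part of the \<open>e\<close>-th root of \<open>n\<close>, written as a count so
  that one loop evaluates it: the qualifying values \<open>i + 1\<close> form an initial
  segment.\<close>

definition nat_root :: "nat \<Rightarrow> nat \<Rightarrow> nat" where
  "nat_root e n = (\<Sum>i<n. of_bool ((i + 1) ^ e \<le> n))"

lemma nat_root:
  assumes "e \<ge> 1"
  shows "nat_root e n ^ e \<le> n" "n < (nat_root e n + 1) ^ e"
proof -
  let ?S = "{i. i < n \<and> (i + 1) ^ e \<le> n}"
  have "nat_root e n = card ?S"
    unfolding nat_root_def by (simp add: sum.If_cases of_bool_def Int_def lessThan_def flip: Collect_conj_eq)
  moreover have "?S = {..<card ?S}"
    by (rule downset_lessThan) (auto intro: order_trans[OF power_mono])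
  ultimately have S: "?S = {..<nat_root e n}" by simp
  let ?r = "nat_root e n"
  have "?r \<notin> ?S" using S by simp
  moreover have "?r + 1 \<le> (?r + 1) ^ e" using assms by (intro self_le_power) auto
  ultimately show "n < (?r + 1) ^ e" by auto
  show "?r ^ e \<le> n"
  proof (cases ?r)
    case (Suc r)
    then have "r \<in> ?S" using S by simp
    then show ?thesis using Suc by simp
  qed (use assms in \<open>simp add: power_0_left\<close>)
qed

section \<open>The programs of the reduction\<close>

definition root_e :: "nat \<Rightarrow> expr" where
  "root_e k = Iter False 20 21 (Var 2) (Num 0) (Bin Plus (Var 21)
     (let_e 22 (Bin Plus (Var 20) (Num 1)) (not_e (less_e (Var 2) (pow_e 22 (Num (4 * k)))))))"

text \<open>
  Variables 0 and 1 hold the set of outputs and the argument; 2 to 11, 16 and 17 are assigned by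
  \<open>pre_e\<close> as recorded in the predicate \<open>globals\<close> below; every other expression has local variables of
  its own from 20 on.
\<close>
definition pre_e :: "nat \<Rightarrow> nat \<Rightarrow> expr \<Rightarrow> expr" where
  "pre_e k K0 b =
     let_e 2 (Inp (Num 0)) (let_e 3 (Inp (Num 1)) (let_e 16 (Num 2)
     (let_e 4 (Bin Plus (Bin Divide (Var 2) (Num k)) (Num 1)) (let_e 5 (pow_e 16 (Var 4))
     (let_e 6 (Bin Times (Num K0) (Bin Plus (root_e k) (Num 1)))
     (let_e 7 (Bin Plus (Bin Times (Bin Times (Num 6) (Var 6)) (Var 6)) (Num 1))
     (let_e 8 (pow_e 7 (Num k)) (let_e 9 (pow_e 3 (Var 8))
     (let_e 10 (Bin Times (Num k) (Var 5))
     (let_e 11 (Bin Plus (Var 10) (Bin Times (Bin Times (Var 5) (Var 7)) (Var 9)))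
     (let_e 17 (Bin Plus (Var 11) (Num 1)) b)))))))))))"

text \<open>Clauses have different lengths, so the first loop finds the required clause by adding up
  length fields. A literal \<open>2 * v + b\<close> is decoded by division by 2.\<close>

definition sat_e :: expr where
  "sat_e = let_e 26 (Iter False 27 28 (Var 25) (Num 2)
       (Bin Plus (Bin Plus (Var 28) (Inp (Var 28))) (Num 1)))
     (ex_e False 27 28 (Inp (Var 26))
       (let_e 29 (Inp (Bin Plus (Bin Plus (Var 26) (Num 1)) (Var 27)))
         (Bin Times (eq_e (Bin Divide (Bin Divide (Var 29) (Num 2)) (Var 4)) (Var 23))
           (eq_e (mod_e (Bin Divide (Var 24) (pow_e 16 (mod_e (Bin Divide (Var 29) (Num 2)) (Var 4)))) (Num 2))
             (mod_e (Var 29) (Num 2))))))"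

definition covers_e :: expr where
  "covers_e = let_e 23 (Bin Divide (Var 30) (Var 5)) (let_e 24 (mod_e (Var 30) (Var 5))
     (let_e 32 (mod_e (Var 31) (Var 9))
     (let_e 33 (mod_e (Bin Divide (Bin Times (Bin Divide (Var 31) (Var 9)) (Var 24)) (Var 5)) (Var 7))
     (ex_e False 34 35 (Var 8)
       (Bin Times (eq_e (mod_e (Bin Divide (Var 34) (pow_e 7 (Var 23))) (Var 7)) (Var 33))
         (let_e 25 (mod_e (Bin Divide (Var 32) (pow_e 3 (Var 34))) (Var 3)) sat_e))))))"

text \<open>Both sides of each case distinction are guarded by \<open>cond_e\<close>, because
  \<open>covers_e\<close> is known to respect the bounds only for arguments in its range.\<close>

definition adj_e :: expr where
  "adj_e = or_e
     (cond_e (less_e (Var 36) (Var 10)) (or_e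
       (cond_e (less_e (Var 37) (Var 10)) (not_e (eq_e (Var 36) (Var 37))))
       (cond_e (not_e (less_e (Var 37) (Var 10)))
         (let_e 30 (Var 36) (let_e 31 (Bin Minus (Var 37) (Var 10)) covers_e)))))
     (cond_e (not_e (less_e (Var 36) (Var 10))) (cond_e (less_e (Var 37) (Var 10))
       (let_e 30 (Var 37) (let_e 31 (Bin Minus (Var 36) (Var 10)) covers_e))))"

definition input_e :: "nat \<Rightarrow> nat \<Rightarrow> expr" where
  "input_e k K0 = pre_e k K0 (Bin Plus (cond_e (eq_e (Var 1) (Num 0)) (Var 11))
     (cond_e (not_e (eq_e (Var 1) (Num 0)))
       (let_e 36 (Bin Divide (Bin Minus (Var 1) (Num 1)) (Var 11))
       (let_e 37 (mod_e (Bin Minus (Var 1) (Num 1)) (Var 11))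
         (cond_e (less_e (Var 36) (Var 11)) adj_e)))))"

definition insert_e :: "nat \<Rightarrow> nat \<Rightarrow> expr" where
  "insert_e k K0 = pre_e k K0 (let_e 38 (Bin Plus (mod_e (Var 1) (Var 11)) (Num 1))
     (Bin Plus
       (cond_e (Bin Times (less_e (Var 0) (pow_e 17 (Var 6)))
           (not_e (ex_e False 40 41 (Bin Plus (Var 6) (Num 1))
             (eq_e (mod_e (Bin Divide (Var 0) (pow_e 17 (Var 40))) (Var 17)) (Var 38)))))
         (Bin Plus (Bin Times (Var 0) (Var 11)) (Var 38)))
       (Var 0)))"

text \<open>Contains the only loop over all vertices, hence the only one flagged
  \<open>True\<close>.\<close>

definition accept_e :: "nat \<Rightarrow> nat \<Rightarrow> expr" where
  "accept_e k K0 = pre_e k K0 (Bin Times (less_e (Var 0) (pow_e 17 (Var 6)))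
     (not_e (ex_e True 42 43 (Var 11) (not_e
       (ex_e False 40 41 (Bin Plus (Var 6) (Num 1))
         (let_e 38 (mod_e (Bin Divide (Var 0) (pow_e 17 (Var 40))) (Var 17))
           (cond_e (not_e (eq_e (Var 38) (Num 0)))
             (or_e (eq_e (Var 38) (Bin Plus (Var 42) (Num 1)))
               (let_e 36 (Var 42) (let_e 37 (Bin Minus (Var 38) (Num 1)) adj_e))))))))))"

section \<open>Parameters of the reduction and bounds on intermediate values\<close>

locale reduction =
  fixes k K0 w n :: nat and F :: cnf
  assumes k_ge: "k \<ge> 2" and K0_ge: "K0 \<ge> 1" and F: "w_cnf w n F"
begin

definition L :: nat where "L = n div k + 1"
text \<open>Adding 1 before scaling gives \<open>n < h ^ (4 * k)\<close> and
  \<open>K0 \<le> h\<close>; the factor \<open>K0\<close> later absorbs \<open>k\<close> and the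
  clause density.\<close>

definition h :: nat where "h = K0 * (nat_root (4 * k) n + 1)"
definition q :: nat where "q = 6 * h * h + 1"
abbreviation D :: nat where "D \<equiv> 2 ^ L"

sublocale gadget k D q "length F" h "block_sat L F"
  by unfold_locales (use k_ge in \<open>auto simp: q_def\<close>)

lemma h_ge: "h \<ge> 1"
  unfolding h_def using K0_ge by simp

lemma clause_len: "u < length F \<Longrightarrow> length (F ! u) \<le> w"
  using F unfolding w_cnf_def by auto

lemma clause_pos_le: "u \<le> length F \<Longrightarrow> clause_pos F u \<le> 2 + u * (w + 1)"
proof (induction u)
  case (Suc u)
  then have "clause_pos F u \<le> 2 + u * (w + 1)" "length (F ! u) \<le> w" using clause_len by auto
  then show ?case using clause_pos_Suc[of u F] Suc.prems by simp
qed (simp add: clause_pos_def)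

text \<open>A bound on the intermediate values apart from the argument, as a sum so that every
  summand is trivially below it. It may be huge: only its number of digits enters the running
  time.\<close>

definition size_bound :: nat where
  "size_bound = V * V + D * q * D + n ^ (4 * k) + A + E + K0 + 4 * k + length F * (w + 1) + w + 10 + 2 * n +
     (V + 1) ^ (h + 1) + q * D * E"

definition loop_bound :: nat where
  "loop_bound = n + length F + w + 4 * k + A + h + 2"

end

text \<open>\<open>M\<close> stays a parameter because an expression may receive an argument above
  \<open>size_bound\<close>.\<close>

locale reduction_run = reduction +
  fixes M :: nat and W :: "bool \<Rightarrow> nat"
  assumes M: "size_bound \<le> M" and W: "loop_bound \<le> W False" "V \<le> W True"
begin

sublocale bounded_eval "cnf_input n F" M W
  by unfold_locales (use M W in \<open>auto simp: size_bound_def loop_bound_def\<close>)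

lemma V_ge_2: "V \<ge> 2"
proof -
  have "2 * 1 \<le> k * D" using k_ge by (intro mult_le_mono) auto
  then show ?thesis unfolding V_def by linarith
qed

lemma D_le_V: "D \<le> V"
proof -
  have "1 * D \<le> k * D" using k_ge by (intro mult_le_mono) auto
  then show ?thesis unfolding V_def by linarith
qed

lemma size_facts:
  "V * V \<le> M" "D * q * D \<le> M" "n ^ (4 * k) \<le> M" "A \<le> M" "E \<le> M" "K0 \<le> M" "4 * k \<le> M"
  "length F * (w + 1) + w + 10 \<le> M" "2 * n + 10 \<le> M" "(V + 1) ^ (h + 1) \<le> M" "q * D * E \<le> M"
  using M unfolding size_bound_def by linarith+

lemma small_facts:
  "V + 1 \<le> M" "V \<le> M" "D \<le> M" "D * q \<le> M" "q \<le> M" "h + 1 \<le> M" "L \<le> M" "n \<le> M" "length F \<le> M" "S \<le> M" "6 * h \<le> M" "6 * h * h \<le> M" "10 \<le> M"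
proof -
  have "2 * V \<le> V * V" using V_ge_2 by (intro mult_le_mono) auto
  then show v: "V + 1 \<le> M" "V \<le> M" using size_facts(1) V_ge_2 by linarith+
  then show "D \<le> M" using D_le_V by linarith
  have "D * q * 1 \<le> D * q * D" by (intro mult_le_mono) auto
  then show dq: "D * q \<le> M" using size_facts(2) by linarith
  have "1 \<le> q" by (simp add: q_def)
  have "1 * q \<le> D * q" by (intro mult_le_mono) auto
  then show q: "q \<le> M" using dq by linarith
  have "6 * h * 1 \<le> 6 * h * h" using h_ge by (intro mult_le_mono) auto
  then show "6 * h \<le> M" "6 * h * h \<le> M" "h + 1 \<le> M" using q h_ge unfolding q_def by linarith+
  have "n div k \<le> n" by simp
  then show "L \<le> M" "n \<le> M" "10 \<le> M"
    using size_facts(9) unfolding L_def by linarith+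
  have "length F * 1 \<le> length F * (w + 1)" by (intro mult_le_mono) auto
  then show "length F \<le> M" using size_facts(8) by linarith
  show "S \<le> M" using v unfolding V_def by linarith
qed

lemma loop_facts: "n \<le> W False" "length F \<le> W False" "w \<le> W False" "4 * k \<le> W False" "k \<le> W False"
   "A \<le> W False" "h + 1 \<le> W False" "h \<le> W False" "L \<le> W False"
proof -
  have "n div k \<le> n" by simp
  then show "n \<le> W False" "length F \<le> W False" "w \<le> W False" "4 * k \<le> W False" "k \<le> W False"
   "A \<le> W False" "h + 1 \<le> W False" "h \<le> W False" "L \<le> W False"
    using W(1) unfolding loop_bound_def L_def by linarith+
qed

lemma power_le_M:
  assumes "a ^ N \<le> M" "j \<le> N"
  shows "a ^ j \<le> M"
proof (cases "a = 0")
  case True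
  then show ?thesis using small_facts(13) by (cases j) auto
next
  case False
  then have "a ^ j \<le> a ^ N" using assms(2) by (intro power_increasing) auto
  then show ?thesis using assms(1) by linarith
qed

definition globals :: "(nat \<Rightarrow> nat) \<Rightarrow> bool" where
  "globals \<sigma> \<longleftrightarrow> \<sigma> 2 = n \<and> \<sigma> 3 = length F \<and> \<sigma> 16 = 2 \<and> \<sigma> 4 = L \<and> \<sigma> 5 = D \<and> \<sigma> 6 = h \<and> \<sigma> 7 = q \<and>
     \<sigma> 8 = A \<and> \<sigma> 9 = E \<and> \<sigma> 10 = S \<and> \<sigma> 11 = V \<and> \<sigma> 17 = V + 1"

section \<open>Values computed by the expressions of the reduction\<close>

lemma yields_root:
  assumes "\<sigma> 2 = n"
  shows "yields \<sigma> (root_e k) (nat_root (4 * k) n)"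
  unfolding root_e_def nat_root_def
proof (rule yields_Iter[where N = n and g = "\<lambda>j. \<Sum>i<j. of_bool ((i + 1) ^ (4 * k) \<le> n)"])
  show "yields \<sigma> (Var 2) n" using yields_Var[of \<sigma> 2] small_facts by (simp add: assms)
  show "yields \<sigma> (Num 0) (\<Sum>i<0. of_bool ((i + 1) ^ (4 * k) \<le> n))" using yields_Num[of 0 \<sigma>] by simp
  show "n \<le> W False" by (rule loop_facts)
next
  fix j assume j: "j < n"
  let ?g = "\<lambda>j. \<Sum>i<j. of_bool ((i + 1) ^ (4 * k) \<le> n) :: nat"
  have g: "?g j \<le> j" for j
    by (rule order_trans[OF sum_bounded_above[where K = 1]]) auto
  let ?\<sigma> = "\<sigma>(20 := j, 21 := ?g j)"
  have p: "(j + 1) ^ (4 * k) \<le> M"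
    using power_mono[of "j + 1" n "4 * k"] j size_facts(3) by linarith
  have "yields ?\<sigma> (let_e 22 (Bin Plus (Var 20) (Num 1)) (not_e (less_e (Var 2) (pow_e 22 (Num (4 * k))))))
     (of_bool (\<not> n < (j + 1) ^ (4 * k)))"
      by (rule yields_cong, (rule yields_intros yields_pow | (insert j small_facts(8) p size_facts(7) loop_facts(4) power_le_M[OF p]; simp add: assms assms; fail))+)
  from yields_Plus[OF yields_Var this, of 21]
  show "yields ?\<sigma> (Bin Plus (Var 21)
     (let_e 22 (Bin Plus (Var 20) (Num 1)) (not_e (less_e (Var 2) (pow_e 22 (Num (4 * k)))))))
     (?g (Suc j))"
    using g[of j] g[of "Suc j"] j small_facts by (simp add: not_less)
qed

lemma lit_bound:
  assumes "u < length F" "i < length (F ! u)" "F ! u ! i = (v, b)"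
  shows "v < n"
  using assms F nth_mem[of i "F ! u"] nth_mem[of u F] unfolding w_cnf_def by fastforce

lemma yields_sat:
  assumes g: "globals \<sigma>" and \<sigma>: "\<sigma> 23 = j" "\<sigma> 24 = x" "\<sigma> 25 = u" and u: "u < length F"
    and jx: "j \<le> M" "x \<le> M"
  shows "yields \<sigma> sat_e (of_bool (block_sat L F j x u))"
proof -
  note g' = g[unfolded globals_def]
  let ?p = "clause_pos F u"
  have pos_le: "clause_pos F i \<le> 2 + length F * (w + 1)" if "i \<le> length F" for i
    using clause_pos_le[OF that] mult_le_mono1[OF that, of "w + 1"] by linarith
  have pos: "yields \<sigma> (Iter False 27 28 (Var 25) (Num 2)
       (Bin Plus (Bin Plus (Var 28) (Inp (Var 28))) (Num 1))) ?p"
  proof (rule yields_Iter[where N = u])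
    show "yields \<sigma> (Var 25) u"
      using yields_Var[of \<sigma> 25] u small_facts(9) by (simp add: \<sigma>)
    show "yields \<sigma> (Num 2) (clause_pos F 0)"
      using yields_Num[of 2 \<sigma>] small_facts by (simp add: clause_pos_def)
    show "u \<le> W False" using u loop_facts(2) by linarith
  next
    fix i assume i: "i < u"
    then have iF: "i < length F" using u by simp
    let ?\<sigma> = "\<sigma>(27 := i, 28 := clause_pos F i)"
    have "length (F ! i) \<le> w" using clause_len iF by blast
    moreover have "clause_pos F i \<le> 2 + length F * (w + 1)" using pos_le[of i] iF by simp
    ultimately have le: "clause_pos F i + length (F ! i) + 1 \<le> M"
      using size_facts(8) by linarith
    show "yields ?\<sigma> (Bin Plus (Bin Plus (Var 28) (Inp (Var 28))) (Num 1)) (clause_pos F (Suc i))"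
      by (rule yields_cong, (rule yields_intros | (insert le; simp add: input_at_cnf(1)[OF iF] clause_pos_Suc[OF iF] input_at_cnf(1)[OF iF]; fail))+)
  qed
  define p where "p i \<longleftrightarrow> (case F ! u ! i of (v, b) \<Rightarrow>
      v div L = j \<and> (x div 2 ^ (v mod L)) mod 2 = (of_bool b :: nat))" for i
  let ?\<sigma>1 = "\<sigma>(12 := 0, 26 := ?p)"
  have p_le: "?p + w + 2 \<le> M" using pos_le[of u] u size_facts(8) by linarith
  have len: "length (F ! u) \<le> w" using clause_len u by blast
  have ex: "yields ?\<sigma>1 (ex_e False 27 28 (Inp (Var 26))
       (let_e 29 (Inp (Bin Plus (Bin Plus (Var 26) (Num 1)) (Var 27)))
         (Bin Times (eq_e (Bin Divide (Bin Divide (Var 29) (Num 2)) (Var 4)) (Var 23))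
           (eq_e (mod_e (Bin Divide (Var 24) (pow_e 16 (mod_e (Bin Divide (Var 29) (Num 2)) (Var 4)))) (Num 2))
             (mod_e (Var 29) (Num 2)))))) (of_bool (\<exists>i<length (F ! u). p i))"
  proof (rule yields_ex)
    show "yields ?\<sigma>1 (Inp (Var 26)) (length (F ! u))"
      by (rule yields_cong, (rule yields_intros | (insert p_le len; simp add: input_at_cnf(1)[OF u] input_at_cnf(1)[OF u]; fail))+)
    show "length (F ! u) \<le> W False" using len loop_facts(3) by linarith
  next
    fix i c assume i: "i < length (F ! u)" and c: "c \<le> length (F ! u)"
    obtain v b where vb: "F ! u ! i = (v, b)" by fastforce
    have v: "v < n" by (rule lit_bound[OF u i vb])
    let ?l = "2 * v + of_bool b :: nat"
    have l: "input_at (cnf_input n F) (?p + 1 + i) = ?l"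
      using input_at_cnf(2)[OF u i, of n] vb by simp
    have lM: "?l \<le> M" using v size_facts(9) by (cases b) auto
    let ?\<sigma>2 = "?\<sigma>1(27 := i, 28 := c)"
    let ?\<sigma>3 = "?\<sigma>2(12 := 0, 29 := ?l)"
    have l2: "?l div 2 = v" "?l mod 2 = of_bool b" by (cases b; simp)+
    have L0: "L > 0" by (simp add: L_def)
    have lit: "yields ?\<sigma>2 (Inp (Bin Plus (Bin Plus (Var 26) (Num 1)) (Var 27))) ?l"
      by (rule yields_cong, (rule yields_intros | (insert lM p_le len i; simp add: l[simplified] l[simplified]; fail))+)
    have a: "yields ?\<sigma>3 (eq_e (Bin Divide (Bin Divide (Var 29) (Num 2)) (Var 4)) (Var 23)) (of_bool (v div L = j))"
      by (rule yields_cong, (rule yields_intros | (insert lM jx small_facts(7,13); simp add: g' \<sigma> l2 g' \<sigma>; fail))+)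
    have "v mod L < L" using L0 by simp
    then have vL: "v mod L \<le> L" by linarith
    have pw: "yields ?\<sigma>3 (pow_e 16 (mod_e (Bin Divide (Var 29) (Num 2)) (Var 4))) (2 ^ (v mod L))"
    proof (rule yields_cong[OF yields_pow])
      have "yields ?\<sigma>3 (mod_e (Bin Divide (Var 29) (Num 2)) (Var 4)) (?\<sigma>3 29 div 2 mod ?\<sigma>3 4)"
        by (rule yields_intros | (insert lM small_facts(7,13); simp add: g'; fail))+
      then show "yields ?\<sigma>3 (mod_e (Bin Divide (Var 29) (Num 2)) (Var 4)) (v mod L)"
        by (simp add: l2 g')
      show "?\<sigma>3 16 \<le> M" "v mod L \<le> W False" using small_facts(13) vL loop_facts(9) by (auto simp: g')
      fix i assume "i \<le> v mod L"
      then have "i \<le> L" using vL by linarith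
      then show "?\<sigma>3 16 ^ i \<le> M" using power_le_M[OF small_facts(3)] by (simp add: g')
    qed (simp_all add: g')
    have b: "yields ?\<sigma>3 (eq_e (mod_e (Bin Divide (Var 24) (pow_e 16 (mod_e (Bin Divide (Var 29) (Num 2)) (Var 4)))) (Num 2))
             (mod_e (Var 29) (Num 2))) (of_bool (?\<sigma>3 24 div 2 ^ (v mod L) mod 2 = ?\<sigma>3 29 mod 2))"
      by (rule yields_intros pw | (insert lM small_facts(13) jx; simp add: \<sigma>; fail))+
    have b': "yields ?\<sigma>3 (eq_e (mod_e (Bin Divide (Var 24) (pow_e 16 (mod_e (Bin Divide (Var 29) (Num 2)) (Var 4)))) (Num 2))
             (mod_e (Var 29) (Num 2))) (of_bool (x div 2 ^ (v mod L) mod 2 = (of_bool b :: nat)))"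
      using b by (simp add: l2 \<sigma>)
    have "p i \<longleftrightarrow> v div L = j \<and> x div 2 ^ (v mod L) mod 2 = (of_bool b :: nat)"
      by (simp add: p_def vb)
    then show "yields ?\<sigma>2 (let_e 29 (Inp (Bin Plus (Bin Plus (Var 26) (Num 1)) (Var 27)))
         (Bin Times (eq_e (Bin Divide (Bin Divide (Var 29) (Num 2)) (Var 4)) (Var 23))
           (eq_e (mod_e (Bin Divide (Var 24) (pow_e 16 (mod_e (Bin Divide (Var 29) (Num 2)) (Var 4)))) (Num 2))
             (mod_e (Var 29) (Num 2))))) (of_bool (p i))"
      using yields_let[OF lit yields_and[OF a b']] by simp
  qed
  have "(\<exists>i<length (F ! u). p i) \<longleftrightarrow> (\<exists>(v, b)\<in>set (F ! u). v div L = j \<and> (x div 2 ^ (v mod L)) mod 2 = (of_bool b :: nat))"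
  proof -
    have "(\<exists>i<length C. Q (C ! i)) \<longleftrightarrow> (\<exists>z\<in>set C. Q z)" for C :: clause and Q
      by (metis in_set_conv_nth)
    then show ?thesis unfolding p_def .
  qed
  also have "\<dots> \<longleftrightarrow> block_sat L F j x u"
    unfolding block_sat_def by (intro bex_cong refl) (auto simp: odd_iff_mod_2_eq_one of_bool_def)
  finally show ?thesis
    using yields_let[OF pos ex] unfolding sat_e_def by simp
qed

lemma pow_le_M:
  "j \<le> L \<Longrightarrow> 2 ^ j \<le> M" "j \<le> k \<Longrightarrow> q ^ j \<le> M" "j \<le> A \<Longrightarrow> length F ^ j \<le> M"
  "j \<le> h + 1 \<Longrightarrow> (V + 1) ^ j \<le> M"
  using power_le_M[OF small_facts(3)] power_le_M[OF size_facts(4)] power_le_M[OF size_facts(5)]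
    power_le_M[OF size_facts(10)] by blast+

lemma yields_covers:
  assumes g: "globals \<sigma>" and \<sigma>: "\<sigma> 30 = s" "\<sigma> 31 = e" and s: "s < S" and e: "e < D * q * E"
  shows "yields \<sigma> covers_e (of_bool (covers s e))"
proof -
  note g' = g[unfolded globals_def]
  have sM: "s \<le> M" "s div D \<le> M" using s small_facts(10) div_le_dividend[of s D] by linarith+
  have sD: "s div D < k" using s by (simp add: div_less_iff_less_mult)
  have eV: "e < V" using e unfolding V_def by linarith
  then have eM: "e \<le> M" "e mod E \<le> M" using small_facts(2) mod_less_eq_dividend[of e E] by linarith+
  have E0: "E > 0" using e by (metis gr0I mult_0_right not_less_zero)
  have m0: "length F > 0" using E0 q_pos by (metis gr0I power_eq_0_iff zero_less_power less_irrefl)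
  have i: "e div E < D * q" using e E0 by (simp add: div_less_iff_less_mult)
  have x: "s mod D < D" by simp
  have xM: "s mod D \<le> M" using x small_facts(3) by linarith
  \<comment> \<open>The hash multiplies before it divides by \<open>D\<close>; this product accounts
    for the summand \<open>D * q * D\<close> of \<open>size_bound\<close>.\<close>
  have "(e div E) * (s mod D) \<le> D * q * D" using i x by (intro mult_le_mono) auto
  then have hM: "(e div E) * (s mod D) \<le> M" using size_facts(2) by linarith
  define H where "H = hash D q (e div E) (s mod D)"
  have H: "e div E * (s mod D) div D mod q = H" by (simp add: H_def hash_def)
  have HM: "H \<le> M" unfolding H_def hash_def using q_pos small_facts(5) mod_less_divisor[of q] by (meson less_imp_le order_trans)
  let ?\<sigma>3 = "\<sigma>(12 := 0, 23 := s div D, 12 := 0, 24 := s mod D, 12 := 0, 32 := e mod E)"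
  let ?\<sigma>4 = "?\<sigma>3(12 := 0, 33 := H)"
  define p where "p a \<longleftrightarrow> (a div q ^ (s div D)) mod q = H \<and>
     block_sat L F (s div D) (s mod D) ((e mod E div length F ^ a) mod length F)" for a
  have ex: "yields ?\<sigma>4 (ex_e False 34 35 (Var 8)
       (Bin Times (eq_e (mod_e (Bin Divide (Var 34) (pow_e 7 (Var 23))) (Var 7)) (Var 33))
         (let_e 25 (mod_e (Bin Divide (Var 32) (pow_e 3 (Var 34))) (Var 3)) sat_e))) (of_bool (\<exists>a<A. p a))"
  proof (rule yields_ex)
    show "yields ?\<sigma>4 (Var 8) A"
      by (rule yields_cong, (rule yields_intros | (insert size_facts(4); simp add: g'; fail))+)
    show "A \<le> W False" by (rule loop_facts)
  next
    fix a c assume a: "a < A" and c: "c \<le> A"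
    let ?\<sigma>5 = "?\<sigma>4(34 := a, 35 := c)"
    have aM: "a \<le> M" using a size_facts(4) by linarith
    have 1: "yields ?\<sigma>5 (eq_e (mod_e (Bin Divide (Var 34) (pow_e 7 (Var 23))) (Var 7)) (Var 33))
       (of_bool ((a div q ^ (s div D)) mod q = H))"
      by (rule yields_cong, (rule yields_intros yields_pow |
        (insert aM HM sD sM loop_facts(5) small_facts(5); simp add: g' pow_le_M; fail))+)
    have 2: "yields ?\<sigma>5 (mod_e (Bin Divide (Var 32) (pow_e 3 (Var 34))) (Var 3))
        ((e mod E div length F ^ a) mod length F)"
      by (rule yields_cong, (rule yields_intros yields_pow |
        (insert a aM eM loop_facts(6) small_facts(9); simp add: g' pow_le_M; fail))+)
    have 3: "yields (?\<sigma>5(12 := 0, 25 := (e mod E div length F ^ a) mod length F)) sat_e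
       (of_bool (block_sat L F (s div D) (s mod D) ((e mod E div length F ^ a) mod length F)))"
      by (rule yields_sat) (use sM xM m0 in \<open>simp_all add: globals_def g'\<close>)
    show "yields ?\<sigma>5 (Bin Times (eq_e (mod_e (Bin Divide (Var 34) (pow_e 7 (Var 23))) (Var 7)) (Var 33))
         (let_e 25 (mod_e (Bin Divide (Var 32) (pow_e 3 (Var 34))) (Var 3)) sat_e)) (of_bool (p a))"
      unfolding p_def by (rule yields_and[OF 1 yields_let[OF 2 3]])
  qed
  have "yields \<sigma> covers_e (of_bool (\<exists>a<A. p a))"
    unfolding covers_e_def
  proof (intro yields_let)
    show "yields ?\<sigma>4 (ex_e False 34 35 (Var 8)
       (Bin Times (eq_e (mod_e (Bin Divide (Var 34) (pow_e 7 (Var 23))) (Var 7)) (Var 33))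
         (let_e 25 (mod_e (Bin Divide (Var 32) (pow_e 3 (Var 34))) (Var 3)) sat_e))) (of_bool (\<exists>a<A. p a))"
      by (rule ex)
    show "yields \<sigma> (Bin Divide (Var 30) (Var 5)) (s div D)"
      by (rule yields_cong, (rule yields_intros | (insert sM small_facts(3); simp add: g' \<sigma>; fail))+)
    show "yields (\<sigma>(12 := 0, 23 := s div D)) (mod_e (Var 30) (Var 5)) (s mod D)"
      by (rule yields_cong, (rule yields_intros | (insert sM small_facts(3); simp add: g' \<sigma>; fail))+)
    show "yields (\<sigma>(12 := 0, 23 := s div D, 12 := 0, 24 := s mod D)) (mod_e (Var 31) (Var 9)) (e mod E)"
      by (rule yields_cong, (rule yields_intros | (insert eM size_facts(5); simp add: g' \<sigma>; fail))+)
    have "yields ?\<sigma>3 (Bin Times (Bin Divide (Var 31) (Var 9)) (Var 24)) ((e div E) * (s mod D))"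
      by (rule yields_cong, rule yields_Times, (rule yields_intros |
         (insert eM sM xM hM size_facts(5); simp add: g' \<sigma>; fail))+)
    then show "yields ?\<sigma>3 (mod_e (Bin Divide (Bin Times (Bin Divide (Var 31) (Var 9)) (Var 24)) (Var 5)) (Var 7)) H"
      by - (rule yields_cong, ((assumption | rule yields_intros) |
         (insert small_facts(3,5); simp add: g' \<sigma> H; fail))+)
  qed
  then show ?thesis unfolding covers_def p_def H_def by simp
qed

lemma yields_covers_Var:
  "globals \<sigma> \<Longrightarrow> \<sigma> 30 < S \<Longrightarrow> \<sigma> 31 < D * q * E \<Longrightarrow> yields \<sigma> covers_e (of_bool (covers (\<sigma> 30) (\<sigma> 31)))"
  by (rule yields_covers) simp_all

lemma yields_cond_bool:
  assumes "yields \<sigma> c (of_bool p)" "p \<Longrightarrow> yields (\<sigma>(12 := 0, 13 := 0)) a (of_bool r)"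
  shows "yields \<sigma> (cond_e c a) (of_bool (p \<and> r))"
  by (rule yields_cong[OF yields_cond[OF assms]]) simp_all

lemma yields_adj:
  assumes g: "globals \<sigma>" and uv: "\<sigma> 36 < V" "\<sigma> 37 < V"
  shows "yields \<sigma> adj_e (of_bool (adj (\<sigma> 36) (\<sigma> 37)))"
proof -
  note g' = g[unfolded globals_def]
  have M: "\<sigma> 36 \<le> M" "\<sigma> 37 \<le> M" using uv small_facts(2) by linarith+
  have d: "S \<le> \<sigma> 36 \<Longrightarrow> \<sigma> 36 - S < D * q * E" "S \<le> \<sigma> 37 \<Longrightarrow> \<sigma> 37 - S < D * q * E"
    using uv unfolding V_def by linarith+
  show ?thesis
    unfolding adj_e_def
    by (rule yields_cong, (rule yields_or yields_cond_bool yields_less yields_not yields_eq yields_let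
         yields_Var yields_Minus yields_covers_Var |
       (insert M d small_facts(10); simp add: g' globals_def adj_def; fail))+)
qed

lemma yields_pre:
  assumes b: "\<And>\<sigma>'. globals \<sigma>' \<Longrightarrow> \<sigma>' 0 = \<sigma> 0 \<Longrightarrow> \<sigma>' 1 = \<sigma> 1 \<Longrightarrow> yields \<sigma>' b v"
  shows "yields \<sigma> (pre_e k K0 b) v"
  unfolding pre_e_def
  apply (rule yields_let[where va = n])
  subgoal by (rule yields_cong, (rule yields_intros |
      (insert small_facts(8); simp add: input_at_cnf_header; fail))+)
  apply (rule yields_let[where va = "length F"])
  subgoal by (rule yields_cong, (rule yields_intros |
      (insert small_facts(9,13); simp add: input_at_cnf_header[simplified]; fail))+)
  apply (rule yields_let[where va = 2])
  subgoal by (rule yields_cong, (rule yields_intros | (insert small_facts(13); simp; fail))+)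
  apply (rule yields_let[where va = L])
  subgoal by (rule yields_cong, (rule yields_intros |
      (insert small_facts(7,8) size_facts(7); simp add: L_def; fail))+)
  apply (rule yields_let[where va = D])
  subgoal by (rule yields_cong, (rule yields_intros yields_pow |
      (insert small_facts(7,13) loop_facts(9); simp add: pow_le_M; fail))+)
  apply (rule yields_let[where va = h])
  subgoal
  proof -
    have "nat_root (4 * k) n + 1 \<le> h"
      using mult_le_mono1[of 1 K0 "nat_root (4 * k) n + 1"] K0_ge unfolding h_def by simp
    then have "nat_root (4 * k) n + 1 \<le> M" "K0 * (nat_root (4 * k) n + 1) \<le> M"
      using small_facts(6) unfolding h_def by linarith+
    then show ?thesis
      by - (rule yields_cong, (rule yields_Times yields_root yields_intros |
        (insert size_facts(6); simp add: h_def; fail))+)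
  qed
  apply (rule yields_let[where va = q])
  subgoal by (rule yields_cong, (rule yields_Times yields_intros |
      (insert small_facts(5,6,11,12,13); simp add: q_def; fail))+)
  apply (rule yields_let[where va = A])
  subgoal by (rule yields_cong, (rule yields_intros yields_pow |
      (insert small_facts(5) size_facts(7) loop_facts(5); simp add: pow_le_M; fail))+)
  apply (rule yields_let[where va = E])
  subgoal by (rule yields_cong, (rule yields_intros yields_pow |
      (insert small_facts(9) size_facts(4) loop_facts(6); simp add: pow_le_M; fail))+)
  apply (rule yields_let[where va = S])
  subgoal by (rule yields_cong, (rule yields_Times yields_intros |
      (insert small_facts(3,10) size_facts(7); simp; fail))+)
  apply (rule yields_let[where va = V])
  subgoal by (rule yields_cong, (rule yields_Times yields_intros |
      (insert small_facts(2,3,4,5,10) size_facts(5,11); simp add: V_def ac_simps; fail))+)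
  apply (rule yields_let[where va = "V + 1"])
  subgoal by (rule yields_cong, (rule yields_intros |
      (insert small_facts(1,2); simp; fail))+)
  by (rule b) (simp_all add: globals_def)

lemma yields_input:
  assumes i: "\<sigma> 1 = i" "i \<le> M"
  shows "yields \<sigma> (input_e k K0) (input_at (graph_input V G) i)"
  unfolding input_e_def
proof (rule yields_pre)
  fix \<tau> assume g: "globals \<tau>" and \<tau>: "\<tau> 0 = \<sigma> 0" "\<tau> 1 = \<sigma> 1"
  note g' = g[unfolded globals_def]
  have t: "\<tau> (Suc 0) = i" using i \<tau> by simp
  have V0: "V > 0" using V_ge_2 by simp
  have G': "(u, v) \<in> G \<longleftrightarrow> adj u v" if "u < V" "v < V" for u v
    using that by (simp add: G_def)
  have v: "input_at (graph_input V G) i =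
     (if i = 0 then V else 0) + (if i \<noteq> 0 then if (i - 1) div V < V then
       of_bool (adj ((i - 1) div V) ((i - 1) mod V)) else 0 else 0)"
    using V0 by (simp add: input_at_graph G')
  have d: "(i - 1) div V \<le> M"
    using i(2) div_le_dividend[of "i - 1" V] by linarith
  show "yields \<tau> (Bin Plus (cond_e (eq_e (Var 1) (Num 0)) (Var 11))
     (cond_e (not_e (eq_e (Var 1) (Num 0)))
       (let_e 36 (Bin Divide (Bin Minus (Var 1) (Num 1)) (Var 11))
       (let_e 37 (mod_e (Bin Minus (Var 1) (Num 1)) (Var 11))
         (cond_e (less_e (Var 36) (Var 11)) adj_e)))))
      (input_at (graph_input V G) i)"
    unfolding v
    by (rule yields_cong, (rule yields_intros yields_adj |
      (insert i(2) small_facts(2,13) V0 d; simp add: g' globals_def t; fail))+)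
qed

lemma yields_digit:
  assumes g: "globals \<sigma>" and X: "\<sigma> 0 \<le> M" and i: "\<sigma> 40 \<le> h + 1"
  shows "yields \<sigma> (mod_e (Bin Divide (Var 0) (pow_e 17 (Var 40))) (Var 17))
    ((\<sigma> 0 div (V + 1) ^ \<sigma> 40) mod (V + 1))"
proof -
  note g' = g[unfolded globals_def]
  show ?thesis
    by (rule yields_cong, (rule yields_intros yields_pow |
      (insert X i small_facts(1,6) loop_facts(7); simp add: g' pow_le_M[simplified]; fail))+)
qed

lemma yields_insert:
  assumes \<sigma>: "\<sigma> 0 = X" "\<sigma> 1 = y" and X: "X < (V + 1) ^ (h + 1)" and y: "y \<le> M"
  shows "yields \<sigma> (insert_e k K0) (insert_num V h X y)"
  unfolding insert_e_def
proof (rule yields_pre)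
  fix \<tau> assume g: "globals \<tau>" and \<tau>: "\<tau> 0 = \<sigma> 0" "\<tau> 1 = \<sigma> 1"
  note g' = g[unfolded globals_def]
  have t: "\<tau> 0 = X" "\<tau> (Suc 0) = y" using \<sigma> \<tau> by simp_all
  let ?d = "y mod V + 1"
  let ?\<tau> = "\<tau>(12 := 0, 38 := ?d)"
  have V0: "V > 0" using V_ge_2 by simp
  then have dV: "?d \<le> V" by (simp add: Suc_leI)
  have XM: "X \<le> M" using X size_facts(10) by linarith
  have d: "yields \<tau> (Bin Plus (mod_e (Var 1) (Var 11)) (Num 1)) ?d"
    by (rule yields_cong, (rule yields_intros |
      (insert y dV small_facts(2,13); simp add: g' t; fail))+)
  have "yields ?\<tau> (less_e (Var 0) (pow_e 17 (Var 6))) (of_bool (X < (V + 1) ^ h))"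
    by (rule yields_cong, (rule yields_intros yields_pow |
      (insert XM small_facts(1,6) loop_facts(8); simp add: g' t pow_le_M[simplified]; fail))+)
  moreover have "yields ?\<tau> (ex_e False 40 41 (Bin Plus (Var 6) (Num 1))
             (eq_e (mod_e (Bin Divide (Var 0) (pow_e 17 (Var 40))) (Var 17)) (Var 38)))
      (of_bool (\<exists>i<h + 1. (X div (V + 1) ^ i) mod (V + 1) = ?d))"
  proof (rule yields_ex)
    show "yields ?\<tau> (Bin Plus (Var 6) (Num 1)) (h + 1)"
      by (rule yields_cong, (rule yields_intros |
        (insert small_facts(6,13); simp add: g'; fail))+)
    show "h + 1 \<le> W False" by (rule loop_facts)
    fix i c assume i: "i < h + 1"
    have "yields (?\<tau>(40 := i, 41 := c)) (mod_e (Bin Divide (Var 0) (pow_e 17 (Var 40))) (Var 17))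
        ((X div (V + 1) ^ i) mod (V + 1))"
      using yields_digit[of "?\<tau>(40 := i, 41 := c)"] i XM by (simp add: globals_def g' t)
    moreover have "yields (?\<tau>(40 := i, 41 := c)) (Var 38) ?d"
      by (rule yields_cong, rule yields_Var) (use dV small_facts(2) in simp_all)
    ultimately show "yields (?\<tau>(40 := i, 41 := c)) (eq_e (mod_e (Bin Divide (Var 0) (pow_e 17 (Var 40))) (Var 17)) (Var 38))
        (of_bool ((X div (V + 1) ^ i) mod (V + 1) = ?d))"
      by (rule yields_eq)
  qed
  ultimately have c: "yields ?\<tau> (Bin Times (less_e (Var 0) (pow_e 17 (Var 6)))
           (not_e (ex_e False 40 41 (Bin Plus (Var 6) (Num 1))
             (eq_e (mod_e (Bin Divide (Var 0) (pow_e 17 (Var 40))) (Var 17)) (Var 38)))))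
       (of_bool (X < (V + 1) ^ h \<and> \<not> (\<exists>i<h + 1. (X div (V + 1) ^ i) mod (V + 1) = ?d)))"
    by (intro yields_and yields_not)
  have ins: "insert_num V h X y \<le> M"
    using insert_num_bound[OF X, of y] V0 size_facts(10) by linarith
  let ?c = "X < (V + 1) ^ h \<and> \<not> (\<exists>i<h + 1. (X div (V + 1) ^ i) mod (V + 1) = ?d)"
  have iv: "insert_num V h X y = (if ?c then X * V + ?d else 0) + X"
    unfolding insert_num_def by simp
  have br: "yields (?\<tau>(12 := 0, 13 := 0)) (Bin Plus (Bin Times (Var 0) (Var 11)) (Var 38)) (X * V + ?d)" if "?c"
  proof -
    have "X * V + ?d \<le> M" using ins that unfolding iv by simp
    then show ?thesis
      by - (rule yields_cong, (rule yields_Times yields_intros |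
        (insert XM dV small_facts(2); simp add: g' t; fail))+)
  qed
  have "yields ?\<tau> (Var 0) X"
    by (rule yields_cong, rule yields_Var) (use XM in \<open>simp_all add: t\<close>)
  from yields_Plus[OF yields_cond[OF c br] this]
  have "yields ?\<tau> (Bin Plus
       (cond_e (Bin Times (less_e (Var 0) (pow_e 17 (Var 6)))
           (not_e (ex_e False 40 41 (Bin Plus (Var 6) (Num 1))
             (eq_e (mod_e (Bin Divide (Var 0) (pow_e 17 (Var 40))) (Var 17)) (Var 38)))))
         (Bin Plus (Bin Times (Var 0) (Var 11)) (Var 38)))
       (Var 0)) (insert_num V h X y)"
    using ins unfolding iv by blast
  then show "yields \<tau> (let_e 38 (Bin Plus (mod_e (Var 1) (Var 11)) (Num 1))
     (Bin Plus
       (cond_e (Bin Times (less_e (Var 0) (pow_e 17 (Var 6)))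
           (not_e (ex_e False 40 41 (Bin Plus (Var 6) (Num 1))
             (eq_e (mod_e (Bin Divide (Var 0) (pow_e 17 (Var 40))) (Var 17)) (Var 38)))))
         (Bin Plus (Bin Times (Var 0) (Var 11)) (Var 38)))
       (Var 0))) (insert_num V h X y)"
    by (rule yields_let[OF d])
qed

lemma yields_accept:
  assumes \<sigma>: "\<sigma> 0 = X" and X: "X < (V + 1) ^ (h + 1)"
  shows "yields \<sigma> (accept_e k K0) (of_bool (accepts adj V h X))"
  unfolding accept_e_def
proof (rule yields_pre)
  fix \<tau> assume g: "globals \<tau>" and \<tau>: "\<tau> 0 = \<sigma> 0" "\<tau> 1 = \<sigma> 1"
  note g' = g[unfolded globals_def]
  have t: "\<tau> 0 = X" using \<sigma> \<tau> by simp
  have XM: "X \<le> M" using X size_facts(10) by linarith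
  let ?d = "\<lambda>i. (X div (V + 1) ^ i) mod (V + 1)"
  let ?ein = "ex_e False 40 41 (Bin Plus (Var 6) (Num 1))
         (let_e 38 (mod_e (Bin Divide (Var 0) (pow_e 17 (Var 40))) (Var 17))
           (cond_e (not_e (eq_e (Var 38) (Num 0)))
             (or_e (eq_e (Var 38) (Bin Plus (Var 42) (Num 1)))
               (let_e 36 (Var 42) (let_e 37 (Bin Minus (Var 38) (Num 1)) adj_e)))))"
  have inner: "yields \<rho> ?ein (of_bool (\<exists>i<h + 1. ?d i \<noteq> 0 \<and> (?d i = v + 1 \<or> adj v (?d i - 1))))"
    if r: "globals \<rho>" "\<rho> 0 = X" "\<rho> 42 = v" and v: "v < V" for \<rho> v
  proof (rule yields_ex)
    note r' = r(1)[unfolded globals_def] r(2,3)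
    show "yields \<rho> (Bin Plus (Var 6) (Num 1)) (h + 1)"
      by (rule yields_cong, (rule yields_intros |
        (insert small_facts(6,13); simp add: r'; fail))+)
    show "h + 1 \<le> W False" by (rule loop_facts)
    fix i c assume i: "i < h + 1"
    let ?\<rho> = "\<rho>(40 := i, 41 := c)"
    have dV: "?d i < V + 1" by (rule mod_less_divisor) simp
    then have dM: "?d i \<le> M" using small_facts(1) by linarith
    have dd: "yields ?\<rho> (mod_e (Bin Divide (Var 0) (pow_e 17 (Var 40))) (Var 17)) (?d i)"
      using yields_digit[of "?\<rho>"] i XM by (simp add: globals_def r')
    have dv: "?d i \<noteq> 0 \<Longrightarrow> ?d i - 1 < V" using dV by linarith
    \<comment> \<open>From here on \<open>D\<close> is the digit, hiding the number of partial
      assignments per block.\<close>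
    obtain D where D: "?d i = D" by blast
    show "yields ?\<rho> (let_e 38 (mod_e (Bin Divide (Var 0) (pow_e 17 (Var 40))) (Var 17))
           (cond_e (not_e (eq_e (Var 38) (Num 0)))
             (or_e (eq_e (Var 38) (Bin Plus (Var 42) (Num 1)))
               (let_e 36 (Var 42) (let_e 37 (Bin Minus (Var 38) (Num 1)) adj_e)))))
        (of_bool (?d i \<noteq> 0 \<and> (?d i = v + 1 \<or> adj v (?d i - 1))))"
      apply (rule yields_let[OF dd])
      unfolding D
      by (rule yields_cong, (rule yields_or yields_cond_bool yields_not yields_eq yields_let yields_Var
           yields_Num yields_Plus yields_Minus yields_adj |
          (insert v dM[unfolded D] dv[unfolded D] small_facts(1,13); simp add: r' globals_def; fail))+)
  qed
  let ?q = "\<lambda>v. \<exists>i<h + 1. ?d i \<noteq> 0 \<and> (?d i = v + 1 \<or> adj v (?d i - 1))"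
  have ex: "yields \<tau> (ex_e True 42 43 (Var 11) (not_e ?ein)) (of_bool (\<exists>v<V. \<not> ?q v))"
  proof (rule yields_ex)
    show "yields \<tau> (Var 11) V"
      by (rule yields_cong, rule yields_Var) (use small_facts(2) in \<open>simp_all add: g'\<close>)
    show "V \<le> W True" by (rule W)
    fix v c assume v: "v < V"
    show "yields (\<tau>(42 := v, 43 := c)) (not_e ?ein) (of_bool (\<not> ?q v))"
      by (rule yields_not, rule inner) (use v in \<open>simp_all add: globals_def g' t\<close>)
  qed
  have less: "yields \<tau> (less_e (Var 0) (pow_e 17 (Var 6))) (of_bool (X < (V + 1) ^ h))"
    by (rule yields_cong, (rule yields_intros yields_pow |
      (insert XM small_facts(1,6) loop_facts(8); simp add: g' t pow_le_M[simplified]; fail))+)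
  have eq: "accepts adj V h X \<longleftrightarrow> X < (V + 1) ^ h \<and> \<not> (\<exists>v<V. \<not> ?q v)"
    unfolding accepts_def by blast
  show "yields \<tau> (Bin Times (less_e (Var 0) (pow_e 17 (Var 6)))
     (not_e (ex_e True 42 43 (Var 11) (not_e ?ein)))) (of_bool (accepts adj V h X))"
    unfolding eq by (intro yields_and yields_not less ex)
qed

end

section \<open>Running time of the reduction\<close>

fun big_depth :: "expr \<Rightarrow> nat" where
  "big_depth (Var x) = 0"
| "big_depth (Num c) = 0"
| "big_depth (Bin p a b) = max (big_depth a) (big_depth b)"
| "big_depth (Inp a) = big_depth a"
| "big_depth (Iter w x y n i e) = max (big_depth n) (max (big_depth i) (of_bool w + big_depth e))"

text \<open>The constants depend on the expression alone, so the bound is polynomial in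
  \<open>W False\<close>. The exponent of \<open>W True\<close> has to be exact: one factor
  \<open>V\<close> is affordable, but for \<open>k = 2\<close> a second one is not.\<close>

lemma step_bound_poly:
  "\<exists>c d. \<forall>W. step_bound W e \<le> c * (W False + 1) ^ d * (W True + 1) ^ big_depth e"
proof (induction e)
  case (Var x)
  then show ?case by (intro exI[of _ 2] exI[of _ 0]) simp
next
  case (Num c)
  then show ?case by (intro exI[of _ 1] exI[of _ 0]) simp
next
  case (Bin p a b)
  then obtain c d c' d' where
    a: "\<And>W. step_bound W a \<le> c * (W False + 1) ^ d * (W True + 1) ^ big_depth a" and
    b: "\<And>W. step_bound W b \<le> c' * (W False + 1) ^ d' * (W True + 1) ^ big_depth b" by blast
  show ?case
  proof (intro exI allI)
    fix W :: "bool \<Rightarrow> nat"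
    let ?D = "max d d'" and ?B = "max (big_depth a) (big_depth b)"
    let ?u = "(W False + 1) ^ ?D * (W True + 1) ^ ?B"
    have "c * ((W False + 1) ^ d * (W True + 1) ^ big_depth a) \<le> c * ?u"
      by (intro mult_le_mono power_increasing order_refl) auto
    then have 1: "step_bound W a \<le> c * ?u" using a[of W] by (simp only: mult.assoc)
    have "c' * ((W False + 1) ^ d' * (W True + 1) ^ big_depth b) \<le> c' * ?u"
      by (intro mult_le_mono power_increasing order_refl) auto
    then have 2: "step_bound W b \<le> c' * ?u" using b[of W] by (simp only: mult.assoc)
    have "1 * 1 \<le> ?u" by (intro mult_le_mono one_le_power) auto
    then have "step_bound W (Bin p a b) \<le> (c + c' + 1) * ?u"
      using 1 2 unfolding step_bound.simps distrib_right by linarith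
    then show "step_bound W (Bin p a b) \<le> (c + c' + 1) * (W False + 1) ^ ?D * (W True + 1) ^ big_depth (Bin p a b)"
      by (simp only: big_depth.simps mult.assoc)
  qed
next
  case (Inp a)
  then obtain c d where
    a: "\<And>W. step_bound W a \<le> c * (W False + 1) ^ d * (W True + 1) ^ big_depth a" by blast
  show ?case
  proof (intro exI allI)
    fix W :: "bool \<Rightarrow> nat"
    let ?u = "(W False + 1) ^ d * (W True + 1) ^ big_depth a"
    have "1 * 1 \<le> ?u" by (intro mult_le_mono one_le_power) auto
    moreover have "step_bound W a \<le> c * ?u" using a[of W] by (simp only: mult.assoc)
    ultimately have "step_bound W (Inp a) \<le> (c + 1) * ?u"
      unfolding step_bound.simps distrib_right by linarith
    then show "step_bound W (Inp a) \<le> (c + 1) * (W False + 1) ^ d * (W True + 1) ^ big_depth (Inp a)"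
      by (simp only: big_depth.simps mult.assoc)
  qed
next
  case (Iter w x y n i e)
  then obtain c1 d1 c2 d2 c3 d3 where
    n: "\<And>W. step_bound W n \<le> c1 * (W False + 1) ^ d1 * (W True + 1) ^ big_depth n" and
    i: "\<And>W. step_bound W i \<le> c2 * (W False + 1) ^ d2 * (W True + 1) ^ big_depth i" and
    e: "\<And>W. step_bound W e \<le> c3 * (W False + 1) ^ d3 * (W True + 1) ^ big_depth e" by blast
  show ?case
  proof (intro exI allI)
    fix W :: "bool \<Rightarrow> nat"
    let ?D = "max d1 (max d2 (d3 + 1))" and ?B = "big_depth (Iter w x y n i e)"
    let ?u = "(W False + 1) ^ ?D * (W True + 1) ^ ?B"
    have "c1 * ((W False + 1) ^ d1 * (W True + 1) ^ big_depth n) \<le> c1 * ?u"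
      by (intro mult_le_mono power_increasing order_refl) auto
    then have 1: "step_bound W n \<le> c1 * ?u" using n[of W] by (simp only: mult.assoc)
    have "c2 * ((W False + 1) ^ d2 * (W True + 1) ^ big_depth i) \<le> c2 * ?u"
      by (intro mult_le_mono power_increasing order_refl) auto
    then have 2: "step_bound W i \<le> c2 * ?u" using i[of W] by (simp only: mult.assoc)
    let ?v = "(W False + 1) ^ d3 * (W True + 1) ^ big_depth e"
    have "1 * 1 \<le> ?v" by (intro mult_le_mono one_le_power) auto
    then have "step_bound W e + 6 \<le> (c3 + 6) * ?v"
      using e[of W] unfolding distrib_right mult.assoc by linarith
    then have "W w * (step_bound W e + 6) \<le> (W w + 1) * ((c3 + 6) * ?v)" by (intro mult_le_mono) auto
    also have "\<dots> = (c3 + 6) * ((W w + 1) * ?v)" by (simp only: mult.left_commute)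
    also have "(W w + 1) * ?v \<le> ?u"
    proof (cases w)
      case True
      have "(W w + 1) * ?v = (W False + 1) ^ d3 * (W True + 1) ^ (1 + big_depth e)"
        using True by (simp add: algebra_simps)
      also have "\<dots> \<le> ?u"
        using True by (intro mult_le_mono power_increasing) auto
      finally show ?thesis .
    next
      case False
      have "(W w + 1) * ?v = (W False + 1) ^ (d3 + 1) * (W True + 1) ^ big_depth e"
        using False by (simp add: algebra_simps)
      also have "\<dots> \<le> ?u"
        using False by (intro mult_le_mono power_increasing) auto
      finally show ?thesis .
    qed
    finally have 3: "W w * (step_bound W e + 6) \<le> (c3 + 6) * ?u" by simp
    have "1 * 1 \<le> ?u" by (intro mult_le_mono one_le_power) auto
    then have "step_bound W (Iter w x y n i e) \<le> (c1 + c2 + 4 + (c3 + 6)) * ?u"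
      using 1 2 3 unfolding step_bound.simps distrib_right by linarith
    then show "step_bound W (Iter w x y n i e) \<le> (c1 + c2 + 4 + (c3 + 6)) * (W False + 1) ^ ?D * (W True + 1) ^ ?B"
      by (simp only: mult.assoc)
  qed
qed

lemmas macro_defs = let_e_def not_e_def eq_e_def less_e_def or_e_def mod_e_def cond_e_def ex_e_def
  pow_e_def root_e_def

lemma big_depth_adj: "big_depth adj_e = 0"
  unfolding adj_e_def covers_e_def sat_e_def macro_defs by simp

lemma big_depth_pre: "big_depth (pre_e k K0 b) = big_depth b"
  unfolding pre_e_def macro_defs by simp

lemma big_depth_programs:
  "big_depth (input_e k K0) = 0" "big_depth (insert_e k K0) = 0" "big_depth (accept_e k K0) = 1"
  unfolding input_e_def insert_e_def accept_e_def big_depth_pre macro_defs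
  by (simp_all add: big_depth_adj)

context reduction
begin

definition loops :: "bool \<Rightarrow> nat" where
  "loops b = (if b then V else loop_bound)"

theorem run:
  assumes P: "computes P (graph_input V G) t y"
  defines "K \<equiv> sim_offset (input_e k K0) (insert_e k K0)"
    and "Q \<equiv> sim_program (input_e k K0) (insert_e k K0) (accept_e k K0) P"
    and "\<Lambda> \<equiv> lcost size_bound"
  shows "\<exists>t'. t' \<le> lcost K + (4 + 2 * lcost K + \<Lambda> +
       2 * \<Lambda> * (step_bound loops (input_e k K0) + step_bound loops (insert_e k K0))) * t +
       (2 * step_bound loops (accept_e k K0) + 1) * \<Lambda> \<and>
     computes Q (cnf_input n F) t' [of_bool (accepts adj V h (foldl (insert_num V h) 0 y))]"
proof -
  \<comment> \<open>An argument \<open>v\<close> beyond \<open>size_bound\<close> raises the bound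
    to \<open>v\<close> itself. As both costs are at least 1, \<open>lcost\<close> of the maximum is
    at most \<open>\<Lambda> * lcost v\<close>.\<close>
  have run: "reduction_run k K0 w n F (max size_bound v) loops" for v
    by unfold_locales (auto simp: loops_def)
  have run0: "reduction_run k K0 w n F size_bound loops"
    by unfold_locales (auto simp: loops_def)
  have pos: "1 \<le> size_bound" by (simp add: size_bound_def)
  interpret sim: simulation "input_e k K0" "insert_e k K0" "accept_e k K0" P "cnf_input n F"
    "graph_input V G" "insert_num V h" "\<lambda>X. X < (V + 1) ^ (h + 1)" "\<lambda>v. max size_bound v" loops \<Lambda>
  proof unfold_locales
    fix X i assume X: "X < (V + 1) ^ (h + 1)"
    interpret reduction_run k K0 w n F "max size_bound i" loops by (rule run)
    have "yields (arg_state X i) (input_e k K0) (input_at (graph_input V G) i)"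
      by (rule yields_input) (simp_all add: arg_state_def)
    then show "tame (cnf_input n F) (max size_bound i) loops (input_e k K0) (arg_state X i)"
      "eval (cnf_input n F) (input_e k K0) (arg_state X i) = input_at (graph_input V G) i"
      by (simp_all add: yields_def)
    have "yields (arg_state X i) (insert_e k K0) (insert_num V h X i)"
      by (rule yields_insert[OF _ _ X]) (simp_all add: arg_state_def)
    then show "tame (cnf_input n F) (max size_bound i) loops (insert_e k K0) (arg_state X i)"
      "eval (cnf_input n F) (insert_e k K0) (arg_state X i) = insert_num V h X i"
      by (simp_all add: yields_def)
    show "insert_num V h X i < (V + 1) ^ (h + 1)"
      by (rule insert_num_bound[OF X V_pos])
  next
    show "0 < (V + 1) ^ (h + 1)" by simp
    fix v show "1 \<le> max size_bound v" using pos by simp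
    show "lcost (max size_bound v) \<le> \<Lambda> * lcost v"
      using lcost_pos[of v] lcost_pos[of size_bound] unfolding \<Lambda>_def by (auto simp: max_def)
  qed
  let ?X = "foldl (insert_num V h) 0 y"
  interpret rr: reduction_run k K0 w n F size_bound loops by (rule run0)
  have acc: "rr.yields (arg_state ?X v) (accept_e k K0) (of_bool (accepts adj V h ?X))" for v
    by (rule rr.yields_accept) (use sim.inv_foldl in \<open>simp_all add: arg_state_def\<close>)
  have "tame (cnf_input n F) size_bound loops (accept_e k K0) (arg_state ?X v)"
    "eval (cnf_input n F) (accept_e k K0) (arg_state ?X v) = of_bool (accepts adj V h ?X)" for v
    using acc[of v] by (simp_all add: rr.yields_def)
  from sim.sim_computes[OF P this pos, unfolded sim.slowdown_def]
  show ?thesis unfolding K_def Q_def \<Lambda>_def .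
qed

text \<open>If the formula is unsatisfiable, \<open>sound\<close> leaves no dominating set small
  enough to pass the test, whatever \<open>y\<close> is. If it is satisfiable,
  \<open>complete\<close> activates the guarantee of the algorithm.\<close>

theorem accepts_satisfiable:
  assumes y: "domination_number {..<V} G \<le> k \<Longrightarrow> dominating_set {..<V} G (set y) \<and> card (set y) \<le> h"
  shows "accepts adj V h (foldl (insert_num V h) 0 y) \<longleftrightarrow> satisfiable F"
proof
  assume "accepts adj V h (foldl (insert_num V h) 0 y)"
  then obtain X where X: "card X \<le> h" "dominating_set {..<V} G X"
    unfolding accepts_iff Let_def by blast
  show "satisfiable F"
  proof (rule ccontr)
    assume "\<not> satisfiable F"
    from sound[OF unsatisfiable_block_sat[OF this] X(2)] X(1) show False by simp
  qed
next
  assume sat: "satisfiable F"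
  have "n \<le> k * L"
    using k_ge dividend_less_times_div[of k n] unfolding L_def by (simp add: distrib_left)
  then obtain g where g: "\<forall>j. g j < D" "\<forall>u<length F. \<exists>j<k. block_sat L F j (g j) u"
    using satisfiable_block_sat[OF F sat, of k L] by (auto simp: L_def)
  have "domination_number {..<V} G \<le> k"
    by (rule complete[of g]) (use g in auto)
  note Y = y[OF this]
  have "(\<lambda>y. y mod V) ` set y = set y"
  proof -
    have "y' mod V = y'" if "y' \<in> set y" for y' using Y that unfolding dominating_set_def by auto
    then show ?thesis by (simp cong: image_cong_simp)
  qed
  then show "accepts adj V h (foldl (insert_num V h) 0 y)"
    unfolding accepts_iff Let_def using Y by simp
qed

text \<open>A common yardstick for the parameters that stay polynomial in \<open>n\<close>, in
  contrast to \<open>D\<close>, \<open>E\<close> and \<open>V\<close>.\<close>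

definition magnitude :: nat where
  "magnitude = n + length F + w + k + K0 + A + h + q + L + 10"

lemma lcost_power: "lcost (a ^ b) \<le> 2 + b * lcost a"
proof (induction b)
  case 0
  have "lcost 1 \<le> Suc 1" unfolding lcost_le_iff by simp
  then show ?case by simp
next
  case (Suc b)
  then show ?case using lcost_mult[of a "a ^ b"] by simp
qed

lemma lcost_le_Suc: "lcost a \<le> Suc a"
  unfolding lcost_le_iff by (rule less_exp)

text \<open>\<open>E = m ^ A\<close> has about \<open>A * log m\<close> digits, so the number of
  digits of \<open>V\<close> is at most quadratic in \<open>magnitude\<close>; the worst summand is
  \<open>(V + 1) ^ (h + 1)\<close>, whose exponent makes the bound cubic.\<close>

lemma lcost_size_bound: "lcost size_bound \<le> 10 * magnitude ^ 3"
proof -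
  define z where "z = magnitude"
  define m where "m = length F"
  have z: "n + m + w + k + K0 + A + h + q + L + 10 = z" by (simp add: z_def m_def magnitude_def)
  define zz zzz where "zz = z * z" and "zzz = z * zz"
  have z10: "10 \<le> z" using z by linarith
  have zz: "10 * z \<le> zz" unfolding zz_def using z10 by (intro mult_le_mono) auto
  have zzz: "10 * zz \<le> zzz" unfolding zzz_def using z10 by (intro mult_le_mono) auto
  have l2: "lcost 2 \<le> 3" using lcost_le_iff[of 2 2] by simp
  have D: "lcost D \<le> 2 + 3 * L"
    using lcost_power[of 2 L] mult_le_mono2[OF l2, of L] by linarith
  have Am: "A * (m + 1) \<le> zz" unfolding zz_def using z by (intro mult_le_mono) linarith+
  have E: "lcost E \<le> 2 + zz"
    using lcost_power[of "length F" A] mult_le_mono2[OF lcost_le_Suc, of A "length F"] Am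
    by (simp add: m_def)
  have q: "lcost q \<le> q + 1" using lcost_le_Suc[of q] by simp
  have "lcost S \<le> lcost k + lcost D" by (rule lcost_mult)
  then have S: "lcost S \<le> (k + 1) + (2 + 3 * L)" using D lcost_le_Suc[of k] by linarith
  have DqE: "lcost (D * q * E) \<le> (2 + 3 * L) + (q + 1) + (2 + zz)"
    using lcost_mult[of "D * q" E] lcost_mult[of D q] D E q by linarith
  have V: "lcost V \<le> 2 * zz"
    using lcost_add[of S "D * q * E"] S DqE z zz unfolding V_def by linarith
  have 1: "lcost (V * V) \<le> 4 * zz" using lcost_mult[of V V] V by linarith
  have 2: "lcost (D * q * D) \<le> zz"
    using lcost_mult[of "D * q" D] lcost_mult[of D q] D q z zz by linarith
  have kn: "k * (n + 1) \<le> zz" unfolding zz_def using z by (intro mult_le_mono) linarith+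
  have 3: "lcost (n ^ (4 * k)) \<le> 5 * zz"
    using lcost_power[of n "4 * k"] mult_le_mono2[OF lcost_le_Suc, of "4 * k" n] kn zz z10
    by simp
  have 4: "lcost A \<le> zz" "lcost K0 \<le> zz" "lcost (4 * k) \<le> zz" "lcost w \<le> zz" "lcost 10 \<le> 2 * zz" "lcost (2 * n) \<le> zz"
    using lcost_le_Suc[of A] lcost_le_Suc[of K0] lcost_le_Suc[of "4 * k"] lcost_le_Suc[of w]
      lcost_le_Suc[of 10] lcost_le_Suc[of "2 * n"] z zz by linarith+
  have "m * (w + 1) \<le> zz" unfolding zz_def using z by (intro mult_le_mono) linarith+
  then have 5: "lcost (length F * (w + 1)) \<le> 2 * zz"
    using lcost_le_Suc[of "m * (w + 1)"] zz z10 unfolding m_def by linarith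
  have "lcost (V + 1) \<le> 2 * zz + 2" using lcost_add[of V 1] lcost_le_Suc[of 1] V by linarith
  then have "(h + 1) * lcost (V + 1) \<le> z * (2 * zz + 2)" using z by (intro mult_le_mono) linarith+
  also have "\<dots> = 2 * zzz + 2 * z" by (simp add: zzz_def distrib_left)
  finally have 6: "lcost ((V + 1) ^ (h + 1)) \<le> 2 + 2 * zzz + 2 * z"
    using lcost_power[of "V + 1" "h + 1"] by linarith
  have 7: "lcost (q * D * E) \<le> 2 * zz"
    using lcost_mult[of "q * D" E] lcost_mult[of q D] D E q z zz by linarith
  have E': "lcost E \<le> 2 * zz" using E z10 zz by linarith
  have "lcost size_bound \<le> lcost (V * V) + lcost (D * q * D) + lcost (n ^ (4 * k)) + lcost A + lcost E +
      lcost K0 + lcost (4 * k) + lcost (length F * (w + 1)) + lcost w + lcost 10 + lcost (2 * n) +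
      lcost ((V + 1) ^ (h + 1)) + lcost (q * D * E)"
    unfolding size_bound_def by (intro order_trans[OF lcost_add] add_mono order_refl)
  also have "\<dots> \<le> 10 * zzz"
    using 1 2 3 4 5 6 7 E' zz zzz z10 by linarith
  also have "zzz = magnitude ^ 3" by (simp add: zzz_def zz_def z_def power3_eq_cube)
  finally show ?thesis .
qed

lemma loop_bound_le: "loop_bound + 1 \<le> 4 * magnitude"
  unfolding loop_bound_def magnitude_def by simp

end

lemma step_bound_programs:
  obtains c d where
    "\<And>W. step_bound W (input_e k K0) \<le> c * (W False + 1) ^ d"
    "\<And>W. step_bound W (insert_e k K0) \<le> c * (W False + 1) ^ d"
    "\<And>W. step_bound W (accept_e k K0) \<le> c * (W False + 1) ^ d * (W True + 1)"
proof -
  obtain c1 d1 where 1: "\<And>W. step_bound W (input_e k K0) \<le> c1 * (W False + 1) ^ d1"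
    using step_bound_poly[of "input_e k K0"] unfolding big_depth_programs by auto
  obtain c2 d2 where 2: "\<And>W. step_bound W (insert_e k K0) \<le> c2 * (W False + 1) ^ d2"
    using step_bound_poly[of "insert_e k K0"] unfolding big_depth_programs by auto
  obtain c3 d3 where 3: "\<And>W. step_bound W (accept_e k K0) \<le> c3 * (W False + 1) ^ d3 * (W True + 1)"
    using step_bound_poly[of "accept_e k K0"] unfolding big_depth_programs by auto
  let ?c = "max c1 (max c2 c3)" and ?d = "max d1 (max d2 d3)"
  have le: "c' * (x + 1) ^ d' \<le> ?c * (x + 1) ^ ?d" if "c' \<le> ?c" "d' \<le> ?d" for c' d' x :: nat
    using that by (intro mult_le_mono power_increasing) auto
  show ?thesis
  proof (rule that)
    fix W :: "bool \<Rightarrow> nat"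
    show "step_bound W (input_e k K0) \<le> ?c * (W False + 1) ^ ?d"
      by (rule order_trans[OF 1 le]) (simp_all add: le_max_iff_disj)
    show "step_bound W (insert_e k K0) \<le> ?c * (W False + 1) ^ ?d"
      by (rule order_trans[OF 2 le]) (simp_all add: le_max_iff_disj)
    have "c3 * (W False + 1) ^ d3 * (W True + 1) \<le> ?c * (W False + 1) ^ ?d * (W True + 1)"
      by (intro mult_le_mono1 le) (simp_all add: le_max_iff_disj)
    then show "step_bound W (accept_e k K0) \<le> ?c * (W False + 1) ^ ?d * (W True + 1)"
      using 3[of W] by linarith
  qed
qed

text \<open>The summand \<open>V\<close> pays for the final domination test; all other overhead is a
  constant times a power of \<open>magnitude\<close>.\<close>

theorem (in reduction) run_bound:
  assumes P: "computes P (graph_input V G) t y"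
    and s: "\<And>W. step_bound W (input_e k K0) \<le> c * (W False + 1) ^ d"
    "\<And>W. step_bound W (insert_e k K0) \<le> c * (W False + 1) ^ d"
    "\<And>W. step_bound W (accept_e k K0) \<le> c * (W False + 1) ^ d * (W True + 1)"
  defines "K \<equiv> sim_offset (input_e k K0) (insert_e k K0)"
    and "Q \<equiv> sim_program (input_e k K0) (insert_e k K0) (accept_e k K0) P"
  shows "\<exists>t'. t' \<le> (6 + 3 * lcost K + 6 * c) * (10 * 4 ^ d * magnitude ^ (d + 3)) * (t + V + 1) \<and>
     computes Q (cnf_input n F) t' [of_bool (accepts adj V h (foldl (insert_num V h) 0 y))]"
proof -
  define \<Lambda> where "\<Lambda> = lcost size_bound"
  define B where "B = (4 * magnitude) ^ d"
  define u where "u = 10 * magnitude ^ 3 * B"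
  have B1: "1 \<le> B" unfolding B_def magnitude_def by (intro one_le_power) simp
  have \<Lambda>: "\<Lambda> \<le> 10 * magnitude ^ 3" unfolding \<Lambda>_def by (rule lcost_size_bound)
  have \<Lambda>B: "\<Lambda> * B \<le> u" unfolding u_def using \<Lambda> by (intro mult_le_mono1)
  have "\<Lambda> * 1 \<le> \<Lambda> * B" using B1 by (intro mult_le_mono2)
  then have \<Lambda>u: "\<Lambda> \<le> u" using \<Lambda>B by linarith
  have u1: "1 \<le> u" using \<Lambda>u lcost_pos[of size_bound] unfolding \<Lambda>_def by linarith
  have lb: "(loops False + 1) ^ d \<le> B"
    unfolding B_def loops_def using loop_bound_le by (intro power_mono) simp_all
  define s1 s2 s3 where "s1 = step_bound loops (input_e k K0)" and "s2 = step_bound loops (insert_e k K0)"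
    and "s3 = step_bound loops (accept_e k K0)"
  have "c * (loops False + 1) ^ d \<le> c * B" using lb by (intro mult_le_mono2)
  then have s12: "s1 \<le> c * B" "s2 \<le> c * B" "c * (loops False + 1) ^ d \<le> c * B"
    using s(1)[of loops] s(2)[of loops] unfolding s1_def s2_def by linarith+
  have s3: "s3 \<le> c * B * (V + 1)"
    using s(3)[of loops] mult_le_mono1[OF s12(3), of "V + 1"] unfolding s3_def loops_def by simp
  obtain t' where t': "t' \<le> lcost K + (4 + 2 * lcost K + \<Lambda> + 2 * \<Lambda> * (s1 + s2)) * t + (2 * s3 + 1) * \<Lambda>"
    and Q: "computes Q (cnf_input n F) t' [of_bool (accepts adj V h (foldl (insert_num V h) 0 y))]"
    using run[OF P] unfolding \<Lambda>_def K_def Q_def s1_def s2_def s3_def by blast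
  define l where "l = lcost K"
  have "\<Lambda> * (s1 + s2) \<le> \<Lambda> * (2 * (c * B))" using s12 by (intro mult_le_mono2) linarith
  also have "\<dots> = 2 * c * (\<Lambda> * B)" by simp
  also have "\<dots> \<le> 2 * c * u" using \<Lambda>B by (intro mult_le_mono2)
  finally have a: "2 * \<Lambda> * (s1 + s2) \<le> 4 * c * u" by simp
  have "l * 1 \<le> l * u" using u1 by (intro mult_le_mono2)
  moreover have "(4 + 3 * l + 1 + 4 * c) * u = 4 * u + 3 * (l * u) + u + 4 * c * u" by (simp add: algebra_simps)
  ultimately have "4 + 2 * l + \<Lambda> + 2 * \<Lambda> * (s1 + s2) \<le> (4 + 3 * l + 1 + 4 * c) * u"
    using a \<Lambda>u u1 by linarith
  then have b: "(4 + 2 * l + \<Lambda> + 2 * \<Lambda> * (s1 + s2)) * t \<le> (4 + 3 * l + 1 + 4 * c) * u * t"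
    by (rule mult_le_mono1)
  have "s3 * \<Lambda> \<le> c * B * (V + 1) * \<Lambda>" using s3 by (rule mult_le_mono1)
  also have "\<dots> = c * (V + 1) * (\<Lambda> * B)" by (simp only: ac_simps)
  also have "\<dots> \<le> c * (V + 1) * u" using \<Lambda>B by (intro mult_le_mono2)
  finally have s3\<Lambda>: "s3 * \<Lambda> \<le> c * u * (V + 1)" by (simp only: ac_simps)
  have "1 * u \<le> (V + 1) * u" by (intro mult_le_mono1) simp
  then have "\<Lambda> \<le> u * (V + 1)" using \<Lambda>u mult.commute[of "V + 1" u] by linarith
  then have d: "(2 * s3 + 1) * \<Lambda> \<le> 2 * (c * u * (V + 1)) + u * (V + 1)"
    using s3\<Lambda> unfolding distrib_right mult.assoc mult_1 by linarith
  have "l * 1 \<le> l * (u * (V + 1))" using u1 by (intro mult_le_mono2) (simp add: Suc_leI)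
  then have "t' \<le> (4 + 3 * l + 1 + 4 * c) * u * t + (l + 2 * c + 1) * u * (V + 1)"
    using t' b d unfolding l_def[symmetric] by (simp add: algebra_simps)
  also have "\<dots> \<le> (6 + 3 * l + 6 * c) * u * t + (6 + 3 * l + 6 * c) * u * (V + 1)"
    by (rule add_mono; (rule mult_le_mono1)+; linarith)
  also have "\<dots> = (6 + 3 * l + 6 * c) * u * (t + V + 1)" by (simp only: distrib_left add.assoc)
  also have "u = 10 * 4 ^ d * magnitude ^ (d + 3)"
    by (simp add: u_def B_def power_mult_distrib power_add)
  finally show ?thesis using Q unfolding l_def by blast
qed

section \<open>Asymptotics\<close>

lemma nat_root_le: "e \<ge> 1 \<Longrightarrow> nat_root e n \<le> n"
  using nat_root(1)[of e n] self_le_power[of "nat_root e n" e] by (cases "nat_root e n") auto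

context reduction
begin

lemma q_le: "q \<le> 7 * h ^ 2"
proof -
  have "1 * 1 \<le> h * h" using h_ge by (intro mult_le_mono)
  then show ?thesis unfolding q_def power2_eq_square by simp
qed

lemma h_le: "h \<le> K0 * (n + 1)"
  unfolding h_def using nat_root_le[of "4 * k" n] k_ge by (intro mult_le_mono) auto

lemma q_le_n: "q \<le> 7 * K0 ^ 2 * (n + 1) ^ 2"
proof -
  have "7 * h ^ 2 \<le> 7 * (K0 * (n + 1)) ^ 2"
    using h_le by (intro mult_le_mono2 power_mono) auto
  then show ?thesis using q_le unfolding power_mult_distrib mult.assoc by linarith
qed

text \<open>The coarse estimate \<open>h \<le> K0 * (n + 1)\<close> is enough here; it makes
  \<open>q\<close> quadratic in \<open>n\<close> and \<open>A\<close> of degree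
  \<open>2 * k\<close>.\<close>

lemma magnitude_le:
  assumes "length F \<le> c * n"
  shows "magnitude \<le> (13 + c + w + k + 2 * K0 + (7 * K0 ^ 2) ^ k + 7 * K0 ^ 2) * (n + 1) ^ (2 * k)"
proof -
  define N where "N = (n + 1) ^ (2 * k)"
  have N: "n + 1 \<le> N" unfolding N_def using k_ge by (intro self_le_power) auto
  have N2: "(n + 1) ^ 2 \<le> N" unfolding N_def using k_ge by (intro power_increasing) auto
  have c: "x \<le> x * N" for x using N by simp
  have 1: "length F \<le> c * N" using assms mult_le_mono2[of n N c] N by linarith
  have 2: "h \<le> K0 * N" using h_le mult_le_mono2[OF N, of K0] by linarith
  have 3: "q \<le> 7 * K0 ^ 2 * N" using q_le_n mult_le_mono2[OF N2, of "7 * K0 ^ 2"] by linarith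
  have "A \<le> (7 * K0 ^ 2 * (n + 1) ^ 2) ^ k" using q_le_n by (intro power_mono) auto
  then have 4: "A \<le> (7 * K0 ^ 2) ^ k * N" by (simp add: N_def power_mult_distrib flip: power_mult)
  have "n div k \<le> n" by simp
  then have 5: "L \<le> N" using N unfolding L_def by linarith
  have "magnitude \<le> N + c * N + w * N + k * N + K0 * N + (7 * K0 ^ 2) ^ k * N + K0 * N + 7 * K0 ^ 2 * N + N + 10 * N"
    unfolding magnitude_def using 1 2 3 4 5 N c[of w] c[of k] c[of K0] c[of 10] by linarith
  also have "\<dots> \<le> (13 + c + w + k + 2 * K0 + (7 * K0 ^ 2) ^ k + 7 * K0 ^ 2) * N"
    by (simp add: algebra_simps)
  finally show ?thesis unfolding N_def .
qed

lemma V_le: "V \<le> 2 ^ L * (k + q) * (length F + 1) ^ A"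
proof -
  have "E \<le> (length F + 1) ^ A" by (intro power_mono) auto
  then have "D * q * E \<le> D * q * (length F + 1) ^ A" by (intro mult_le_mono2)
  moreover have "k * D * 1 \<le> k * D * (length F + 1) ^ A" by (intro mult_le_mono2 one_le_power) simp
  moreover have "D * (k + q) * (length F + 1) ^ A = k * D * (length F + 1) ^ A + D * q * (length F + 1) ^ A"
    by (simp only: distrib_left distrib_right mult.commute[of D k])
  ultimately show ?thesis unfolding V_def by linarith
qed

text \<open>Origin of the 16: with \<open>n \<le> h ^ (4 * k)\<close> and
  \<open>A \<le> (7 * h ^ 2) ^ k\<close> the logarithm of \<open>V\<close> is at most
  \<open>(9 + 7 ^ k * c) * h ^ (6 * k)\<close>, hence at most \<open>h ^ (8 * k)\<close>. Its
  \<open>16 * k\<close>-th root is at most \<open>sqrt h\<close>, and \<open>k ^ 2 \<le> h\<close>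
  bounds \<open>k\<close> by the other factor \<open>sqrt h\<close>. The terms in the bound on
  \<open>K0\<close> are what these estimates consume.\<close>

lemma gap:
  assumes c: "length F \<le> c * n" and K0: "k ^ 2 + k + 9 + 7 ^ k * c \<le> K0"
  shows "log 2 (real V) powr (1 / (16 * real k)) * real k \<le> real h"
proof -
  have K0h: "K0 * 1 \<le> h" unfolding h_def by (intro mult_le_mono2) simp
  then have h: "k ^ 2 \<le> h" "k + 1 \<le> h" "9 + 7 ^ k * c \<le> h" using K0 by linarith+
  have h1: "1 \<le> h" using h by linarith
  have pw: "h ^ i \<le> h ^ (6 * k)" if "i \<le> 6 * k" for i using h1 that by (intro power_increasing)
  have "nat_root (4 * k) n + 1 \<le> h"
    using mult_le_mono1[of 1 K0 "nat_root (4 * k) n + 1"] K0_ge unfolding h_def by simp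
  then have "(nat_root (4 * k) n + 1) ^ (4 * k) \<le> h ^ (4 * k)" by (intro power_mono) auto
  then have n: "n \<le> h ^ (4 * k)" using nat_root(2)[of "4 * k" n] k_ge by linarith
  have "A \<le> (7 * h ^ 2) ^ k" using q_le by (intro power_mono) auto
  then have "A * length F \<le> (7 * h ^ 2) ^ k * (c * h ^ (4 * k))"
    using c mult_le_mono2[OF n, of c] by (intro mult_le_mono) linarith+
  also have "\<dots> = 7 ^ k * c * (h ^ (2 * k) * h ^ (4 * k))"
    by (simp add: power_mult_distrib flip: power_mult)
  also have "h ^ (2 * k) * h ^ (4 * k) = h ^ (6 * k)" by (simp flip: power_add)
  finally have Am: "A * length F \<le> 7 ^ k * c * h ^ (6 * k)" by simp
  have "n div k \<le> n" by simp
  then have L: "L \<le> n + 1" unfolding L_def by linarith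
  have "h ^ 1 \<le> h ^ (6 * k)" "h ^ 2 \<le> h ^ (6 * k)" "h ^ (4 * k) \<le> h ^ (6 * k)"
    using k_ge by - (rule pw, simp)+
  then have "L + (k + q) + A * length F \<le> h ^ (6 * k) + h ^ (6 * k) + 7 * h ^ (6 * k) + 7 ^ k * c * h ^ (6 * k)"
    using L n q_le Am h(2) unfolding power_one_right by linarith
  also have "\<dots> = (9 + 7 ^ k * c) * h ^ (6 * k)" by (simp add: algebra_simps)
  also have "\<dots> \<le> h * h ^ (6 * k)" using h(3) by (rule mult_le_mono1)
  also have "\<dots> = h ^ (6 * k + 1)" by simp
  also have "\<dots> \<le> h ^ (8 * k)" using h1 k_ge by (intro power_increasing) auto
  finally have e: "L + (k + q) + A * length F \<le> h ^ (8 * k)" .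
  \<comment> \<open>Replacing \<open>log (m + 1)\<close> by \<open>m\<close> is wasteful, but costs
    only a larger power of \<open>h\<close>, which the gap tolerates.\<close>
  have "length F + 1 \<le> 2 ^ length F" using less_exp[of "length F"] by linarith
  then have "(length F + 1) ^ A \<le> 2 ^ (A * length F)"
    using power_mono[of "length F + 1" "2 ^ length F" A] by (simp add: mult.commute flip: power_mult)
  moreover have "k + q \<le> 2 ^ (k + q)" using less_exp[of "k + q"] by linarith
  ultimately have "2 ^ L * (k + q) * (length F + 1) ^ A \<le> 2 ^ L * 2 ^ (k + q) * 2 ^ (A * length F)"
    by (intro mult_le_mono) auto
  also have "\<dots> = 2 ^ (L + (k + q) + A * length F)" by (simp add: power_add)
  also have "\<dots> \<le> 2 ^ (h ^ (8 * k))" using e by (intro power_increasing) auto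
  finally have V: "V \<le> 2 ^ (h ^ (8 * k))" using V_le by linarith
  have V1: "V \<ge> 1" by (rule V_pos)
  have "real V \<le> 2 ^ (h ^ (8 * k))" using V by (metis of_nat_le_iff of_nat_numeral of_nat_power)
  then have "real V \<le> 2 powr real (h ^ (8 * k))" by (subst powr_realpow) auto
  then have "log 2 (real V) \<le> log 2 (2 powr real (h ^ (8 * k)))"
    using V1 by (subst log_le_cancel_iff) auto
  then have lV: "log 2 (real V) \<le> real h powr (8 * real k)"
  proof -
    have "real h powr real (8 * k) = real h ^ (8 * k)" using h1 by (intro powr_realpow) simp
    moreover have "log 2 (2 powr real (h ^ (8 * k))) = real h ^ (8 * k)" by simp
    ultimately show ?thesis using \<open>log 2 (real V) \<le> log 2 (2 powr real (h ^ (8 * k)))\<close> by simp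
  qed
  have "log 2 (real V) powr (1 / (16 * real k)) \<le> (real h powr (8 * real k)) powr (1 / (16 * real k))"
    using lV V1 by (intro powr_mono2) auto
  also have "\<dots> = sqrt (real h)"
    using k_ge h1 by (simp add: powr_powr powr_half_sqrt)
  finally have "log 2 (real V) powr (1 / (16 * real k)) * real k \<le> sqrt (real h) * real k"
    by (intro mult_right_mono) auto
  also have "real k \<le> sqrt (real h)"
    using h(1) by (intro real_le_rsqrt) (metis of_nat_le_iff of_nat_power)
  then have "sqrt (real h) * real k \<le> sqrt (real h) * sqrt (real h)" by (intro mult_left_mono) auto
  also have "\<dots> = real h" by simp
  finally show ?thesis .
qed

text \<open>The estimate that keeps \<open>E = m ^ A\<close> subexponential. It rests on the upper
  bound for \<open>nat_root\<close>, whereas \<open>gap\<close> rests on the lower one.\<close>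

lemma A_le: "real A \<le> (28 * real K0 ^ 2) ^ k * sqrt (real n + 1)"
proof -
  \<comment> \<open>The maximum with 1 gives \<open>nat_root (4 * k) n + 1 \<le> 2 * r\<close>, also
    for \<open>n = 0\<close>.\<close>
  define r where "r = max (nat_root (4 * k) n) 1"
  have r: "r ^ (4 * k) \<le> n + 1"
    using nat_root(1)[of "4 * k" n] k_ge unfolding r_def by (auto simp: max_def)
  have "h \<le> K0 * (2 * r)" unfolding h_def r_def by (intro mult_le_mono2) auto
  then have "7 * h ^ 2 \<le> 7 * (K0 * (2 * r)) ^ 2" by (intro mult_le_mono2 power_mono) auto
  then have "q \<le> 28 * K0 ^ 2 * r ^ 2" using q_le by (simp only: power_mult_distrib) simp
  then have "A \<le> (28 * K0 ^ 2 * r ^ 2) ^ k" by (intro power_mono) auto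
  also have "\<dots> = (28 * K0 ^ 2) ^ k * r ^ (2 * k)"
    by (simp add: power_mult_distrib flip: power_mult)
  finally have "real A \<le> real ((28 * K0 ^ 2) ^ k * r ^ (2 * k))" by (simp only: of_nat_le_iff)
  also have "\<dots> = (28 * real K0 ^ 2) ^ k * real r ^ (2 * k)" by simp
  also have "real r ^ (2 * k) \<le> sqrt (real n + 1)"
  proof (rule real_le_rsqrt)
    have "(real r ^ (2 * k))\<^sup>2 = real (r ^ (4 * k))" by (simp flip: power_mult)
    also have "\<dots> \<le> real (n + 1)" using r by (simp only: of_nat_le_iff)
    finally show "(real r ^ (2 * k))\<^sup>2 \<le> real n + 1" by simp
  qed
  finally show ?thesis by (simp add: mult_left_mono)
qed

lemma V_le_powr:
  assumes c: "length F \<le> c * n"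
  shows "real V \<le> 2 powr (real n / real k) * (2 * (real k + 7 * real K0 ^ 2 * (real n + 1) ^ 2) *
     (real c * real n + 1) powr ((28 * real K0 ^ 2) ^ k * sqrt (real n + 1)))"
proof -
  have "real V \<le> real (2 ^ L * (k + q) * (length F + 1) ^ A)" using V_le by (simp only: of_nat_le_iff)
  also have "\<dots> = 2 ^ L * (real k + real q) * (real (length F) + 1) ^ A"
    by (simp only: of_nat_mult of_nat_power of_nat_add of_nat_1 of_nat_numeral)
  also have "\<dots> \<le> (2 * 2 powr (real n / real k)) * (real k + 7 * real K0 ^ 2 * (real n + 1) ^ 2) *
      (real c * real n + 1) powr ((28 * real K0 ^ 2) ^ k * sqrt (real n + 1))"
  proof (intro mult_mono add_mono order_refl)
    have "(2::real) ^ L = 2 * 2 powr real (n div k)" by (simp add: L_def powr_realpow)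
    also have "\<dots> \<le> 2 * 2 powr (real n / real k)"
      by (intro mult_left_mono powr_mono) (auto simp: of_nat_div_le_of_nat)
    finally show "(2::real) ^ L \<le> 2 * 2 powr (real n / real k)" .
    have "real q \<le> real (7 * K0 ^ 2 * (n + 1) ^ 2)" using q_le_n by (simp only: of_nat_le_iff)
    then show "real q \<le> 7 * real K0 ^ 2 * (real n + 1) ^ 2" by (simp add: add.commute)
    have m: "real (length F) \<le> real c * real n" using c by (metis of_nat_le_iff of_nat_mult)
    have "(real (length F) + 1) ^ A \<le> (real c * real n + 1) ^ A"
      using m by (intro power_mono) auto
    also have "\<dots> = (real c * real n + 1) powr real A"
      by (subst powr_realpow) (auto simp: add_nonneg_pos)
    also have "\<dots> \<le> (real c * real n + 1) powr ((28 * real K0 ^ 2) ^ k * sqrt (real n + 1))"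
      using A_le by (intro powr_mono) auto
    finally show "(real (length F) + 1) ^ A \<le> (real c * real n + 1) powr ((28 * real K0 ^ 2) ^ k * sqrt (real n + 1))" .
  qed auto
  finally show ?thesis by (simp only: ac_simps)
qed

end

text \<open>The logarithm of the left-hand side is \<open>O(sqrt n * ln n)\<close>, hence eventually
  below any positive multiple of \<open>n\<close>.\<close>

lemma subexponential_bound:
  fixes a b c \<delta> C :: real and d k :: nat
  assumes pos: "a > 0" "b > 0" "c > 0" "\<delta> > 0" "k > 0"
  shows "(\<lambda>n. C * (real n + 1) ^ d *
     (2 * (real k + a * (real n + 1) ^ 2) * (c * real n + 1) powr (b * sqrt (real n + 1))) ^ k)
     \<in> O(\<lambda>n. 2 powr (\<delta> * real n))"
proof -
  define \<Phi> where "\<Phi> n = real d * ln (real n + 1) +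
     real k * (ln 2 + ln (real k + a * (real n + 1) ^ 2) + b * sqrt (real n + 1) * ln (c * real n + 1))" for n
  have 1: "(\<lambda>n. ln (real n + 1)) \<in> o(\<lambda>n. real n)" by real_asymp
  have 2: "(\<lambda>n. ln 2 + ln (real k + a * (real n + 1) ^ 2) + b * sqrt (real n + 1) * ln (c * real n + 1)) \<in> o(\<lambda>n. real n)"
    using pos by real_asymp
  have "\<Phi> \<in> o(\<lambda>n. real n)"
  proof -
    have "(\<lambda>n. c' * f n) \<in> o(\<lambda>n. real n)" if "f \<in> o(\<lambda>n. real n)" for c' :: real and f :: "nat \<Rightarrow> real"
      using that by (cases "c' = 0") auto
    then show ?thesis unfolding \<Phi>_def using 1 2 by (intro sum_in_smallo) blast+
  qed
  then have ev: "eventually (\<lambda>n. norm (\<Phi> n) \<le> (\<delta> * ln 2) * norm (real n)) at_top"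
    using pos by (intro landau_o.smallD) auto
  show ?thesis
  proof (rule bigoI[where c = "\<bar>C\<bar>"])
    show "eventually (\<lambda>n. norm (C * (real n + 1) ^ d *
     (2 * (real k + a * (real n + 1) ^ 2) * (c * real n + 1) powr (b * sqrt (real n + 1))) ^ k)
      \<le> \<bar>C\<bar> * norm (2 powr (\<delta> * real n))) at_top"
      using ev
    proof eventually_elim
      case (elim n)
      define X where "X = (real n + 1) ^ d *
        (2 * (real k + a * (real n + 1) ^ 2) * (c * real n + 1) powr (b * sqrt (real n + 1))) ^ k"
      have p: "real k + a * (real n + 1) ^ 2 > 0" using pos by (intro add_pos_pos) auto
      have p': "c * real n + 1 > 0" using pos by (intro add_nonneg_pos) auto
      have X0: "X > 0" unfolding X_def using p p' by (intro mult_pos_pos zero_less_power) auto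
      have "ln X = \<Phi> n"
      proof -
        define u v where "u = real k + a * (real n + 1) ^ 2" and "v = c * real n + 1"
        have "u > 0" "v > 0" using p p' unfolding u_def v_def by auto
        then show ?thesis
          unfolding X_def \<Phi>_def u_def[symmetric] v_def[symmetric] by (simp add: ln_mult ln_realpow ln_powr)
      qed
      also have "\<dots> \<le> \<delta> * ln 2 * real n" using elim by simp
      finally have "X \<le> exp (\<delta> * ln 2 * real n)" using X0 by (metis exp_le_cancel_iff exp_ln)
      also have "\<dots> = 2 powr (\<delta> * real n)" by (simp add: powr_def ac_simps)
      finally have "\<bar>C\<bar> * X \<le> \<bar>C\<bar> * 2 powr (\<delta> * real n)" by (intro mult_left_mono) auto
      then have "norm (C * X) \<le> \<bar>C\<bar> * norm (2 powr (\<delta> * real n))" using X0 by (simp add: abs_mult)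
      then show ?case by (simp only: X_def mult.assoc)
    qed
  qed
qed

text \<open>The running time is evaluated at every \<open>V\<close>, including small ones, so the
  asymptotic bound is made uniform: finitely many exceptions are absorbed by the sum of their
  values, as \<open>n powr b\<close> is at least 1.\<close>

lemma bigo_powr_bound:
  fixes T :: "nat \<Rightarrow> nat" and a b :: real
  assumes T: "(\<lambda>n. real (T n)) \<in> O(\<lambda>n. real n powr a)" and ab: "a \<le> b" "0 \<le> b"
  obtains C where "C \<ge> 0" "\<And>n. n \<ge> 1 \<Longrightarrow> real (T n) \<le> C * real n powr b"
proof -
  obtain c where c: "c > 0" "eventually (\<lambda>n. norm (real (T n)) \<le> c * norm (real n powr a)) at_top"
    using T by (elim landau_o.bigE)
  then obtain N where N: "\<And>n. n \<ge> N \<Longrightarrow> real (T n) \<le> c * real n powr a"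
    unfolding eventually_at_top_linorder by auto
  define s where "s = real (\<Sum>i<N. T i)"
  have s0: "0 \<le> s" unfolding s_def by (rule of_nat_0_le_iff)
  define C where "C = c + s"
  show ?thesis
  proof (rule that)
    show "C \<ge> 0" using c(1) s0 unfolding C_def by linarith
    fix n :: nat assume n: "n \<ge> 1"
    have one: "1 \<le> real n powr b" using n ab by (intro ge_one_powr_ge_zero) auto
    show "real (T n) \<le> C * real n powr b"
    proof (cases "n < N")
      case True
      then have "T n \<le> (\<Sum>i<N. T i)" by (intro member_le_sum) auto
      then have "real (T n) \<le> s" unfolding s_def by (simp only: of_nat_le_iff)
      moreover have "s \<le> C" using c(1) unfolding C_def by simp
      ultimately have "real (T n) \<le> C * 1" by simp
      also have "\<dots> \<le> C * real n powr b" using one \<open>C \<ge> 0\<close> by (intro mult_left_mono)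
      finally show ?thesis .
    next
      case False
      then have "real (T n) \<le> c * real n powr a" using N by simp
      also have "\<dots> \<le> C * real n powr b"
      proof (rule mult_mono)
        show "c \<le> C" using s0 unfolding C_def by linarith
        show "real n powr a \<le> real n powr b" using n ab by (intro powr_mono) auto
      qed (use \<open>C \<ge> 0\<close> in auto)
      finally show ?thesis .
    qed
  qed
qed

section \<open>From approximation to satisfiability\<close>

theorem approximation_decides_SAT:
  fixes k w :: nat and \<epsilon> c :: real
  assumes k: "k \<ge> 2" and \<epsilon>: "\<epsilon> > 0"
    and P: "approximates_DomSet_in_time P k (\<lambda>n. log 2 (real n) powr (1 / (16 * real k)))
      (\<lambda>n. real n powr (real k - \<epsilon>))"
  shows "SAT_in_time (min \<epsilon> 1 / (2 * real k)) (\<lambda>n F. w_cnf w n F \<and> real (length F) \<le> c * real n)"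
proof -
  \<comment> \<open>The cap at 1 keeps the exponent \<open>x = k - \<epsilon>1\<close> at least 1,
    so that the term \<open>V\<close> of the simulation is dominated by
    \<open>B powr x\<close>.\<close>
  define \<epsilon>1 where "\<epsilon>1 = min \<epsilon> 1"
  have \<epsilon>1: "0 < \<epsilon>1" "\<epsilon>1 \<le> 1" "\<epsilon>1 \<le> \<epsilon>" using \<epsilon> by (auto simp: \<epsilon>1_def)
  define c' where "c' = nat \<lceil>max c 1\<rceil>"
  have c': "c \<le> real c'" "1 \<le> c'" unfolding c'_def by linarith+
  \<comment> \<open>The value demanded by \<open>gap\<close>. It depends on \<open>k\<close> and the
    clause density only, so \<open>Q\<close> is a single program for all formulas.\<close>
  define K0 where "K0 = k ^ 2 + k + 9 + 7 ^ k * c'"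
  have "1 \<le> K0" unfolding K0_def by linarith
  then have K0: "1 \<le> K0" "0 < real K0" by simp_all
  obtain T where T: "(\<lambda>n. real (T n)) \<in> O(\<lambda>n. real n powr (real k - \<epsilon>))"
    and alg: "\<And>n E. n \<ge> 2 \<Longrightarrow> simple_graph n E \<Longrightarrow>
       \<exists>t y. t \<le> T n \<and> computes P (graph_input n E) t y \<and>
         (domination_number {..<n} E \<le> k \<longrightarrow> dominating_set {..<n} E (set y) \<and>
           real (card (set y)) \<le> log 2 (real n) powr (1 / (16 * real k)) * real k)"
    using P unfolding approximates_DomSet_in_time_def by blast
  define x where "x = real k - \<epsilon>1"
  have x: "1 \<le> x" "real k - \<epsilon> \<le> x" using k \<epsilon>1 unfolding x_def by linarith+
  obtain CT where CT: "CT \<ge> 0" "\<And>n. n \<ge> 1 \<Longrightarrow> real (T n) \<le> CT * real n powr x"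
    using bigo_powr_bound[OF T x(2)] x(1) by auto
  obtain cs ds where s:
    "\<And>W. step_bound W (input_e k K0) \<le> cs * (W False + 1) ^ ds"
    "\<And>W. step_bound W (insert_e k K0) \<le> cs * (W False + 1) ^ ds"
    "\<And>W. step_bound W (accept_e k K0) \<le> cs * (W False + 1) ^ ds * (W True + 1)"
    by (rule step_bound_programs[of k K0], rule that)
  define Q where "Q = sim_program (input_e k K0) (insert_e k K0) (accept_e k K0) P"
  define CQ where "CQ = (6 + 3 * lcost (sim_offset (input_e k K0) (insert_e k K0)) + 6 * cs) * (10 * 4 ^ ds)"
  define Cm where "Cm = 13 + c' + w + k + 2 * K0 + (7 * K0 ^ 2) ^ k + 7 * K0 ^ 2"
  define U where "U n = 2 * (real k + 7 * real K0 ^ 2 * (real n + 1) ^ 2) *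
     (real c' * real n + 1) powr ((28 * real K0 ^ 2) ^ k * sqrt (real n + 1))" for n
  define S where "S n = real CQ * real Cm ^ (ds + 3) * (CT + 2) * (real n + 1) ^ (2 * k * (ds + 3)) * U n ^ k" for n
  define H where "H n = S n * 2 powr (real n - \<epsilon>1 * real n / real k)" for n
  \<comment> \<open>Half of the saving \<open>\<epsilon>1 / k\<close> in the exponent pays for the
    subexponential factor \<open>S\<close>; the other half remains.\<close>
  have "S \<in> O(\<lambda>n. 2 powr (\<epsilon>1 / (2 * real k) * real n))"
    unfolding S_def U_def using k \<epsilon>1 K0 c' by (intro subexponential_bound) auto
  then have "H \<in> O(\<lambda>n. 2 powr (\<epsilon>1 / (2 * real k) * real n) * 2 powr (real n - \<epsilon>1 * real n / real k))"
    unfolding H_def by (rule landau_o.big.mult) simp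
  also have "(\<lambda>n. 2 powr (\<epsilon>1 / (2 * real k) * real n) * 2 powr (real n - \<epsilon>1 * real n / real k)) =
      (\<lambda>n. 2 powr ((1 - \<epsilon>1 / (2 * real k)) * real n))"
    using k by (auto simp: field_simps simp flip: powr_add)
  finally have H: "H \<in> O(\<lambda>n. 2 powr ((1 - \<epsilon>1 / (2 * real k)) * real n))" .
  have U1: "1 \<le> U n" for n
  proof -
    have "1 * 1 \<le> (2 * (real k + 7 * real K0 ^ 2 * (real n + 1) ^ 2)) *
       (real c' * real n + 1) powr ((28 * real K0 ^ 2) ^ k * sqrt (real n + 1))"
    proof (rule mult_mono)
      have "2 \<le> real k" using k by simp
      then have ge: "1 \<le> 2 * (real k + u)" if "0 \<le> u" for u using that by simp
      show "1 \<le> 2 * (real k + 7 * real K0 ^ 2 * (real n + 1) ^ 2)" by (rule ge) simp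
      show "1 \<le> (real c' * real n + 1) powr ((28 * real K0 ^ 2) ^ k * sqrt (real n + 1))"
        by (intro ge_one_powr_ge_zero) auto
    qed auto
    then show ?thesis unfolding U_def by simp
  qed
  have H0: "H n \<ge> 0" for n
    unfolding H_def S_def using CT(1) U1[of n] by (intro mult_nonneg_nonneg) auto
  have main: "\<exists>t'. real t' \<le> H n \<and> computes Q (cnf_input n F) t' [of_bool (satisfiable F)]"
    if inst: "w_cnf w n F" "real (length F) \<le> c * real n" for n F
  proof -
    interpret reduction k K0 w n F by unfold_locales (use k K0 inst in auto)
    have "real (length F) \<le> real c' * real n" using inst(2) c'(1) mult_right_mono[of c "real c'" "real n"] by linarith
    then have len: "length F \<le> c' * n" by (metis of_nat_le_iff of_nat_mult)
    have "2 * 1 \<le> k * D" using k_ge by (intro mult_le_mono) auto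
    then have V2: "V \<ge> 2" unfolding V_def by linarith
    obtain t y where t: "t \<le> T V" and y: "computes P (graph_input V G) t y"
      and dom: "domination_number {..<V} G \<le> k \<Longrightarrow> dominating_set {..<V} G (set y) \<and>
           real (card (set y)) \<le> log 2 (real V) powr (1 / (16 * real k)) * real k"
      using alg[OF V2 simple_graph_G] by blast
    have "domination_number {..<V} G \<le> k \<Longrightarrow> dominating_set {..<V} G (set y) \<and> card (set y) \<le> h"
      using dom gap[OF len] unfolding K0_def[symmetric] by force
    then have acc: "accepts adj V h (foldl (insert_num V h) 0 y) \<longleftrightarrow> satisfiable F"
      by (rule accepts_satisfiable)
    obtain t' where t': "t' \<le> CQ * magnitude ^ (ds + 3) * (t + V + 1)"
      and comp: "computes Q (cnf_input n F) t' [of_bool (satisfiable F)]"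
      using run_bound[OF y s] unfolding Q_def[symmetric] CQ_def acc mult.assoc by blast
    define B where "B = 2 powr (real n / real k) * U n"
    have VB: "real V \<le> B" unfolding B_def U_def using V_le_powr[OF len] .
    have V1: "1 \<le> real V" using V2 by simp
    have "V powr x \<le> B powr x" using VB V1 x by (intro powr_mono2) auto
    then have 1: "real (T V) \<le> CT * B powr x"
      using CT(2)[of V] V2 mult_left_mono[OF _ CT(1)] by fastforce
    have "B powr 1 \<le> B powr x" using VB V1 x by (intro powr_mono) auto
    then have 2: "B \<le> B powr x" using VB V1 by simp
    have "real (t + V + 1) \<le> (CT + 2) * B powr x"
      using t 1 2 VB V1 by (simp add: distrib_right)
    also have "B powr x = 2 powr (real n / real k * x) * U n powr x"
      unfolding B_def using U1[of n] by (simp add: powr_mult powr_powr)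
    also have "real n / real k * x = real n - \<epsilon>1 * real n / real k"
      unfolding x_def using k_ge by (simp add: field_simps)
    also have "U n powr x \<le> U n powr real k"
      using U1[of n] \<epsilon>1 by (intro powr_mono) (auto simp: x_def)
    also have "U n powr real k = U n ^ k" using U1[of n] by (intro powr_realpow) linarith
    finally have tV: "real (t + V + 1) \<le> (CT + 2) * (2 powr (real n - \<epsilon>1 * real n / real k) * U n ^ k)"
      using CT(1) by (simp add: mult_left_mono)
    have "real magnitude \<le> real (Cm * (n + 1) ^ (2 * k))"
      using magnitude_le[OF len] unfolding Cm_def by (simp only: of_nat_le_iff)
    then have "real magnitude ^ (ds + 3) \<le> (real Cm * (real n + 1) ^ (2 * k)) ^ (ds + 3)"
      by (intro power_mono) (simp_all add: add.commute)
    also have "\<dots> = real Cm ^ (ds + 3) * (real n + 1) ^ (2 * k * (ds + 3))"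
      by (simp only: power_mult_distrib power_mult)
    finally have mag: "real magnitude ^ (ds + 3) \<le> real Cm ^ (ds + 3) * (real n + 1) ^ (2 * k * (ds + 3))" .
    have "real t' \<le> real (CQ * magnitude ^ (ds + 3) * (t + V + 1))" using t' by (simp only: of_nat_le_iff)
    also have "\<dots> = real CQ * real magnitude ^ (ds + 3) * real (t + V + 1)"
      by (simp only: of_nat_mult of_nat_power)
    also have "\<dots> \<le> real CQ * (real Cm ^ (ds + 3) * (real n + 1) ^ (2 * k * (ds + 3))) *
        ((CT + 2) * (2 powr (real n - \<epsilon>1 * real n / real k) * U n ^ k))"
      by (intro mult_mono mag tV order_refl mult_nonneg_nonneg) auto
    also have "\<dots> = H n" unfolding H_def S_def by (simp only: ac_simps)
    finally show ?thesis using comp by blast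
  qed
  show ?thesis
    unfolding SAT_in_time_def
  proof (rule exI[of _ Q], rule exI[of _ "\<lambda>n. nat \<lfloor>H n\<rfloor>"], rule conjI; (intro allI impI)?)
    have "(\<lambda>n. real (nat \<lfloor>H n\<rfloor>)) \<in> O(H)"
      using H0 by (intro landau_o.big_mono always_eventually) auto
    then show "(\<lambda>n. real (nat \<lfloor>H n\<rfloor>)) \<in> O(\<lambda>n. 2 powr ((1 - min \<epsilon> 1 / (2 * real k)) * real n))"
      using H unfolding \<epsilon>1_def by (rule landau_o.big_trans)
    fix n F assume "w_cnf w n F \<and> real (length F) \<le> c * real n"
    then obtain t' where "real t' \<le> H n" "computes Q (cnf_input n F) t' [of_bool (satisfiable F)]"
      using main by blast
    then show "\<exists>t\<le>nat \<lfloor>H n\<rfloor>. computes Q (cnf_input n F) t [of_bool (satisfiable F)]"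
      by (intro exI[of _ t']) (simp add: le_nat_floor)
  qed
qed

theorem theorem1p5:
  shows "\<exists>(e :: real \<Rightarrow> nat) (p :: real poly poly).
    (\<forall>\<epsilon>>0. e \<epsilon> \<ge> 1) \<and>
    (\<forall>a b :: nat. a \<ge> 1 \<and> b \<ge> 1 \<longrightarrow> poly2 p (real a) (real b) \<ge> 1) \<and>
    (SETH \<longrightarrow>
      (\<forall>(k :: nat) (\<epsilon> :: real). k \<ge> 2 \<and> \<epsilon> > 0 \<longrightarrow>
        \<not> (\<exists>P. approximates_DomSet_in_time P k
              (\<lambda>n. log 2 (real n) powr (1 / poly2 p (real k) (real (e \<epsilon>))))
              (\<lambda>n. real n powr (real k - \<epsilon>)))))"
proof -
  \<comment> \<open>16 times the first variable, constant in the second one.\<close>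
  define p :: "real poly poly" where "p = [:[:0, 16:]:]"
  have p: "poly2 p a b = 16 * a" for a b by (simp add: poly2_def p_def)
  show ?thesis
  proof (rule exI[of _ "\<lambda>_. 1"], rule exI[of _ p], intro conjI allI impI notI)
    fix k :: nat and \<epsilon> :: real
    assume SETH and k: "k \<ge> 2 \<and> \<epsilon> > 0" and
      "\<exists>P. approximates_DomSet_in_time P k
          (\<lambda>n. log 2 (real n) powr (1 / poly2 p (real k) (real 1))) (\<lambda>n. real n powr (real k - \<epsilon>))"
    then obtain P where P: "approximates_DomSet_in_time P k
          (\<lambda>n. log 2 (real n) powr (1 / (16 * real k))) (\<lambda>n. real n powr (real k - \<epsilon>))"
      unfolding p by blast
    have "min \<epsilon> 1 / (2 * real k) > 0" using k by simp
    \<comment> \<open>SETH is applied to the saving that the reduction leaves, in its form for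
      linearly many clauses.\<close>
    then obtain w c where
      "\<not> SAT_in_time (min \<epsilon> 1 / (2 * real k)) (\<lambda>n F. w_cnf w n F \<and> real (length F) \<le> c * real n)"
      using \<open>SETH\<close> unfolding SETH_def by blast
    then show False using approximation_decides_SAT[OF _ _ P] k by blast
  qed (simp_all add: p)
qed

end
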